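(* Let $V$ be a Euclidean vector space, let $\sigma:V\to X$ be an infinitesimal manifold submetry, let $\mathcal{F}$ be the partition of $V$ into the fibers of $\sigma$, let $A=\mathcal{B}(\sigma)$ be its algebra of basic polynomials, and let $k\geq 2$ be an integer. Assume that $\mathcal{F}$ satisfies $k$-NS, and that the restriction of $\mathcal{F}^{(k)}$ to the saturated subspace $V\times\{0\}\times\cdots\times\{0\}\subset V^k$ coincides with $\mathcal{F}$ under the identification $v\mapsto(v,0,\dots,0)$. Then $\mathcal{F}$ is homogeneous, that is, $\mathcal{F}$ is the decomposition of $V$ into the orbits of some compact subgroup of $\mathrm{O}(V)$.
   Context: A Euclidean vector space is a finite-dimensional real inner product space; $\mathbb{R}[V]$ is its algebra of real polynomial functions and $\mathrm{O}(V)$ its orthogonal group. A submetry is a map between metric spaces which maps each closed metric ball of radius $\rho$ around $x$ onto the closed ball of radius $\rho$ around the image of $x$. A manifold submetry is a submetry from a Riemannian manifold to a metric space such that each fiber is a (possibly disconnected) embedded smooth submanifold. An infinitesimal manifold submetry is a manifold submetry $\sigma:V\to X$ from a Euclidean vector space $V$ such that $\{0\}$ is a fiber. $\mathcal{B}(\sigma)\subset\mathbb{R}[V]$ is the algebra of all polynomials constant on each fiber of $\sigma$. A subset is saturated with respect to a partition if it is a union of members (leaves) of the partition. $k$-NS ($k$ normal spaces condition): there is a non-empty open subset $U\subset V^k$ such that for all $(x_1,\dots,x_k)\in U$ one has $\nu_{x_1}(L_{x_1})+\cdots+\nu_{x_k}(L_{x_k})=V$, where for $x\in V$, $L_x$ is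 the $\sigma$-fiber through $x$ and $\nu_x(L_x)\subset V$ is the normal space to $L_x$ at $x$ (the orthogonal complement of the tangent space). In orthonormal coordinates $x_i$ on a Euclidean vector space $W$, a sub-algebra of $\mathbb{R}[W]$ is called Laplacian if it contains $r^2=\sum_i x_i^2$ and is preserved by $\Delta=\sum_i\partial^2/\partial x_i^2$. The algebra $\mathcal{B}(\sigma)$ is Laplacian. For a Laplacian sub-algebra $A\subset\mathbb{R}[V]$, the algebra of generalized polarizations $A^{(k)}\subset\mathbb{R}[V^k]$ is the smallest Laplacian sub-algebra of $\mathbb{R}[V^k]$ (with the product inner product on $V^k$) containing all polynomials $(v_1,\dots,v_k)\mapsto f(v_1)$ with $f\in A$, and all polynomials $(v_1,\dots,v_k)\mapsto\langle v_i,v_j\rangle$ with $1\le i,j\le k$. $\mathcal{F}^{(k)}$ denotes the partition of $V^k$ into the fibers of the infinitesimal manifold submetry from $V^k$ whose algebra of basic polynomials is $A^{(k)}$ (it exists and its fibers are unique); equivalently, the leaves of $\mathcal{F}^{(k)}$ are the equivalence classes of the relation on $V^k$ identifying two points when all elements of $A^{(k)}$ take the same value on them. The subspace $V\times\{0\}\times\cdots\times\{0\}$ is $\mathcal{F}^{(k)}$-saturated. *)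

theory Defs
  imports "HOL-Analysis.Analysis" "HOL-Algebra.Group"
begin

subsection \<open>Submanifolds of a Euclidean space\<close>

text \<open>Both notions are meant for open \<open>U\<close> only.\<close>

primrec C_times_on :: "nat \<Rightarrow> 'a set \<Rightarrow> ('a::euclidean_space \<Rightarrow> 'b::euclidean_space) \<Rightarrow> bool" where
  "C_times_on 0 U f \<longleftrightarrow> continuous_on U f"
| "C_times_on (Suc n) U f \<longleftrightarrow> f differentiable_on U \<and>
     (\<forall>v. C_times_on n U (\<lambda>x. frechet_derivative f (at x) v))"

definition smooth_on :: "'a set \<Rightarrow> ('a::euclidean_space \<Rightarrow> 'b::euclidean_space) \<Rightarrow> bool" where
  "smooth_on U f \<longleftrightarrow> (\<forall>n. C_times_on n U f)"

text \<open>Submanifolds need not be connected, but all components have the same dimension \<open>d\<close>.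
  The maps \<open>\<phi>\<close> are slice charts of the ambient space.\<close>

definition embedded_submanifold :: "nat \<Rightarrow> 'a::euclidean_space set \<Rightarrow> bool" where
  "embedded_submanifold d S \<longleftrightarrow>
     (\<forall>x\<in>S. \<exists>U W (\<phi> :: 'a \<Rightarrow> 'a) \<psi> T. open U \<and> open W \<and> x \<in> U \<and>
        homeomorphism U W \<phi> \<psi> \<and> smooth_on U \<phi> \<and> smooth_on W \<psi> \<and>
        subspace T \<and> dim T = d \<and> \<phi> ` (S \<inter> U) = T \<inter> W)"

definition tangent_space :: "'a::euclidean_space set \<Rightarrow> 'a \<Rightarrow> 'a set" where
  "tangent_space S x =
     {v. \<exists>(\<gamma> :: real \<Rightarrow> 'a) \<epsilon>. \<epsilon> > 0 \<and> smooth_on {-\<epsilon><..<\<epsilon>} \<gamma> \<and> \<gamma> ` {-\<epsilon><..<\<epsilon>} \<subseteq> S \<and>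
        \<gamma> 0 = x \<and> (\<gamma> has_vector_derivative v) (at 0)}"

definition normal_space :: "'a::euclidean_space set \<Rightarrow> 'a \<Rightarrow> 'a set" where
  "normal_space S x = orthogonal_comp (tangent_space S x)"


subsection \<open>Manifold submetries\<close>

definition submetry :: "('a::metric_space \<Rightarrow> 'x::metric_space) \<Rightarrow> bool" where
  "submetry \<sigma> \<longleftrightarrow> (\<forall>x. \<forall>\<rho>\<ge>0. \<sigma> ` cball x \<rho> = cball (\<sigma> x) \<rho>)"

definition fiber :: "('a \<Rightarrow> 'x) \<Rightarrow> 'a \<Rightarrow> 'a set" where
  "fiber \<sigma> x = \<sigma> -` {\<sigma> x}"

definition fibers :: "('a \<Rightarrow> 'x) \<Rightarrow> 'a set set" where
  "fibers \<sigma> = range (fiber \<sigma>)"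

definition manifold_submetry :: "('a::euclidean_space \<Rightarrow> 'x::metric_space) \<Rightarrow> bool" where
  "manifold_submetry \<sigma> \<longleftrightarrow> submetry \<sigma> \<and> (\<forall>L\<in>fibers \<sigma>. \<exists>d. embedded_submanifold d L)"

definition infinitesimal_manifold_submetry ::
    "('a::euclidean_space \<Rightarrow> 'x::metric_space) \<Rightarrow> bool" where
  "infinitesimal_manifold_submetry \<sigma> \<longleftrightarrow> manifold_submetry \<sigma> \<and> {0} \<in> fibers \<sigma>"

text \<open>Powers \<open>V\<^sup>k\<close> are rendered as \<open>'a ^ 'k\<close>, with \<open>k = CARD('k)\<close>;
  the inner product of this type is the product inner product.\<close>

definition normal_spaces_condition ::
    "'k::finite itself \<Rightarrow> ('a::euclidean_space \<Rightarrow> 'x) \<Rightarrow> bool" where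
  "normal_spaces_condition _ \<sigma> \<longleftrightarrow>
     (\<exists>U :: ('a ^ 'k) set. open U \<and> U \<noteq> {} \<and>
        (\<forall>x\<in>U. {\<Sum>i\<in>UNIV. w i |w. \<forall>i. w i \<in> normal_space (fiber \<sigma> (x $ i)) (x $ i)} = UNIV))"


subsection \<open>Laplacian algebras and generalized polarizations\<close>

definition basic_polynomials :: "('a::euclidean_space \<Rightarrow> 'x) \<Rightarrow> ('a \<Rightarrow> real) set" where
  "basic_polynomials \<sigma> =
     {f. real_polynomial_function f \<and> (\<forall>L\<in>fibers \<sigma>. \<forall>x\<in>L. \<forall>y\<in>L. f x = f y)}"

definition laplacian :: "('a::euclidean_space \<Rightarrow> real) \<Rightarrow> 'a \<Rightarrow> real" where
  "laplacian f x = (\<Sum>b\<in>Basis. (deriv ^^ 2) (\<lambda>t. f (x + t *\<^sub>R b)) 0)"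

definition polynomial_subalgebra :: "('a::euclidean_space \<Rightarrow> real) set \<Rightarrow> bool" where
  "polynomial_subalgebra B \<longleftrightarrow> B \<subseteq> Collect real_polynomial_function \<and>
     (\<forall>c. (\<lambda>_. c) \<in> B) \<and>
     (\<forall>f\<in>B. \<forall>g\<in>B. (\<lambda>x. f x + g x) \<in> B \<and> (\<lambda>x. f x * g x) \<in> B)"

definition laplacian_subalgebra :: "('a::euclidean_space \<Rightarrow> real) set \<Rightarrow> bool" where
  "laplacian_subalgebra B \<longleftrightarrow> polynomial_subalgebra B \<and>
     (\<lambda>x. \<Sum>b\<in>Basis. (x \<bullet> b)\<^sup>2) \<in> B \<and> (\<forall>f\<in>B. laplacian f \<in> B)"

text \<open>The index \<open>i\<close> singles out the factor of \<open>V\<^sup>k\<close> that is called the first one.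
  For \<open>A\<close> consisting of polynomials, the intersection is over a nonempty family, since all
  polynomial functions on \<open>V\<^sup>k\<close> form a Laplacian sub-algebra.\<close>

definition generalized_polarizations ::
    "'k::finite \<Rightarrow> ('a::euclidean_space \<Rightarrow> real) set \<Rightarrow> ('a ^ 'k \<Rightarrow> real) set" where
  "generalized_polarizations i A =
     \<Inter>{B. laplacian_subalgebra B \<and> (\<forall>f\<in>A. (\<lambda>v. f (v $ i)) \<in> B) \<and>
          (\<forall>j l. (\<lambda>v. v $ j \<bullet> v $ l) \<in> B)}"


subsection \<open>Partitions\<close>

text \<open>For \<open>B = A\<^sup>(\<^sup>k\<^sup>)\<close>, the classes are the leaves of \<open>\<F>\<^sup>(\<^sup>k\<^sup>)\<close>.\<close>

definition level_partition :: "('a \<Rightarrow> real) set \<Rightarrow> 'a set set" where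
  "level_partition B = UNIV // {(x, y). \<forall>f\<in>B. f x = f y}"

definition restrict_partition :: "'a set set \<Rightarrow> 'a set \<Rightarrow> 'a set set" where
  "restrict_partition P W = {L \<inter> W |L. L \<in> P \<and> L \<inter> W \<noteq> {}}"

definition orthogonal_group :: "('a::euclidean_space \<Rightarrow>\<^sub>L 'a) monoid" where
  "orthogonal_group =
     \<lparr>carrier = {g. orthogonal_transformation (blinfun_apply g)},
      mult = (o\<^sub>L), one = id_blinfun\<rparr>"

text \<open>Compactness refers to the operator norm.\<close>

definition homogeneous :: "'a::euclidean_space set set \<Rightarrow> bool" where
  "homogeneous P \<longleftrightarrow>
     (\<exists>G. subgroup G orthogonal_group \<and> compact G \<and>
        P = range (\<lambda>x. (\<lambda>g. blinfun_apply g x) ` G))"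

end

theory Submission
  imports Defs "HOL-Probability.Distributions"
begin

text \<open>
  Let \<open>A\<close> be the algebra of basic polynomials, \<open>B\<close> the algebra of generalized polarizations, and call two points
  of \<open>V\<^sup>k\<close> equivalent if \<open>B\<close> does not separate them. The group of all orthogonal maps of \<open>V\<close> that
  leave every element of \<open>A\<close> invariant is closed in the orthogonal group, hence compact. Its orbits turn out to
  be the fibers.

  The assumption on the restriction to \<open>V \<times> 0 \<times> \<dots> \<times> 0\<close> has two consequences (\<open>restricted_polarizations\<close>):
  restrictions of elements of \<open>B\<close> lie in \<open>A\<close>, and \<open>A\<close> separates the fibers. So symmetries
  of \<open>A\<close> preserve the fibers, and points \<open>p\<close> and \<open>q\<close> of one fiber give equivalent points \<open>(p, 0, \<dots>, 0)\<close> and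
  \<open>(q, 0, \<dots>, 0)\<close>. It remains to find a symmetry of \<open>A\<close> that maps \<open>p\<close> to \<open>q\<close>. Four facts are combined.

  \<^item> Equivalence classes of a Laplacian algebra are equidistant (\<open>same_values_equidistant\<close>): if \<open>p\<close> and
  \<open>q\<close> are equivalent, then each \<open>x\<close> has an equivalent \<open>y\<close> with \<open>p \<bullet> x \<le> q \<bullet> y\<close>. As \<open>B\<close> is preserved by the
  Laplacian, equivalent points see the same heat: the integrals of an element of \<open>B\<close> against Gaussians
  centred at \<open>p\<close> and at \<open>q\<close> agree. High powers of suitable elements of \<open>B\<close> concentrate these integrals near the
  class of \<open>x\<close>, and Laplace asymptotics yield the inequality of the maxima of the linear forms.

  \<^item> At some point of \<open>V\<^sup>k\<close> the gradients of elements of \<open>A\<close> in the \<open>k\<close> slots span \<open>V\<close>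
  (\<open>normal_spaces_imp_gradients_span\<close>). Because \<open>A\<close> separates the fibers, at points where the rank of the
  gradients is locally maximal a fiber is, locally, a level set of functions with independent gradients, so that the normal
  space consists of gradients; now use the normal spaces condition. Spanning is an open algebraic condition, so it
  persists along a line through such a point up to finitely many exceptions.

  \<^item> The inner products of these gradients are invariant on classes (\<open>grad_inner_grad\<close>). If \<open>x\<close> and \<open>y\<close> are
  equivalent and the gradients at \<open>x\<close> span, there is therefore an isometry \<open>g\<close> that maps the gradients at
  \<open>x\<close> to those at \<open>y\<close>.

  \<^item> This isometry leaves \<open>A\<close> invariant (\<open>rigidity\<close>). Shears that add the gradient of an element of \<open>A\<close>
  at one slot to another slot preserve equivalence (\<open>preserves_shear\<close>). Moving one slot of \<open>x\<close> and of \<open>y\<close> by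
  such shears does not change \<open>g\<close> (\<open>transport_locally_constant\<close>), and after the motion one may still add gradients
  taken at the moved slot itself (\<open>slot_value_add_gradients\<close>). This reaches an open set.

  Finally, take points \<open>x\<close> with spanning gradients that tend to \<open>(p, 0, \<dots>, 0)\<close>, equivalent points \<open>y\<close> with
  \<open>p \<bullet> x\<^sub>1 \<le> q \<bullet> y\<^sub>1\<close>, and the symmetries \<open>g\<close> with \<open>g x\<^sub>1 = y\<^sub>1\<close>. A limit \<open>h\<close> of these symmetries
  satisfies \<open>p \<bullet> p \<le> q \<bullet> h p\<close>, and \<open>h p = q\<close> because all norms agree.
\<close>

section \<open>Gradients and Hessians of polynomial functions\<close>

definition grad :: "('a::euclidean_space \<Rightarrow> real) \<Rightarrow> 'a \<Rightarrow> 'a" where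
  "grad f x = (\<Sum>b\<in>Basis. frechet_derivative f (at x) b *\<^sub>R b)"

definition hess :: "('a::euclidean_space \<Rightarrow> real) \<Rightarrow> 'a \<Rightarrow> 'a \<Rightarrow> 'a" where
  "hess f x = frechet_derivative (grad f) (at x)"

lemma grad_eqI:
  assumes "(f has_derivative (\<lambda>h. g \<bullet> h)) (at x)"
  shows "grad f x = g"
  unfolding grad_def frechet_derivative_at[OF assms, symmetric] by (simp add: euclidean_representation)

lemma has_derivative_grad:
  assumes "real_polynomial_function f"
  shows "(f has_derivative (\<lambda>h. grad f x \<bullet> h)) (at x)"
proof -
  have f: "(f has_derivative frechet_derivative f (at x)) (at x)"
    using differentiable_at_real_polynomial_function[OF assms] frechet_derivative_works by blast
  then interpret L: linear "frechet_derivative f (at x)"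
    by (rule has_derivative_linear)
  have "frechet_derivative f (at x) h = grad f x \<bullet> h" for h
  proof -
    have "frechet_derivative f (at x) h = frechet_derivative f (at x) (\<Sum>b\<in>Basis. (h \<bullet> b) *\<^sub>R b)"
      by (simp add: euclidean_representation)
    also have "\<dots> = (\<Sum>b\<in>Basis. (h \<bullet> b) * frechet_derivative f (at x) b)"
      by (simp add: L.sum L.scale)
    also have "\<dots> = grad f x \<bullet> h"
      unfolding grad_def inner_sum_left by (intro sum.cong) (auto simp: inner_commute)
    finally show ?thesis .
  qed
  then show ?thesis using f by (metis (no_types, lifting) ext)
qed

lemma grad_add:
  assumes "real_polynomial_function f" "real_polynomial_function g"
  shows "grad (\<lambda>x. f x + g x) x = grad f x + grad g x"
  by (intro grad_eqI) (auto intro!: derivative_eq_intros has_derivative_grad assms simp: inner_add_left)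

lemma grad_mult:
  assumes "real_polynomial_function f" "real_polynomial_function g"
  shows "grad (\<lambda>x. f x * g x) x = f x *\<^sub>R grad g x + g x *\<^sub>R grad f x"
  by (intro grad_eqI)
     (auto intro!: derivative_eq_intros has_derivative_grad assms simp: inner_add_left algebra_simps)

lemma grad_const [simp]: "grad (\<lambda>x. c) x = 0"
  by (intro grad_eqI) (auto intro!: derivative_eq_intros)

lemma bounded_linear_euclidean_inner:
  fixes f :: "'a::euclidean_space \<Rightarrow> real"
  assumes "bounded_linear f"
  obtains g where "f = (\<lambda>x. g \<bullet> x)"
proof -
  interpret bounded_linear f by fact
  have "f x = (\<Sum>b\<in>Basis. f b *\<^sub>R b) \<bullet> x" for x
  proof -
    have "f x = f (\<Sum>b\<in>Basis. (x \<bullet> b) *\<^sub>R b)" by (simp add: euclidean_representation)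
    also have "\<dots> = (\<Sum>b\<in>Basis. (x \<bullet> b) * f b)" by (simp add: sum scale)
    also have "\<dots> = (\<Sum>b\<in>Basis. f b *\<^sub>R b) \<bullet> x"
      unfolding inner_sum_left by (intro sum.cong) (auto simp: inner_commute)
    finally show ?thesis .
  qed
  then show ?thesis using that by blast
qed

lemma grad_inner [simp]: "grad (\<lambda>x. g \<bullet> x) x = g"
  by (intro grad_eqI) (auto intro!: derivative_eq_intros)

lemma polynomial_grad:
  assumes "real_polynomial_function f"
  shows "polynomial_function (grad f)"
  using assms
proof induction
  case (linear f)
  then obtain g where "f = (\<lambda>x. g \<bullet> x)" by (rule bounded_linear_euclidean_inner)
  moreover have "grad (\<lambda>x. g \<bullet> x) = (\<lambda>x. g)" by auto
  ultimately show ?case by simp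
next
  case (const c)
  have "grad (\<lambda>x. c) = (\<lambda>x::'a. 0)" by auto
  then show ?case by simp
next
  case (add f g)
  have "grad (\<lambda>x. f x + g x) = (\<lambda>x. grad f x + grad g x)" using add grad_add by blast
  then show ?case using add by (metis polynomial_function_add)
next
  case (mult f g)
  have "grad (\<lambda>x. f x * g x) = (\<lambda>x. f x *\<^sub>R grad g x + g x *\<^sub>R grad f x)"
    using mult grad_mult by blast
  moreover have "polynomial_function f" "polynomial_function g"
    using mult.hyps unfolding real_polynomial_function_eq .
  ultimately show ?case
    using mult.IH by (simp only:) (intro polynomial_function_add polynomial_function_mult)
qed

lemma real_polynomial_inner:
  fixes f g :: "'a::real_normed_vector \<Rightarrow> 'b::euclidean_space"
  assumes "polynomial_function f" "polynomial_function g"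
  shows "real_polynomial_function (\<lambda>x. f x \<bullet> g x)"
proof -
  have "(\<lambda>x. f x \<bullet> g x) = (\<lambda>x. \<Sum>b\<in>Basis. (f x \<bullet> b) * (g x \<bullet> b))"
    using euclidean_inner by blast
  moreover have "real_polynomial_function (\<lambda>x. \<Sum>b\<in>Basis. (f x \<bullet> b) * (g x \<bullet> b))"
    by (rule real_polynomial_function_sum[OF finite_Basis], rule real_polynomial_function.intros(4))
       (use assms in \<open>simp_all add: polynomial_function_iff_Basis_inner\<close>)
  ultimately show ?thesis by simp
qed

lemma grad_norm2: "grad (\<lambda>x. x \<bullet> x) x = 2 *\<^sub>R x"
  by (intro grad_eqI) (auto intro!: derivative_eq_intros simp: inner_commute)

lemma continuous_grad: "real_polynomial_function f \<Longrightarrow> continuous_on S (grad f)"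
  by (simp add: continuous_on_polymonial_function polynomial_grad)

lemma has_derivative_hess:
  assumes "real_polynomial_function f"
  shows "(grad f has_derivative hess f x) (at x)"
  unfolding hess_def
  using differentiable_at_polynomial_function[OF polynomial_grad[OF assms]] frechet_derivative_works
  by blast

lemma linear_hess:
  assumes "real_polynomial_function f"
  shows "linear (hess f x)"
  using has_derivative_hess[OF assms] has_derivative_linear by blast

lemma hess_eqI:
  assumes "(grad f has_derivative D) (at x)"
  shows "hess f x = D"
  unfolding hess_def using frechet_derivative_at[OF assms] by simp

lemma hess_add:
  assumes f: "real_polynomial_function f" and g: "real_polynomial_function g"
  shows "hess (\<lambda>x. f x + g x) x u = hess f x u + hess g x u"
proof -
  have *: "grad (\<lambda>x. f x + g x) = (\<lambda>x. grad f x + grad g x)" using grad_add[OF f g] by auto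
  have "hess (\<lambda>x. f x + g x) x = (\<lambda>u. hess f x u + hess g x u)"
    by (intro hess_eqI, unfold *) (auto intro!: derivative_eq_intros has_derivative_hess f g)
  then show ?thesis by simp
qed

lemma hess_mult:
  assumes f: "real_polynomial_function f" and g: "real_polynomial_function g"
  shows "hess (\<lambda>x. f x * g x) x u = f x *\<^sub>R hess g x u + (grad f x \<bullet> u) *\<^sub>R grad g x +
    (g x *\<^sub>R hess f x u + (grad g x \<bullet> u) *\<^sub>R grad f x)"
proof -
  have *: "grad (\<lambda>x. f x * g x) = (\<lambda>x. f x *\<^sub>R grad g x + g x *\<^sub>R grad f x)"
    using grad_mult[OF f g] by auto
  have "hess (\<lambda>x. f x * g x) x = (\<lambda>u. f x *\<^sub>R hess g x u + (grad f x \<bullet> u) *\<^sub>R grad g x +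
         (g x *\<^sub>R hess f x u + (grad g x \<bullet> u) *\<^sub>R grad f x))"
    by (intro hess_eqI, unfold *)
       (auto intro!: derivative_eq_intros has_derivative_hess has_derivative_grad f g)
  then show ?thesis by simp
qed

lemma hess_sym:
  assumes "real_polynomial_function f"
  shows "hess f x u \<bullet> w = hess f x w \<bullet> u"
  using assms
proof induction
  case (linear f)
  then obtain g where "f = (\<lambda>x. g \<bullet> x)" by (rule bounded_linear_euclidean_inner)
  moreover have "grad (\<lambda>x. g \<bullet> x) = (\<lambda>x. g)" by auto
  ultimately have "hess f x = (\<lambda>u. 0)" by (intro hess_eqI) auto
  then show ?case by simp
next
  case (const c)
  have "grad (\<lambda>x. c) = (\<lambda>x::'a. 0)" by auto
  then have "hess (\<lambda>x. c) x = (\<lambda>u. 0)" by (intro hess_eqI) auto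
  then show ?case by simp
next
  case (add f g)
  then show ?case by (simp add: hess_add inner_add_left)
next
  case (mult f g)
  then show ?case by (simp add: hess_mult inner_add_left inner_commute algebra_simps)
qed

lemma has_derivative_along_line:
  assumes "(f has_derivative D) (at (x + s *\<^sub>R u))"
  shows "((\<lambda>s. f (x + s *\<^sub>R u)) has_vector_derivative D u) (at s)"
proof -
  have "((\<lambda>s. f (x + s *\<^sub>R u)) has_derivative (\<lambda>h. D (h *\<^sub>R u))) (at s)"
    by (rule has_derivative_compose[of "\<lambda>s. x + s *\<^sub>R u" _ s UNIV f D])
       (use assms in \<open>auto intro!: derivative_eq_intros\<close>)
  then show ?thesis
    using linear_cmul[OF has_derivative_linear[OF assms]] by (simp add: has_vector_derivative_def)
qed

lemma deriv_along_line:
  assumes "real_polynomial_function f"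
  shows "((\<lambda>s. f (x + s *\<^sub>R u)) has_real_derivative grad f (x + s *\<^sub>R u) \<bullet> u) (at s)"
  using has_derivative_along_line[OF has_derivative_grad[OF assms]]
  by (simp add: has_real_derivative_iff_has_vector_derivative)

lemma polynomial_along_line:
  assumes "real_polynomial_function f"
  shows "\<exists>R. \<forall>s. f (x + s *\<^sub>R u) = poly R s"
  using assms
proof induction
  case (linear f)
  then interpret bounded_linear f .
  show ?case by (rule exI[of _ "[:f x, f u:]"]) (simp add: add scale)
next
  case (const c)
  show ?case by (rule exI[of _ "[:c:]"]) simp
next
  case (add f g)
  then obtain R R' where "\<forall>s. f (x + s *\<^sub>R u) = poly R s" "\<forall>s. g (x + s *\<^sub>R u) = poly R' s" by blast
  then show ?case by (intro exI[of _ "R + R'"]) simp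
next
  case (mult f g)
  then obtain R R' where "\<forall>s. f (x + s *\<^sub>R u) = poly R s" "\<forall>s. g (x + s *\<^sub>R u) = poly R' s" by blast
  then show ?case by (intro exI[of _ "R * R'"]) simp
qed

lemma polynomial_zero_near_imp_zero:
  assumes "real_polynomial_function f" "\<epsilon> > 0" "\<And>v. norm v < \<epsilon> \<Longrightarrow> f v = 0"
  shows "f v = 0"
proof -
  obtain R where R: "\<And>s. f (0 + s *\<^sub>R v) = poly R s" using polynomial_along_line[OF assms(1)] by blast
  define \<delta> where "\<delta> = \<epsilon> / (norm v + 1)"
  have d: "\<delta> > 0" using assms(2) by (simp add: \<delta>_def add_nonneg_pos)
  have "poly R s = 0" if "s \<in> {0<..<\<delta>}" for s
  proof -
    have "norm (s *\<^sub>R v) \<le> s * (norm v + 1)" using that by (simp add: algebra_simps)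
    also have "\<dots> < \<delta> * (norm v + 1)" using that by (intro mult_strict_right_mono) (auto simp: add_nonneg_pos)
    also have "\<dots> = \<epsilon>" by (simp add: \<delta>_def add_nonneg_pos less_imp_neq[symmetric])
    finally show ?thesis using assms(3)[of "s *\<^sub>R v"] R by simp
  qed
  then have "{0<..<\<delta>} \<subseteq> {s. poly R s = 0}" by auto
  moreover have "infinite {0<..<\<delta>}" using d by (simp add: infinite_Ioo)
  ultimately have "R = 0" using poly_roots_finite finite_subset by blast
  then show ?thesis using R[of 1] by simp
qed

lemma laplacian_conv_hess:
  assumes "real_polynomial_function f"
  shows "laplacian f x = (\<Sum>b\<in>Basis. hess f x b \<bullet> b)"
proof -
  have "(deriv ^^ 2) (\<lambda>t. f (x + t *\<^sub>R b)) 0 = hess f x b \<bullet> b" for b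
  proof -
    have "deriv (\<lambda>t. f (x + t *\<^sub>R b)) = (\<lambda>t. grad f (x + t *\<^sub>R b) \<bullet> b)"
      using deriv_along_line[OF assms] DERIV_imp_deriv by blast
    moreover have "((\<lambda>t. grad f (x + t *\<^sub>R b)) has_vector_derivative hess f x b) (at 0)"
      using has_derivative_along_line[of "grad f" "hess f x" x 0 b] has_derivative_hess[OF assms, of x] by simp
    then have "((\<lambda>t. grad f (x + t *\<^sub>R b) \<bullet> b) has_real_derivative hess f x b \<bullet> b) (at 0)"
      unfolding has_real_derivative_iff_has_vector_derivative
      by (auto intro!: derivative_eq_intros simp: has_vector_derivative_def)
    then have "deriv (\<lambda>t. grad f (x + t *\<^sub>R b) \<bullet> b) 0 = hess f x b \<bullet> b" by (rule DERIV_imp_deriv)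
    ultimately show ?thesis by (simp add: numeral_2_eq_2)
  qed
  then show ?thesis by (simp add: laplacian_def)
qed

lemma laplacian_add:
  assumes "real_polynomial_function f" "real_polynomial_function g"
  shows "laplacian (\<lambda>x. f x + g x) x = laplacian f x + laplacian g x"
  using assms
  by (simp add: laplacian_conv_hess real_polynomial_function.intros(3) hess_add inner_add_left sum.distrib)

lemma laplacian_mult:
  assumes "real_polynomial_function f" "real_polynomial_function g"
  shows "laplacian (\<lambda>x. f x * g x) x =
    f x * laplacian g x + g x * laplacian f x + 2 * (grad f x \<bullet> grad g x)"
  using assms euclidean_inner[of "grad f x" "grad g x"]
  by (simp add: laplacian_conv_hess real_polynomial_function.intros(4) hess_mult inner_add_left sum.distrib
      sum_distrib_left mult_ac)

lemma real_polynomial_hess: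
  assumes "real_polynomial_function f" "polynomial_function u" "polynomial_function w"
  shows "real_polynomial_function (\<lambda>x. hess f x (u x) \<bullet> w x)"
proof -
  have comp: "real_polynomial_function (\<lambda>x. grad f x \<bullet> b)" for b
    by (rule real_polynomial_inner[OF polynomial_grad[OF assms(1)] polynomial_function_const])
  have h: "hess f x v \<bullet> b = grad (\<lambda>x. grad f x \<bullet> b) x \<bullet> v" for x v b
  proof -
    have "((\<lambda>x. grad f x \<bullet> b) has_derivative (\<lambda>v. hess f x v \<bullet> b)) (at x)"
      by (auto intro!: derivative_eq_intros has_derivative_hess assms)
    moreover have "((\<lambda>x. grad f x \<bullet> b) has_derivative (\<lambda>v. grad (\<lambda>x. grad f x \<bullet> b) x \<bullet> v)) (at x)"
      using has_derivative_grad[OF comp] .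
    ultimately have "(\<lambda>v. hess f x v \<bullet> b) = (\<lambda>v. grad (\<lambda>x. grad f x \<bullet> b) x \<bullet> v)"
      by (rule has_derivative_unique)
    from fun_cong[OF this, of v] show ?thesis .
  qed
  have "hess f x (u x) \<bullet> w x = (\<Sum>b\<in>Basis. (grad (\<lambda>x. grad f x \<bullet> b) x \<bullet> u x) * (w x \<bullet> b))" for x
    by (subst euclidean_inner) (simp add: h)
  moreover have "real_polynomial_function (\<lambda>x. \<Sum>b\<in>Basis. (grad (\<lambda>x. grad f x \<bullet> b) x \<bullet> u x) * (w x \<bullet> b))"
    by (rule real_polynomial_function_sum[OF finite_Basis], rule real_polynomial_function.intros(4))
       (rule real_polynomial_inner polynomial_grad comp assms polynomial_function_const)+
  ultimately show ?thesis by simp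
qed

lemma polynomial_hess:
  assumes "real_polynomial_function f" "polynomial_function u"
  shows "polynomial_function (\<lambda>x. hess f x (u x))"
  unfolding polynomial_function_iff_Basis_inner
  using real_polynomial_hess[OF assms] by simp

lemma real_polynomial_laplacian:
  assumes "real_polynomial_function f"
  shows "real_polynomial_function (laplacian f)"
proof -
  have "laplacian f = (\<lambda>x. \<Sum>b\<in>Basis. hess f x b \<bullet> b)" using laplacian_conv_hess[OF assms] by auto
  moreover have "real_polynomial_function (\<lambda>x. \<Sum>b\<in>Basis. hess f x b \<bullet> b)"
    by (rule real_polynomial_function_sum[OF finite_Basis])
       (rule real_polynomial_hess[OF assms polynomial_function_const polynomial_function_const])
  ultimately show ?thesis by simp
qed

section \<open>Laplacian algebras and flows that preserve their level sets\<close>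

definition same_values :: "('a \<Rightarrow> real) set \<Rightarrow> 'a \<Rightarrow> 'a \<Rightarrow> bool" where
  "same_values B x y \<longleftrightarrow> (\<forall>F\<in>B. F x = F y)"

lemma grad_dot:
  assumes "(f has_derivative D) (at x)"
  shows "grad f x \<bullet> u = D u"
proof -
  interpret bounded_linear D using assms by (rule has_derivative_bounded_linear)
  obtain g where g: "D = (\<lambda>u. g \<bullet> u)"
    using bounded_linear_euclidean_inner[OF bounded_linear_axioms] .
  then show ?thesis using grad_eqI[of f g x] assms by simp
qed

context
  fixes B :: "('a::euclidean_space \<Rightarrow> real) set"
  assumes B: "laplacian_subalgebra B"
begin

lemma lap_poly: "F \<in> B \<Longrightarrow> real_polynomial_function F"
  using B by (auto simp: laplacian_subalgebra_def polynomial_subalgebra_def)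

lemma lap_const: "(\<lambda>_. c) \<in> B"
  using B by (auto simp: laplacian_subalgebra_def polynomial_subalgebra_def)

lemma lap_add: "F \<in> B \<Longrightarrow> H \<in> B \<Longrightarrow> (\<lambda>x. F x + H x) \<in> B"
  using B by (auto simp: laplacian_subalgebra_def polynomial_subalgebra_def)

lemma lap_mult: "F \<in> B \<Longrightarrow> H \<in> B \<Longrightarrow> (\<lambda>x. F x * H x) \<in> B"
  using B by (auto simp: laplacian_subalgebra_def polynomial_subalgebra_def)

lemma lap_laplacian: "F \<in> B \<Longrightarrow> laplacian F \<in> B"
  using B by (auto simp: laplacian_subalgebra_def)

lemma lap_cmult: "F \<in> B \<Longrightarrow> (\<lambda>x. c * F x) \<in> B"
  using lap_mult[OF lap_const] by simp

lemma lap_diff: "F \<in> B \<Longrightarrow> H \<in> B \<Longrightarrow> (\<lambda>x. F x - H x) \<in> B"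
  using lap_add[of F "\<lambda>x. (-1) * H x"] lap_cmult[of H "-1"] by simp

lemma lap_power: "F \<in> B \<Longrightarrow> (\<lambda>x. F x ^ n) \<in> B"
  by (induction n) (auto intro: lap_const lap_mult)

lemma lap_sum: "finite I \<Longrightarrow> (\<And>i. i \<in> I \<Longrightarrow> F i \<in> B) \<Longrightarrow> (\<lambda>x. \<Sum>i\<in>I. F i x) \<in> B"
  by (induction I rule: finite_induct) (auto intro: lap_const lap_add)

lemma lap_norm2: "(\<lambda>x. x \<bullet> x) \<in> B"
proof -
  have "(\<lambda>x. \<Sum>b\<in>Basis. (x \<bullet> b)\<^sup>2) \<in> B" using B by (simp add: laplacian_subalgebra_def)
  moreover have "(\<lambda>x::'a. \<Sum>b\<in>Basis. (x \<bullet> b)\<^sup>2) = (\<lambda>x. x \<bullet> x)"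
    by (rule ext, subst (2) euclidean_inner) (simp add: power2_eq_square)
  ultimately show ?thesis by simp
qed

text \<open>The inner product of gradients measures the failure of the Laplacian to be a derivation.\<close>

lemma lap_grad_inner:
  assumes "F \<in> B" "H \<in> B"
  shows "(\<lambda>x. grad F x \<bullet> grad H x) \<in> B"
proof -
  have "(\<lambda>x. laplacian (\<lambda>y. F y * H y) x - (F x * laplacian H x + H x * laplacian F x)) \<in> B"
    by (intro lap_diff lap_add lap_mult lap_laplacian assms)
  then have "(\<lambda>x. (1/2) * (laplacian (\<lambda>y. F y * H y) x - (F x * laplacian H x + H x * laplacian F x))) \<in> B"
    by (rule lap_cmult)
  then show ?thesis by (simp add: laplacian_mult lap_poly assms)
qed

text \<open>The Lie bracket of \<open>e\<close> and \<open>grad H\<close> acts on \<open>B\<close>, since both fields do. If \<open>grad H\<close> is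
  the sum of a field \<open>z\<close> with bracket \<open>- z\<close> and a field on which the bracket is the identity, then the
  summand \<open>z\<close> acts on \<open>B\<close> as well.\<close>

lemma lap_split_gradient_field:
  assumes H: "H \<in> B" and e: "bounded_linear e"
    and eB: "\<And>F. F \<in> B \<Longrightarrow> (\<lambda>v. grad F v \<bullet> e v) \<in> B"
    and split: "\<And>v. hess H v (e v) - e (grad H v) = grad H v - 2 *\<^sub>R z v"
    and F: "F \<in> B"
  shows "(\<lambda>v. grad F v \<bullet> z v) \<in> B"
proof -
  let ?X = "\<lambda>F v. grad F v \<bullet> grad H v" and ?E = "\<lambda>F v. grad F v \<bullet> e v"
  have X: "?X F \<in> B" if "F \<in> B" for F using lap_grad_inner[OF that H] .
  have *: "?E (?X F) v - ?X (?E F) v = grad F v \<bullet> (grad H v - 2 *\<^sub>R z v)" for v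
  proof -
    note F' = has_derivative_hess[OF lap_poly[OF F]] and H' = has_derivative_hess[OF lap_poly[OF H]]
    have "?E (?X F) v = grad F v \<bullet> hess H v (e v) + hess F v (e v) \<bullet> grad H v"
      using grad_dot[OF has_derivative_inner[OF F' H'], of v] .
    moreover have "?X (?E F) v = grad F v \<bullet> e (grad H v) + hess F v (grad H v) \<bullet> e v"
      using grad_dot[OF has_derivative_inner[OF F' bounded_linear.has_derivative[OF e has_derivative_ident]]]
      by simp
    ultimately show ?thesis
      using hess_sym[OF lap_poly[OF F], of v "e v" "grad H v"]
      by (simp flip: split add: inner_diff_right)
  qed
  have "(\<lambda>v. (1/2) * (?X F v - (?E (?X F) v - ?X (?E F) v))) \<in> B"
    by (intro lap_cmult lap_diff X eB F)
  moreover have "(1/2) * (?X F v - (?E (?X F) v - ?X (?E F) v)) = grad F v \<bullet> z v" for v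
    unfolding * by (simp add: inner_diff_right)
  ultimately show ?thesis by simp
qed

end

text \<open>The coefficients of degree \<open>n\<close> of \<open>R\<close> and of its successor \<open>R'\<close> determine the coefficient of degree
  \<open>n + 1\<close> of \<open>R\<close>, so all coefficients vanish by induction on the degree.\<close>

lemma poly_family_zero:
  fixes \<R> :: "real poly set"
  assumes "R \<in> \<R>"
    and init: "\<And>R. R \<in> \<R> \<Longrightarrow> poly R 0 = 0"
    and step: "\<And>R. R \<in> \<R> \<Longrightarrow> \<exists>R'\<in>\<R>. R' = [:a, c:] * pderiv R" and a: "a \<noteq> 0"
  shows "R = 0"
proof -
  have "coeff R n = 0" if "R \<in> \<R>" for R n
    using that
  proof (induction n arbitrary: R)
    case 0
    then show ?case using init by (simp add: poly_0_coeff_0)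
  next
    case (Suc n)
    have "coeff ([:a, c:] * pderiv R) n = 0" using step[OF Suc.prems] Suc.IH by blast
    moreover have "coeff ([:a, c:] * pderiv R) n = a * (real (Suc n) * coeff R (Suc n)) + c * (real n * coeff R n)"
      by (cases n) (simp_all add: coeff_pderiv)
    ultimately show ?case using Suc.IH[OF Suc.prems] a by simp
  qed
  then show ?thesis using assms(1) by (simp add: poly_eq_iff)
qed

text \<open>Along an affine curve that is, up to the parametrisation, an integral curve of a field acting on \<open>B\<close>,
  all derivatives of an element of \<open>B\<close> are determined by the values of elements of \<open>B\<close> at the initial point.\<close>

lemma same_values_flow:
  assumes poly: "\<And>F. F \<in> B \<Longrightarrow> real_polynomial_function F"
    and zB: "\<And>F. F \<in> B \<Longrightarrow> (\<lambda>v. grad F v \<bullet> z v) \<in> B"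
    and z: "\<And>v s. z (v + s *\<^sub>R z v) = (1 + c * s) *\<^sub>R z v"
    and xy: "same_values B x y"
  shows "same_values B (x + s *\<^sub>R z x) (y + s *\<^sub>R z y)"
  unfolding same_values_def
proof
  fix F assume F: "F \<in> B"
  let ?\<phi> = "\<lambda>F s. F (x + s *\<^sub>R z x) - F (y + s *\<^sub>R z y)"
  define \<R> where "\<R> = {R. \<exists>F\<in>B. \<forall>s. poly R s = ?\<phi> F s}"
  have ex: "\<exists>R. \<forall>s. poly R s = ?\<phi> F s" if FB: "F \<in> B" for F
  proof -
    obtain R1 R2 where "\<forall>s. F (x + s *\<^sub>R z x) = poly R1 s" "\<forall>s. F (y + s *\<^sub>R z y) = poly R2 s"
      using polynomial_along_line[OF poly[OF FB]] by meson
    then show ?thesis by (intro exI[of _ "R1 - R2"]) simp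
  qed
  have "poly R s = 0" if "R \<in> \<R>" for R s
  proof -
    have "R = 0" using that
    proof (rule poly_family_zero[of _ _ 1 c])
      fix R assume "R \<in> \<R>"
      then obtain F where F: "F \<in> B" "\<And>s. poly R s = ?\<phi> F s" by (auto simp: \<R>_def)
      show "poly R 0 = 0" using F xy by (simp add: same_values_def)
      let ?G = "\<lambda>v. grad F v \<bullet> z v"
      have "poly ([:1, c:] * pderiv R) s = ?\<phi> ?G s" for s
      proof -
        have "(poly R has_real_derivative grad F (x + s *\<^sub>R z x) \<bullet> z x - grad F (y + s *\<^sub>R z y) \<bullet> z y) (at s)"
          unfolding F(2)[abs_def] by (intro DERIV_diff deriv_along_line poly F(1))
        then have "poly (pderiv R) s = grad F (x + s *\<^sub>R z x) \<bullet> z x - grad F (y + s *\<^sub>R z y) \<bullet> z y"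
          using DERIV_unique poly_DERIV by blast
        moreover have "poly ([:1, c:] * pderiv R) s = (1 + c * s) * poly (pderiv R) s"
          by (simp add: algebra_simps)
        ultimately show ?thesis by (simp only: z inner_scaleR_right right_diff_distrib)
      qed
      then have "[:1, c:] * pderiv R \<in> \<R>" using zB[OF F(1)] unfolding \<R>_def by (intro CollectI bexI[of _ ?G]) auto
      then show "\<exists>R'\<in>\<R>. R' = [:1, c:] * pderiv R" by blast
    qed auto
    then show ?thesis by simp
  qed
  then show "F (x + s *\<^sub>R z x) = F (y + s *\<^sub>R z y)" using ex[OF F] F unfolding \<R>_def by fastforce
qed

lemma lap_radial:
  assumes B: "laplacian_subalgebra B" and F: "F \<in> B"
  shows "(\<lambda>v. grad F v \<bullet> v) \<in> B"
  using lap_cmult[OF B lap_grad_inner[OF B F lap_norm2[OF B]], of "1/2"] by (simp add: grad_norm2)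

text \<open>The radial field is half the gradient of the squared norm, and homotheties move points along
  its lines.\<close>

lemma same_values_scale:
  assumes B: "laplacian_subalgebra B" and xy: "same_values B x y"
  shows "same_values B (c *\<^sub>R x) (c *\<^sub>R y)"
proof -
  have "same_values B (x + (c - 1) *\<^sub>R x) (y + (c - 1) *\<^sub>R y)"
    by (rule same_values_flow[where z = "\<lambda>v. v" and c = 1, OF _ _ _ xy])
       (auto simp: lap_poly[OF B] lap_radial[OF B] algebra_simps)
  then show ?thesis by (simp add: algebra_simps)
qed

section \<open>The heat flow on polynomials\<close>

definition monomial :: "('a::euclidean_space \<Rightarrow> nat) \<Rightarrow> 'a \<Rightarrow> real" where
  "monomial m x = (\<Prod>b\<in>Basis. (x \<bullet> b) ^ m b)"

inductive monomial_span :: "('a::euclidean_space \<Rightarrow> real) \<Rightarrow> bool" where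
  mon: "monomial_span (monomial m)"
| add: "monomial_span f \<Longrightarrow> monomial_span g \<Longrightarrow> monomial_span (\<lambda>x. f x + g x)"
| cmult: "monomial_span f \<Longrightarrow> monomial_span (\<lambda>x. c * f x)"

lemma monomial_span_const: "monomial_span (\<lambda>x. c)"
  using monomial_span.cmult[OF monomial_span.mon[of "\<lambda>_. 0"], of c] by (simp add: monomial_def)

lemma monomial_span_mult:
  assumes "monomial_span f" "monomial_span g"
  shows "monomial_span (\<lambda>x. f x * g x)"
  using assms
proof (induction f arbitrary: g)
  case (mon m)
  from mon.prems show ?case
  proof induction
    case (mon m')
    have "(\<lambda>x. monomial m x * monomial m' x) = monomial (\<lambda>b. m b + m' b)"
      by (auto simp: monomial_def power_add prod.distrib)
    then show ?case using monomial_span.mon by metis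
  next
    case (add f g)
    have "(\<lambda>x. monomial m x * (f x + g x)) = (\<lambda>x. monomial m x * f x + monomial m x * g x)"
      by (simp add: distrib_left)
    then show ?case using monomial_span.add[OF add.IH] by metis
  next
    case (cmult f c)
    have "(\<lambda>x. monomial m x * (c * f x)) = (\<lambda>x. c * (monomial m x * f x))" by (simp add: mult_ac)
    then show ?case using monomial_span.cmult[OF cmult.IH] by metis
  qed
next
  case (add f f')
  have "(\<lambda>x. (f x + f' x) * g x) = (\<lambda>x. f x * g x + f' x * g x)" by (simp add: distrib_right)
  then show ?case using monomial_span.add[OF add.IH(1)[OF add.prems] add.IH(2)[OF add.prems]] by metis
next
  case (cmult f c)
  have "(\<lambda>x. c * f x * g x) = (\<lambda>x. c * (f x * g x))" by (simp add: mult_ac)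
  then show ?case using monomial_span.cmult[OF cmult.IH[OF cmult.prems]] by metis
qed

lemma monomial_span_sum:
  "finite I \<Longrightarrow> (\<And>i. i \<in> I \<Longrightarrow> monomial_span (f i)) \<Longrightarrow> monomial_span (\<lambda>x. \<Sum>i\<in>I. f i x)"
  by (induction I rule: finite_induct) (auto intro: monomial_span_const monomial_span.add)

lemma real_polynomial_monomial_span:
  assumes "real_polynomial_function f"
  shows "monomial_span f"
  using assms
proof induction
  case (linear f)
  then obtain g where g: "f = (\<lambda>x. g \<bullet> x)" by (rule bounded_linear_euclidean_inner)
  have coord: "monomial_span (\<lambda>x. x \<bullet> b)" if b: "b \<in> Basis" for b
  proof -
    have "monomial (\<lambda>c. if c = b then 1 else 0) x = x \<bullet> b" for x
    proof -
      have "monomial (\<lambda>c. if c = b then 1 else 0) x = (\<Prod>c\<in>Basis. if c = b then x \<bullet> b else 1)"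
        unfolding monomial_def by (intro prod.cong) auto
      then show ?thesis using b by simp
    qed
    then have "monomial (\<lambda>c. if c = b then 1 else 0) = (\<lambda>x. x \<bullet> b)" by auto
    then show ?thesis using monomial_span.mon by metis
  qed
  have "f = (\<lambda>x. \<Sum>b\<in>Basis. (g \<bullet> b) * (x \<bullet> b))" unfolding g using euclidean_inner by blast
  then show ?case by (simp only:) (intro monomial_span_sum finite_Basis monomial_span.cmult coord)
qed (auto intro: monomial_span_const monomial_span.add monomial_span_mult)

subsection \<open>One variable\<close>

text \<open>The \<open>m\<close>-th moment of the normal distribution with mean \<open>p\<close>, as a polynomial in the variance.\<close>

definition heat_poly :: "nat \<Rightarrow> real \<Rightarrow> real poly" where
  "heat_poly m p = (\<Sum>i\<le>m. monom (real (m choose (2 * i)) * p ^ (m - 2 * i) * (fact (2 * i) / (2 ^ i * fact i))) i)"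

lemma coeff_heat_poly:
  "coeff (heat_poly m p) i = real (m choose (2 * i)) * p ^ (m - 2 * i) * (fact (2 * i) / (2 ^ i * fact i))"
proof (cases "i \<le> m")
  case True
  then show ?thesis by (simp add: heat_poly_def coeff_sum coeff_monom)
next
  case False
  then have "m < 2 * i" by simp
  then show ?thesis using False by (simp add: heat_poly_def coeff_sum coeff_monom binomial_eq_0)
qed

text \<open>The heat equation in one variable: the right-hand side is the heat flow of the second derivative of
  the \<open>m\<close>-th power.\<close>

lemma pderiv_heat_poly:
  "smult 2 (pderiv (heat_poly m p)) = smult (real m * (real m - 1)) (heat_poly (m - 2) p)"
proof (rule poly_eqI)
  fix i
  show "coeff (smult 2 (pderiv (heat_poly m p))) i = coeff (smult (real m * (real m - 1)) (heat_poly (m - 2) p)) i"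
  proof (cases "m \<ge> 2")
    case True
    then obtain n where n: "m = Suc (Suc n)" by (metis add_2_eq_Suc le_Suc_ex)
    have "real (Suc (Suc n) choose Suc (Suc (2 * i))) * real (Suc (Suc (2 * i))) * real (Suc (2 * i))
        = real (Suc (Suc n)) * (real (Suc n choose Suc (2 * i)) * real (Suc (2 * i)))"
      using Suc_times_binomial_eq[of "Suc n" "Suc (2 * i)"] by (metis mult.assoc of_nat_mult)
    also have "real (Suc n choose Suc (2 * i)) * real (Suc (2 * i)) = real (Suc n) * real (n choose (2 * i))"
      using Suc_times_binomial_eq[of n "2 * i"] by (metis of_nat_mult)
    finally have *: "real (Suc (Suc n) choose Suc (Suc (2 * i))) * real (Suc (Suc (2 * i))) * real (Suc (2 * i))
        = real (Suc (Suc n)) * (real (Suc n) * real (n choose (2 * i)))" .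
    have f: "(fact (Suc (Suc (2 * i))) :: real) = real (Suc (Suc (2 * i))) * real (Suc (2 * i)) * fact (2 * i)"
      by (simp add: fact_Suc mult_ac)
    have "coeff (smult 2 (pderiv (heat_poly m p))) i
      = 2 * (real (Suc i) * (real (Suc (Suc n) choose Suc (Suc (2 * i))) * p ^ (n - 2 * i) *
          (fact (Suc (Suc (2 * i))) / (2 * 2 ^ i * (real (Suc i) * fact i)))))"
      by (simp add: coeff_pderiv coeff_heat_poly n fact_Suc del: binomial_Suc_Suc)
    also have "\<dots> = (real (Suc (Suc n) choose Suc (Suc (2 * i))) * real (Suc (Suc (2 * i))) * real (Suc (2 * i)))
         * p ^ (n - 2 * i) * (fact (2 * i) / (2 ^ i * fact i))"
      unfolding f by (simp add: field_simps del: binomial_Suc_Suc of_nat_Suc)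
    also have "\<dots> = coeff (smult (real m * (real m - 1)) (heat_poly (m - 2) p)) i"
      unfolding * by (simp add: n coeff_heat_poly)
    finally show ?thesis .
  next
    case False
    then have "m = 0 \<or> m = 1" by auto
    then show ?thesis by (auto simp: coeff_pderiv coeff_heat_poly binomial_eq_0)
  qed
qed

lemma std_normal_moments:
  "has_bochner_integral lborel (\<lambda>t. t ^ j * std_normal_density t)
     (if even j then fact j / (2 ^ (j div 2) * fact (j div 2)) else 0)"
proof (cases "even j")
  case True
  then obtain k where "j = 2 * k" by auto
  then show ?thesis using std_normal_moment_even[of k] by (simp add: mult.commute)
next
  case False
  then obtain k where "j = 2 * k + 1" by (auto elim: oddE)
  then show ?thesis using std_normal_moment_odd[of k] by (simp add: mult.commute)
qed

lemma heat_poly_integral: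
  assumes "\<tau> \<ge> 0"
  shows "has_bochner_integral lborel (\<lambda>t. (p + sqrt \<tau> * t) ^ m * std_normal_density t) (poly (heat_poly m p) \<tau>)"
proof -
  define \<mu> where "\<mu> j = (if even j then fact j / (2 ^ (j div 2) * fact (j div 2)) else 0 :: real)" for j
  let ?f = "\<lambda>j. real (m choose j) * p ^ (m - j) * sqrt \<tau> ^ j"
  have "(\<lambda>t. (p + sqrt \<tau> * t) ^ m * std_normal_density t)
      = (\<lambda>t. \<Sum>j\<le>m. ?f j * (t ^ j * std_normal_density t))"
    by (rule ext, subst add.commute, subst binomial_ring)
       (simp add: sum_distrib_left sum_distrib_right power_mult_distrib mult_ac)
  moreover have "has_bochner_integral lborel (\<lambda>t. \<Sum>j\<le>m. ?f j * (t ^ j * std_normal_density t)) (\<Sum>j\<le>m. ?f j * \<mu> j)"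
    unfolding \<mu>_def by (intro has_bochner_integral_sum has_bochner_integral_mult_right std_normal_moments)
  moreover have "(\<Sum>j\<le>m. ?f j * \<mu> j) = poly (heat_poly m p) \<tau>"
  proof -
    have sq: "sqrt \<tau> ^ (2 * i) = \<tau> ^ i" for i using assms by (simp add: power_mult)
    have "(\<Sum>j\<le>m. ?f j * \<mu> j) = (\<Sum>j\<le>2 * m. ?f j * \<mu> j)"
      by (rule sum.mono_neutral_left) (auto simp: binomial_eq_0)
    also have "\<dots> = (\<Sum>j\<in>(\<lambda>i. 2 * i) ` {..m}. ?f j * \<mu> j)"
    proof (rule sum.mono_neutral_right)
      show "\<forall>j\<in>{..2 * m} - (\<lambda>i. 2 * i) ` {..m}. ?f j * \<mu> j = 0"
        by (auto simp: \<mu>_def image_iff elim!: evenE)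
    qed auto
    also have "\<dots> = (\<Sum>i\<le>m. ?f (2 * i) * \<mu> (2 * i))"
      by (subst sum.reindex) (auto simp: inj_on_def)
    also have "\<dots> = poly (heat_poly m p) \<tau>"
      using sq by (simp add: heat_poly_def poly_sum poly_monom \<mu>_def mult_ac)
    finally show ?thesis .
  qed
  ultimately show ?thesis by simp
qed

subsection \<open>Several variables\<close>

definition gauss :: "'a::euclidean_space \<Rightarrow> real" where
  "gauss z = (\<Prod>b\<in>Basis. std_normal_density (z \<bullet> b))"

text \<open>The Gaussian has variance \<open>\<tau>\<close> in each coordinate, so the generator of this semigroup is half the
  Laplacian.\<close>

definition heat :: "real \<Rightarrow> ('a::euclidean_space \<Rightarrow> real) \<Rightarrow> 'a \<Rightarrow> real" where
  "heat \<tau> f p = (\<integral>z. f (p + sqrt \<tau> *\<^sub>R z) * gauss z \<partial>lborel)"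

lemma lborel_prod_integral:
  fixes f :: "'a::euclidean_space \<Rightarrow> real \<Rightarrow> real"
  assumes f: "\<And>b. b \<in> Basis \<Longrightarrow> has_bochner_integral lborel (f b) (I b)"
  shows "has_bochner_integral lborel (\<lambda>x::'a. \<Prod>b\<in>Basis. f b (x \<bullet> b)) (\<Prod>b\<in>Basis. I b)"
proof -
  interpret product_sigma_finite "\<lambda>_::'a. lborel :: real measure" by standard
  have int: "\<And>b. b \<in> Basis \<Longrightarrow> integrable lborel (f b)" using f has_bochner_integral_iff by blast
  have [measurable]: "f b \<in> borel_measurable borel" if "b \<in> Basis" for b
    using borel_measurable_integrable[OF int[OF that]] by simp
  let ?P = "\<Pi>\<^sub>M b\<in>(Basis::'a set). (lborel :: real measure)"
  let ?T = "\<lambda>g. \<Sum>b\<in>(Basis::'a set). g b *\<^sub>R b"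
  have eq: "(\<Prod>b\<in>Basis. f b (?T g \<bullet> b)) = (\<Prod>b\<in>Basis. f b (g b))" for g
    by (intro prod.cong) (auto simp: inner_sum_left_Basis)
  have T: "?T \<in> measurable ?P borel" by measurable
  have m: "(\<lambda>x::'a. \<Prod>b\<in>Basis. f b (x \<bullet> b)) \<in> borel_measurable borel" by measurable
  have "has_bochner_integral ?P (\<lambda>g. \<Prod>b\<in>Basis. f b (g b)) (\<Prod>b\<in>Basis. I b)"
    using product_integrable_prod[OF finite_Basis int] product_integral_prod[OF finite_Basis int] f
    by (simp add: has_bochner_integral_iff cong: prod.cong)
  then have "has_bochner_integral (distr ?P borel ?T) (\<lambda>x::'a. \<Prod>b\<in>Basis. f b (x \<bullet> b)) (\<Prod>b\<in>Basis. I b)"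
    unfolding has_bochner_integral_iff
    using integrable_distr_eq[OF T m] integral_distr[OF T m] by (simp add: eq)
  then show ?thesis by (simp flip: lborel_eq)
qed

lemma monomial_heat:
  assumes "\<tau> \<ge> 0"
  shows "has_bochner_integral lborel (\<lambda>z. monomial m (p + sqrt \<tau> *\<^sub>R z) * gauss z)
    (poly (\<Prod>b\<in>Basis. heat_poly (m b) (p \<bullet> b)) \<tau>)"
proof -
  have "has_bochner_integral lborel (\<lambda>z. \<Prod>b\<in>Basis. (p \<bullet> b + sqrt \<tau> * (z \<bullet> b)) ^ m b * std_normal_density (z \<bullet> b))
      (\<Prod>b\<in>Basis. poly (heat_poly (m b) (p \<bullet> b)) \<tau>)"
    by (rule lborel_prod_integral) (rule heat_poly_integral[OF assms])
  then show ?thesis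
    by (simp add: monomial_def gauss_def prod.distrib inner_add_left poly_prod)
qed

lemma integrable_heat:
  assumes "real_polynomial_function f" "\<tau> \<ge> 0"
  shows "integrable lborel (\<lambda>z. f (p + sqrt \<tau> *\<^sub>R z) * gauss z)"
  using real_polynomial_monomial_span[OF assms(1)]
proof induction
  case (mon m)
  show ?case using monomial_heat[OF assms(2)] has_bochner_integral_iff by blast
qed (simp_all add: distrib_right mult.assoc)

lemma laplacian_monomial:
  "laplacian (monomial m) x = (\<Sum>b\<in>Basis. real (m b) * (real (m b) - 1) * monomial (m(b := m b - 2)) x)"
proof -
  have "(deriv ^^ 2) (\<lambda>t. monomial m (x + t *\<^sub>R b)) 0 = real (m b) * (real (m b) - 1) * monomial (m(b := m b - 2)) x"
    if b: "b \<in> Basis" for b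
  proof -
    define K where "K = (\<Prod>c\<in>Basis - {b}. (x \<bullet> c) ^ m c)"
    have mon: "monomial (m(b := n)) (x + t *\<^sub>R b) = (x \<bullet> b + t) ^ n * K" for n t
    proof -
      have "monomial (m(b := n)) (x + t *\<^sub>R b)
         = (x \<bullet> b + t) ^ n * (\<Prod>c\<in>Basis - {b}. ((x + t *\<^sub>R b) \<bullet> c) ^ (m(b := n)) c)"
        unfolding monomial_def using b by (subst prod.remove[of _ b]) (auto simp: inner_add_left)
      also have "(\<Prod>c\<in>Basis - {b}. ((x + t *\<^sub>R b) \<bullet> c) ^ (m(b := n)) c) = K"
        unfolding K_def using b by (intro prod.cong) (auto simp: inner_add_left inner_not_same_Basis)
      finally show ?thesis .
    qed
    have "(\<lambda>t. monomial m (x + t *\<^sub>R b)) = (\<lambda>t. (x \<bullet> b + t) ^ m b * K)"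
      using mon[of "m b"] by simp
    moreover have d1: "deriv (\<lambda>t. (x \<bullet> b + t) ^ n * K) = (\<lambda>t. real n * (x \<bullet> b + t) ^ (n - 1) * K)" for n
      by (intro ext DERIV_imp_deriv) (auto intro!: derivative_eq_intros)
    moreover have "deriv (\<lambda>t. real n * (x \<bullet> b + t) ^ (n - 1) * K) 0
       = real n * (real (n - 1) * (x \<bullet> b + 0) ^ (n - 1 - 1) * K)" for n
      by (intro DERIV_imp_deriv) (auto intro!: derivative_eq_intros)
    ultimately have "(deriv ^^ 2) (\<lambda>t. monomial m (x + t *\<^sub>R b)) 0
      = real (m b) * (real (m b - 1) * (x \<bullet> b + 0) ^ (m b - 2) * K)"
      by (simp add: numeral_2_eq_2)
    also have "\<dots> = real (m b) * (real (m b) - 1) * monomial (m(b := m b - 2)) x"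
      using mon[of "m b - 2" 0] by (cases "m b") auto
    finally show ?thesis .
  qed
  then show ?thesis by (simp add: laplacian_def)
qed

lemma real_polynomial_monomial: "real_polynomial_function (monomial m)"
  unfolding monomial_def[abs_def]
  by (intro real_polynomial_function_prod finite_Basis real_polynomial_function_power
      real_polynomial_function.intros(1) bounded_linear_inner_left)

text \<open>On monomials the Gaussian integral factors over the coordinates, and the product rule turns the
  heat equations in one variable into the heat equation on the whole space.\<close>

lemma heat_polynomial:
  assumes "real_polynomial_function f"
  shows "\<exists>Q. \<forall>\<tau>\<ge>0. heat \<tau> f p = poly Q \<tau> \<and> heat \<tau> (laplacian f) p = 2 * poly (pderiv Q) \<tau>"
proof -
  have "monomial_span f" using real_polynomial_monomial_span[OF assms] .
  then have "real_polynomial_function f \<and> ?thesis"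
  proof induction
    case (mon m)
    let ?Q = "\<lambda>m. \<Prod>b\<in>Basis. heat_poly (m b) (p \<bullet> b)"
    have heat: "heat \<tau> (monomial m) p = poly (?Q m) \<tau>" if "\<tau> \<ge> 0" for \<tau> m
      using monomial_heat[OF that] has_bochner_integral_iff unfolding heat_def by blast
    have "heat \<tau> (laplacian (monomial m)) p = 2 * poly (pderiv (?Q m)) \<tau>" if \<tau>: "\<tau> \<ge> 0" for \<tau>
    proof -
      let ?k = "\<lambda>b. real (m b) * (real (m b) - 1)"
      have "heat \<tau> (laplacian (monomial m)) p = (\<Sum>b\<in>Basis. ?k b * heat \<tau> (monomial (m(b := m b - 2))) p)"
        unfolding heat_def laplacian_monomial
        by (simp add: sum_distrib_right mult.assoc integrable_heat[OF real_polynomial_monomial \<tau>])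
      also have "\<dots> = (\<Sum>b\<in>Basis. ?k b * poly (?Q (m(b := m b - 2))) \<tau>)" by (simp add: heat[OF \<tau>])
      also have "\<dots> = (\<Sum>b\<in>Basis. poly (smult 2 (pderiv (heat_poly (m b) (p \<bullet> b)))) \<tau> *
                        poly (\<Prod>c\<in>Basis - {b}. heat_poly (m c) (p \<bullet> c)) \<tau>)"
      proof (rule sum.cong[OF refl])
        fix b :: 'a assume b: "b \<in> Basis"
        have "?Q (m(b := m b - 2)) = heat_poly (m b - 2) (p \<bullet> b) * (\<Prod>c\<in>Basis - {b}. heat_poly (m c) (p \<bullet> c))"
          using b by (subst prod.remove[of _ b]) (auto intro!: prod.cong)
        then show "?k b * poly (?Q (m(b := m b - 2))) \<tau> = poly (smult 2 (pderiv (heat_poly (m b) (p \<bullet> b)))) \<tau> *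
             poly (\<Prod>c\<in>Basis - {b}. heat_poly (m c) (p \<bullet> c)) \<tau>"
          unfolding pderiv_heat_poly by simp
      qed
      also have "\<dots> = 2 * poly (pderiv (?Q m)) \<tau>"
        by (simp add: pderiv_prod poly_sum sum_distrib_left mult_ac)
      finally show ?thesis .
    qed
    then show ?case using heat real_polynomial_monomial by blast
  next
    case (add f g)
    then obtain Q1 Q2 where Q: "\<forall>\<tau>\<ge>0. heat \<tau> f p = poly Q1 \<tau> \<and> heat \<tau> (laplacian f) p = 2 * poly (pderiv Q1) \<tau>"
      "\<forall>\<tau>\<ge>0. heat \<tau> g p = poly Q2 \<tau> \<and> heat \<tau> (laplacian g) p = 2 * poly (pderiv Q2) \<tau>"
      by blast
    have fg: "real_polynomial_function f" "real_polynomial_function g" using add by auto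
    have heat_add: "heat \<tau> (\<lambda>x. f x + g x) p = heat \<tau> f p + heat \<tau> g p"
      if "\<tau> \<ge> 0" "real_polynomial_function f" "real_polynomial_function g" for \<tau> and f g :: "'a \<Rightarrow> real"
      unfolding heat_def distrib_right
      by (rule Bochner_Integration.integral_add) (rule integrable_heat; fact)+
    have "laplacian (\<lambda>x. f x + g x) = (\<lambda>x. laplacian f x + laplacian g x)"
      using laplacian_add[OF fg] by auto
    then show ?case
      using Q fg by (auto intro!: exI[of _ "Q1 + Q2"] real_polynomial_function.intros(3)
          simp: heat_add real_polynomial_laplacian pderiv_add)
  next
    case (cmult f c)
    then obtain Q where Q: "\<forall>\<tau>\<ge>0. heat \<tau> f p = poly Q \<tau> \<and> heat \<tau> (laplacian f) p = 2 * poly (pderiv Q) \<tau>"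
      by blast
    have f: "real_polynomial_function f" using cmult by auto
    have heat_cmult: "heat \<tau> (\<lambda>x. c * f x) p = c * heat \<tau> f p" for \<tau> and f :: "'a \<Rightarrow> real"
      unfolding heat_def by (simp add: mult.assoc)
    have "laplacian (\<lambda>x. c * f x) = (\<lambda>x. c * laplacian f x)"
    proof
      fix x :: 'a
      have "laplacian (\<lambda>x. c) x = 0"
        using laplacian_add[of "\<lambda>x. c" "\<lambda>x. 0" x] laplacian_add[of "\<lambda>x. 0" "\<lambda>x. 0" x]
        by (simp add: laplacian_def numeral_2_eq_2)
      then show "laplacian (\<lambda>x. c * f x) x = c * laplacian f x"
        using laplacian_mult[OF real_polynomial_function.intros(2) f, of c x] by simp
    qed
    moreover have "real_polynomial_function (\<lambda>x. c * f x)"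
      by (rule real_polynomial_function.intros(4)[OF real_polynomial_function.intros(2) f])
    ultimately show ?case
      using Q by (auto intro!: exI[of _ "smult c Q"] simp: heat_cmult pderiv_smult)
  qed
  then show ?thesis by blast
qed

lemma heat_0: "heat 0 f p = f p"
proof -
  have "has_bochner_integral lborel (\<lambda>z::'a. monomial (\<lambda>_. 0) (0 + sqrt 0 *\<^sub>R z) * gauss z) 1"
    using monomial_heat[of 0 "\<lambda>_. 0" "0::'a"] by (simp add: heat_poly_def poly_prod poly_monom)
  then have "integral\<^sup>L lborel (gauss :: 'a \<Rightarrow> real) = 1"
    by (simp add: monomial_def has_bochner_integral_iff)
  then show ?thesis by (simp add: heat_def)
qed

text \<open>The heat flow of a polynomial is polynomial in time and its time derivatives are heat flows of
  iterated Laplacians, so points that \<open>B\<close> does not separate see the same heat.\<close>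

lemma same_values_heat:
  assumes B: "laplacian_subalgebra B" and pq: "same_values B p q" and F: "F \<in> B" and \<tau>: "\<tau> \<ge> 0"
  shows "heat \<tau> F p = heat \<tau> F q"
proof -
  define \<R> where "\<R> = {R. \<exists>F\<in>B. \<forall>\<tau>\<ge>0. poly R \<tau> = heat \<tau> F p - heat \<tau> F q}"
  obtain Q1 Q2 where Q: "\<And>\<tau>. \<tau> \<ge> 0 \<Longrightarrow> heat \<tau> F p = poly Q1 \<tau>" "\<And>\<tau>. \<tau> \<ge> 0 \<Longrightarrow> heat \<tau> F q = poly Q2 \<tau>"
    using heat_polynomial[OF lap_poly[OF B F]] by metis
  have "Q1 - Q2 \<in> \<R>" using F Q unfolding \<R>_def by (intro CollectI bexI[of _ F]) auto
  then have "Q1 - Q2 = 0"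
  proof (rule poly_family_zero[of _ _ 2 0])
    fix R assume "R \<in> \<R>"
    then obtain F where F: "F \<in> B" "\<And>\<tau>. \<tau> \<ge> 0 \<Longrightarrow> poly R \<tau> = heat \<tau> F p - heat \<tau> F q"
      by (auto simp: \<R>_def)
    show "poly R 0 = 0" using F pq by (simp add: heat_0 same_values_def)
    obtain Q1 where Q1: "\<And>\<tau>. \<tau> \<ge> 0 \<Longrightarrow> heat \<tau> F p = poly Q1 \<tau> \<and> heat \<tau> (laplacian F) p = 2 * poly (pderiv Q1) \<tau>"
      using heat_polynomial[OF lap_poly[OF B F(1)]] by blast
    obtain Q2 where Q2: "\<And>\<tau>. \<tau> \<ge> 0 \<Longrightarrow> heat \<tau> F q = poly Q2 \<tau> \<and> heat \<tau> (laplacian F) q = 2 * poly (pderiv Q2) \<tau>"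
      using heat_polynomial[OF lap_poly[OF B F(1)]] by blast
    have "R - (Q1 - Q2) = 0"
    proof (rule ccontr)
      assume "R - (Q1 - Q2) \<noteq> 0"
      then have "finite {\<tau>. poly (R - (Q1 - Q2)) \<tau> = 0}" by (rule poly_roots_finite)
      moreover have "{0..} \<subseteq> {\<tau>. poly (R - (Q1 - Q2)) \<tau> = 0}" using F(2) Q1 Q2 by auto
      ultimately show False using infinite_Ici finite_subset by blast
    qed
    then have "poly ([:2, 0:] * pderiv R) \<tau> = heat \<tau> (laplacian F) p - heat \<tau> (laplacian F) q" if "\<tau> \<ge> 0" for \<tau>
      using Q1[OF that] Q2[OF that] by (simp add: pderiv_diff)
    then have "[:2, 0:] * pderiv R \<in> \<R>"
      using lap_laplacian[OF B F(1)] unfolding \<R>_def by blast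
    then show "\<exists>R'\<in>\<R>. R' = [:2, 0:] * pderiv R" by blast
  qed simp
  then show ?thesis using Q \<tau> by simp
qed

section \<open>The classes of a Laplacian algebra are equidistant\<close>

lemma gauss_eq:
  "gauss z = (1 / sqrt (2 * pi)) ^ DIM('a) * exp (- (z \<bullet> z) / 2)" for z :: "'a::euclidean_space"
proof -
  have "gauss z = (\<Prod>b\<in>(Basis::'a set). (1 / sqrt (2 * pi)) * exp (- (z \<bullet> b)\<^sup>2 / 2))"
    by (simp add: gauss_def normal_density_def)
  also have "\<dots> = (1 / sqrt (2 * pi)) ^ DIM('a) * exp (\<Sum>b\<in>(Basis::'a set). - (z \<bullet> b)\<^sup>2 / 2)"
    by (simp only: prod.distrib exp_sum[OF finite_Basis] prod_constant)
  also have "(\<Sum>b\<in>(Basis::'a set). - (z \<bullet> b)\<^sup>2 / 2) = - (z \<bullet> z) / 2"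
    by (subst (2) euclidean_inner) (simp add: power2_eq_square sum_negf sum_divide_distrib)
  finally show ?thesis .
qed

lemma has_bochner_integral_lborel_affine:
  fixes g :: "'a::euclidean_space \<Rightarrow> real"
  assumes c: "c > 0" and g[measurable]: "g \<in> borel_measurable borel"
    and I: "has_bochner_integral lborel (\<lambda>z. g (t + c *\<^sub>R z)) I"
  shows "has_bochner_integral lborel g (c ^ DIM('a) * I)"
proof -
  have "has_bochner_integral (distr lborel borel (\<lambda>z. t + c *\<^sub>R z)) g I"
    by (rule has_bochner_integral_distr[where f = g]) (use I in auto)
  then have "has_bochner_integral (distr lborel borel (\<lambda>z. t + c *\<^sub>R z)) (\<lambda>x. c ^ DIM('a) *\<^sub>R g x) (c ^ DIM('a) * I)"
    using has_bochner_integral_mult_right by simp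
  then have "has_bochner_integral (density (distr lborel borel (\<lambda>z. t + c *\<^sub>R z)) (\<lambda>_. c ^ DIM('a))) g (c ^ DIM('a) * I)"
    using c by (intro has_bochner_integral_density) auto
  then show ?thesis using lborel_affine[of c t] c by simp
qed

text \<open>Completing the square turns the weight into a Gaussian of variance \<open>1 / (2 \<beta>)\<close> centred at
  \<open>p / (2 \<beta>)\<close>.\<close>

lemma exp_integral_heat:
  fixes F :: "'a::euclidean_space \<Rightarrow> real"
  assumes F: "real_polynomial_function F" and \<beta>: "\<beta> > 0"
  shows "has_bochner_integral lborel (\<lambda>w. F w * exp (p \<bullet> w - \<beta> * (w \<bullet> w)))
    ((sqrt (1 / (2 * \<beta>)) * sqrt (2 * pi)) ^ DIM('a) * exp (p \<bullet> p / (4 * \<beta>)) *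
       heat (1 / (2 * \<beta>)) F ((1 / (2 * \<beta>)) *\<^sub>R p))"
proof -
  define \<tau> where "\<tau> = 1 / (2 * \<beta>)"
  define t where "t = \<tau> *\<^sub>R p"
  have \<tau>: "\<tau> > 0" using \<beta> by (simp add: \<tau>_def)
  have [measurable]: "F \<in> borel_measurable borel"
    using F by (simp add: borel_measurable_continuous_onI continuous_on_polymonial_function real_polynomial_function_eq)
  define K where "K = sqrt (2 * pi) ^ DIM('a) * exp (p \<bullet> p / (4 * \<beta>))"
  let ?g = "\<lambda>w. F w * exp (p \<bullet> w - \<beta> * (w \<bullet> w))"
  have eq: "?g (t + sqrt \<tau> *\<^sub>R z) = K * (F (t + sqrt \<tau> *\<^sub>R z) * gauss z)" for z
  proof -
    have s: "sqrt \<tau> * sqrt \<tau> = \<tau>" using \<tau> by simp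
    have "p \<bullet> (t + sqrt \<tau> *\<^sub>R z) - \<beta> * ((t + sqrt \<tau> *\<^sub>R z) \<bullet> (t + sqrt \<tau> *\<^sub>R z))
       = (\<tau> - \<beta> * \<tau> * \<tau>) * (p \<bullet> p) + (1 - 2 * \<beta> * \<tau>) * sqrt \<tau> * (p \<bullet> z) - \<beta> * (sqrt \<tau> * sqrt \<tau>) * (z \<bullet> z)"
      unfolding t_def by (simp add: inner_add_left inner_add_right inner_commute algebra_simps)
    also have "\<dots> = p \<bullet> p / (4 * \<beta>) - (z \<bullet> z) / 2"
      unfolding s using \<beta> by (simp add: \<tau>_def field_simps)
    finally have "exp (p \<bullet> (t + sqrt \<tau> *\<^sub>R z) - \<beta> * ((t + sqrt \<tau> *\<^sub>R z) \<bullet> (t + sqrt \<tau> *\<^sub>R z)))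
       = exp (p \<bullet> p / (4 * \<beta>)) * exp (- (z \<bullet> z) / 2)"
      by (simp flip: exp_add)
    also have "\<dots> = K * gauss z"
      by (simp add: K_def gauss_eq power_divide)
    finally show ?thesis by simp
  qed
  have "has_bochner_integral lborel (\<lambda>z. K * (F (t + sqrt \<tau> *\<^sub>R z) * gauss z)) (K * heat \<tau> F t)"
    unfolding heat_def using integrable_heat[OF F] \<tau>
    by (intro has_bochner_integral_mult_right has_bochner_integral_integrable) auto
  then have "has_bochner_integral lborel (\<lambda>z. ?g (t + sqrt \<tau> *\<^sub>R z)) (K * heat \<tau> F t)"
    unfolding eq .
  then have "has_bochner_integral lborel ?g (sqrt \<tau> ^ DIM('a) * (K * heat \<tau> F t))"
    using \<tau> by (intro has_bochner_integral_lborel_affine[where t = t and g = ?g]) auto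
  then show ?thesis
    unfolding K_def t_def \<tau>_def by (simp add: power_mult_distrib mult_ac)
qed

text \<open>The centres \<open>p / (2 \<beta>)\<close> and \<open>q / (2 \<beta>)\<close> are equivalent because homotheties preserve the classes.\<close>

lemma same_values_exp_integral:
  assumes B: "laplacian_subalgebra B" and pq: "same_values B p q" and F: "F \<in> B" and \<beta>: "\<beta> > 0"
  shows "integral\<^sup>L lborel (\<lambda>w. F w * exp (p \<bullet> w - \<beta> * (w \<bullet> w))) =
         integral\<^sup>L lborel (\<lambda>w. F w * exp (q \<bullet> w - \<beta> * (w \<bullet> w)))"
proof -
  have "p \<bullet> p = q \<bullet> q" using pq lap_norm2[OF B] by (auto simp: same_values_def)
  moreover have "heat (1 / (2 * \<beta>)) F ((1 / (2 * \<beta>)) *\<^sub>R p) = heat (1 / (2 * \<beta>)) F ((1 / (2 * \<beta>)) *\<^sub>R q)"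
    by (rule same_values_heat[OF B same_values_scale[OF B pq] F]) (use \<beta> in simp)
  ultimately show ?thesis
    using exp_integral_heat[OF lap_poly[OF B F] \<beta>] by (simp add: has_bochner_integral_iff)
qed

lemma real_polynomial_exp_bound:
  fixes f :: "'a::euclidean_space \<Rightarrow> real"
  assumes "real_polynomial_function f" "\<delta> > 0"
  shows "\<exists>C>0. \<forall>w. \<bar>f w\<bar> \<le> C * exp (\<delta> * (w \<bullet> w))"
  using assms
proof (induction arbitrary: \<delta>)
  case (linear f)
  then obtain g where g: "f = (\<lambda>x. g \<bullet> x)" by (meson bounded_linear_euclidean_inner)
  have "\<bar>g \<bullet> w\<bar> \<le> (norm g * (1 / \<delta> + 1) + 1) * exp (\<delta> * (w \<bullet> w))" for w
  proof -
    have "norm w \<le> 1 + (norm w)\<^sup>2"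
      using zero_le_power2[of "norm w - 1/2"] by (simp add: power2_eq_square algebra_simps)
    also have "\<dots> \<le> (1 / \<delta> + 1) * (1 + \<delta> * (w \<bullet> w))"
      using linear.prems by (simp add: power2_norm_eq_inner field_simps)
    also have "\<dots> \<le> (1 / \<delta> + 1) * exp (\<delta> * (w \<bullet> w))"
      using linear.prems by (intro mult_left_mono exp_ge_add_one_self) auto
    finally have "norm g * norm w \<le> norm g * ((1 / \<delta> + 1) * exp (\<delta> * (w \<bullet> w)))"
      by (rule mult_left_mono) simp
    then have "\<bar>g \<bullet> w\<bar> \<le> norm g * ((1 / \<delta> + 1) * exp (\<delta> * (w \<bullet> w)))"
      using Cauchy_Schwarz_ineq2[of g w] by linarith
    also have "\<dots> \<le> (norm g * (1 / \<delta> + 1) + 1) * exp (\<delta> * (w \<bullet> w))"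
      by (simp add: distrib_right mult.assoc)
    finally show ?thesis .
  qed
  moreover have "norm g * (1 / \<delta> + 1) + 1 > 0"
    using linear.prems by (intro add_nonneg_pos mult_nonneg_nonneg) auto
  ultimately show ?case unfolding g by blast
next
  case (const c)
  have "\<bar>c\<bar> \<le> (\<bar>c\<bar> + 1) * exp (\<delta> * (w \<bullet> w))" for w :: 'a
  proof -
    have "\<bar>c\<bar> \<le> (\<bar>c\<bar> + 1) * 1" by simp
    also have "\<dots> \<le> (\<bar>c\<bar> + 1) * exp (\<delta> * (w \<bullet> w))"
      using const by (intro mult_left_mono) auto
    finally show ?thesis .
  qed
  then show ?case by (intro exI[of _ "\<bar>c\<bar> + 1"]) auto
next
  case (add f g)
  obtain C1 C2 where C: "C1 > 0" "C2 > 0" "\<And>w. \<bar>f w\<bar> \<le> C1 * exp (\<delta> * (w \<bullet> w))"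
    "\<And>w. \<bar>g w\<bar> \<le> C2 * exp (\<delta> * (w \<bullet> w))"
    using add.IH[OF add.prems] by blast
  have "\<bar>f w + g w\<bar> \<le> (C1 + C2) * exp (\<delta> * (w \<bullet> w))" for w
    using C(3,4)[of w] by (simp add: distrib_right abs_if split: if_splits)
  then show ?case using C by (intro exI[of _ "C1 + C2"]) auto
next
  case (mult f g)
  have d: "\<delta> / 2 > 0" using mult.prems by simp
  obtain C1 C2 where C: "C1 > 0" "C2 > 0" "\<And>w. \<bar>f w\<bar> \<le> C1 * exp (\<delta> / 2 * (w \<bullet> w))"
    "\<And>w. \<bar>g w\<bar> \<le> C2 * exp (\<delta> / 2 * (w \<bullet> w))"
    using mult.IH[OF d] by blast
  have "\<bar>f w * g w\<bar> \<le> (C1 * C2) * exp (\<delta> * (w \<bullet> w))" for w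
  proof -
    have "\<bar>f w * g w\<bar> \<le> (C1 * exp (\<delta> / 2 * (w \<bullet> w))) * (C2 * exp (\<delta> / 2 * (w \<bullet> w)))"
      unfolding abs_mult using C by (intro mult_mono) auto
    also have "\<dots> = (C1 * C2) * exp (\<delta> * (w \<bullet> w))"
      by (simp add: exp_add[symmetric] mult_ac flip: exp_add)
    finally show ?thesis .
  qed
  then show ?case using C by (intro exI[of _ "C1 * C2"]) auto
qed

text \<open>The norms of a function in the spaces \<open>L\<^sup>N\<close> tend to its supremum.\<close>

lemma sup_le_of_power_integrals:
  fixes f g :: "'a::euclidean_space \<Rightarrow> real"
  assumes f: "continuous_on UNIV f" "\<And>w. f w \<ge> 0" "\<And>n. integrable lborel (\<lambda>w. f w ^ Suc n)"
    and g: "\<And>w. g w \<ge> 0" "\<And>n. integrable lborel (\<lambda>w. g w ^ Suc n)"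
    and eq: "\<And>n. integral\<^sup>L lborel (\<lambda>w. f w ^ Suc n) = integral\<^sup>L lborel (\<lambda>w. g w ^ Suc n)"
    and m: "m > 0" "\<And>w. g w \<le> m"
  shows "f x \<le> m"
proof (rule ccontr)
  assume "\<not> f x \<le> m"
  define M where "M = (m + f x) / 2"
  have M: "m < M" "M < f x" using \<open>\<not> f x \<le> m\<close> by (auto simp: M_def)
  have "open {w. M < f w}" using f(1) by (intro open_Collect_less continuous_on_const)
  then obtain d where d: "d > 0" "ball x d \<subseteq> {w. M < f w}" using M open_contains_ball by blast
  define v where "v = measure lborel (ball x d)"
  have v: "v > 0" using content_ball_pos[OF d(1), of x] by (simp add: v_def)
  have int1: "integrable lborel (g)" using g(2)[of 0] by simp
  have bound: "M * v * (M / m) ^ n \<le> integral\<^sup>L lborel g" for n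
  proof -
    have "M ^ Suc n * v = integral\<^sup>L lborel (\<lambda>w. M ^ Suc n * indicator (ball x d) w)"
      by (simp add: v_def)
    also have "\<dots> \<le> integral\<^sup>L lborel (\<lambda>w. f w ^ Suc n)"
    proof (rule integral_mono)
      show "integrable lborel (\<lambda>w. M ^ Suc n * indicator (ball x d) w)"
        by (intro integrable_mult_right integrable_real_indicator) (use emeasure_lborel_ball_finite[of x d] in auto)
      show "M ^ Suc n * indicator (ball x d) w \<le> f w ^ Suc n" for w
      proof (cases "w \<in> ball x d")
        case True
        then have "M < f w" using d by auto
        then show ?thesis using M m True power_mono[of M "f w" "Suc n"] by simp
      next
        case False
        then show ?thesis using f(2)[of w] by simp
      qed
    qed (rule f(3))
    also have "\<dots> = integral\<^sup>L lborel (\<lambda>w. g w ^ Suc n)" by (rule eq)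
    also have "\<dots> \<le> integral\<^sup>L lborel (\<lambda>w. m ^ n * g w)"
    proof (rule integral_mono)
      show "g w ^ Suc n \<le> m ^ n * g w" for w
        using power_mono[OF m(2) g(1), of w n] g(1)[of w] by (simp add: mult.commute mult_left_mono)
    qed (use int1 g(2) in auto)
    also have "\<dots> = m ^ n * integral\<^sup>L lborel g" by simp
    finally have "M ^ Suc n * v / m ^ n \<le> integral\<^sup>L lborel g"
      using m by (simp add: divide_le_eq mult.commute)
    then show ?thesis by (simp add: power_divide mult_ac)
  qed
  have "1 < M / m" using M m by simp
  then obtain n where "integral\<^sup>L lborel g / (M * v) < (M / m) ^ n"
    using real_arch_pow by blast
  then have "integral\<^sup>L lborel g < M * v * (M / m) ^ n"
    using M m v by (simp add: divide_less_eq mult_ac)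
  then show False using bound[of n] by simp
qed

lemma mult_exp_le_one:
  fixes t :: real
  shows "exp 1 * t * exp (- t) \<le> 1" "exp 1 * t * exp (- t) = 1 \<longleftrightarrow> t = 1"
proof -
  have e: "exp 1 * t * exp (- t) = t * exp (1 - t)" by (simp add: exp_diff exp_minus field_simps)
  have "t \<le> exp (t - 1)" using exp_ge_add_one_self[of "t - 1"] by simp
  then have "t * exp (1 - t) \<le> exp (t - 1) * exp (1 - t)" by (intro mult_right_mono) auto
  then show "exp 1 * t * exp (- t) \<le> 1" unfolding e by (simp flip: exp_add)
  show "exp 1 * t * exp (- t) = 1 \<longleftrightarrow> t = 1"
  proof
    assume "exp 1 * t * exp (- t) = 1"
    then have t: "t * exp (1 - t) = 1" unfolding e .
    then have "t > 0" by (metis exp_gt_zero zero_less_mult_pos2 zero_less_one)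
    moreover have "t = exp (t - 1)" using t by (simp add: exp_diff field_simps)
    then have "ln t = t - 1" by (metis ln_exp)
    ultimately show "t = 1" by (rule ln_eq_minus_one)
  qed (simp flip: exp_add)
qed

lemma bounded_of_square_le:
  fixes a b r :: real
  assumes "r\<^sup>2 \<le> a * r + b" "a \<ge> 0" "b \<ge> 0" "r \<ge> 0"
  shows "r \<le> a + b + 1"
proof (rule ccontr)
  assume r: "\<not> r \<le> a + b + 1"
  have "b * 1 \<le> b * r" using r assms by (intro mult_left_mono) auto
  then have "r * r \<le> (a + b) * r" using assms(1) by (simp add: power2_eq_square distrib_right)
  then have "r \<le> a + b" using r assms by (simp add: mult_le_cancel_right)
  then show False using r by simp
qed

text \<open>The integrals of \<open>u\<^sup>2\<^sup>\<kappa>\<^sup>N exp (N p \<bullet> w)\<close> and \<open>u\<^sup>2\<^sup>\<kappa>\<^sup>N exp (N q \<bullet> w)\<close> agree, where \<open>u\<close> is a Gaussian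
  multiple of an element of \<open>B\<close> whose modulus peaks where finitely many elements of \<open>B\<close> take the same
  values as at \<open>x\<close>. Letting first \<open>N\<close> and then \<open>\<kappa>\<close> tend to infinity compares the maxima of the two
  linear forms over this set.\<close>

lemma equidistant_finite:
  assumes B: "laplacian_subalgebra B" and pq: "same_values B p q" and x: "x \<noteq> 0"
    and \<F>: "finite \<F>" "\<F> \<subseteq> B"
  shows "\<exists>w. w \<bullet> w = x \<bullet> x \<and> p \<bullet> x \<le> q \<bullet> w \<and> (\<forall>F\<in>\<F>. F w = F x)"
proof -
  define r where "r = x \<bullet> x"
  have r: "r > 0" using x by (simp add: r_def)
  define D where "D w = (\<Sum>F\<in>\<F>. (F w - F x)\<^sup>2)" for w
  have "(\<lambda>w. (F w - F x) ^ 2) \<in> B" if "F \<in> \<F>" for F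
    using lap_power[OF B lap_diff[OF B _ lap_const[OF B]]] \<F>(2) that by blast
  then have DB: "D \<in> B" unfolding D_def[abs_def] by (intro lap_sum[OF B \<F>(1)])
  have D: "D w \<ge> 0" "D x = 0" for w by (auto simp: D_def intro!: sum_nonneg)
  have D0: "\<forall>F\<in>\<F>. F w = F x" if "D w = 0" for w
    using that \<F>(1) by (simp add: D_def sum_nonneg_eq_0_iff)
  obtain C where C: "C > 0" "\<And>w. \<bar>D w\<bar> \<le> C * exp (1 / r * (w \<bullet> w))"
    using real_polynomial_exp_bound[OF lap_poly[OF B DB], of "1 / r"] r by auto
  define t where "t w = (w \<bullet> w) / r" for w :: 'a
  \<comment> \<open>The function \<open>u\<close> takes values in the interval from \<open>-1/2\<close> to \<open>1\<close>. The factor \<open>t exp (1 - t)\<close> is at most \<open>1\<close>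
    with equality on the sphere through \<open>x\<close>, and \<open>\<epsilon>\<close> keeps the subtracted term below \<open>1/2\<close>.\<close>
  define \<epsilon> where "\<epsilon> = 1 / (2 * C)"
  define Q where "Q w = exp 1 * t w - \<epsilon> * D w" for w
  define u where "u w = Q w * exp (- t w)" for w
  have \<epsilon>: "\<epsilon> > 0" using C by (simp add: \<epsilon>_def)
  have tB: "t \<in> B" using lap_cmult[OF B lap_norm2[OF B], of "1 / r"] by (simp add: t_def[abs_def])
  have QB: "Q \<in> B" unfolding Q_def[abs_def] by (intro lap_diff[OF B] lap_cmult[OF B] tB DB)
  have u_eq: "u w = exp 1 * t w * exp (- t w) - \<epsilon> * D w * exp (- t w)" for w
    by (simp add: u_def Q_def left_diff_distrib)
  have small: "0 \<le> \<epsilon> * D w * exp (- t w)" "\<epsilon> * D w * exp (- t w) \<le> 1 / 2" for w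
  proof -
    show "0 \<le> \<epsilon> * D w * exp (- t w)" using \<epsilon> D by simp
    have "\<epsilon> * D w * exp (- t w) \<le> \<epsilon> * (C * exp (t w)) * exp (- t w)"
      using \<epsilon> C(2)[of w] D(1)[of w] by (intro mult_right_mono mult_left_mono) (auto simp: t_def)
    also have "\<dots> = 1 / 2" using C(1) by (simp add: \<epsilon>_def exp_minus)
    finally show "\<epsilon> * D w * exp (- t w) \<le> 1 / 2" .
  qed
  have t0: "t w \<ge> 0" for w using r by (simp add: t_def)
  have u_le: "u w \<le> 1" "u w \<ge> - 1 / 2" for w
  proof -
    have "0 \<le> exp 1 * t w * exp (- t w)" using t0[of w] by simp
    then show "u w \<le> 1" "u w \<ge> - 1 / 2"
      using mult_exp_le_one(1)[of "t w"] small[of w] unfolding u_eq by linarith+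
  qed
  have abs_u: "\<bar>u w\<bar> \<le> 1" for w using u_le[of w] by linarith
  have u1: "t w = 1 \<and> D w = 0" if "u w = 1" for w
  proof -
    have "exp 1 * t w * exp (- t w) = 1" "\<epsilon> * D w * exp (- t w) = 0"
      using that mult_exp_le_one(1)[of "t w"] small(1)[of w] unfolding u_eq by linarith+
    then show ?thesis using mult_exp_le_one(2) \<epsilon> by auto
  qed
  have ux: "u x = 1" using D(2) r by (simp add: u_eq t_def r_def flip: exp_add)
  have contQ: "continuous_on S Q" and contD: "continuous_on S D" for S
    using lap_poly[OF B QB] lap_poly[OF B DB] by (simp_all add: continuous_on_polymonial_function real_polynomial_function_eq)
  have cont_u: "continuous_on S u" for S
    unfolding u_def[abs_def] t_def using r by (intro continuous_intros contQ) auto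
  define \<phi> where "\<phi> \<kappa> a w = u w ^ (2 * \<kappa>) * exp (a \<bullet> w)" for \<kappa> :: nat and a w :: 'a
  have \<phi>0: "\<phi> \<kappa> a w \<ge> 0" for \<kappa> a w by (simp add: \<phi>_def power_mult)
  have cont_\<phi>: "continuous_on UNIV (\<phi> \<kappa> a)" for \<kappa> a
    unfolding \<phi>_def[abs_def] by (intro continuous_intros cont_u)
  have power_\<phi>: "\<phi> \<kappa> a w ^ Suc n = Q w ^ (2 * \<kappa> * Suc n) *
      exp ((real (Suc n) *\<^sub>R a) \<bullet> w - (real (2 * \<kappa> * Suc n) / r) * (w \<bullet> w))" for \<kappa> a w n
  proof -
    have "\<phi> \<kappa> a w ^ Suc n = Q w ^ (2 * \<kappa> * Suc n) * (exp (- t w) ^ (2 * \<kappa> * Suc n) * exp (a \<bullet> w) ^ Suc n)"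
      unfolding \<phi>_def u_def power_mult_distrib power_mult[symmetric] by (simp only: mult.assoc)
    also have "exp (- t w) ^ (2 * \<kappa> * Suc n) * exp (a \<bullet> w) ^ Suc n
       = exp (real (2 * \<kappa> * Suc n) * (- t w) + real (Suc n) * (a \<bullet> w))"
      by (simp only: exp_add exp_of_nat_mult)
    also have "real (2 * \<kappa> * Suc n) * (- t w) + real (Suc n) * (a \<bullet> w)
       = (real (Suc n) *\<^sub>R a) \<bullet> w - (real (2 * \<kappa> * Suc n) / r) * (w \<bullet> w)"
      unfolding t_def by (simp only: inner_scaleR_left) (simp add: field_simps)
    finally show ?thesis .
  qed
  have pos: "real (2 * \<kappa> * Suc n) / r > 0" if "\<kappa> \<ge> 1" for \<kappa> n
  proof -
    have "2 * \<kappa> * Suc n > 0" using that by simp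
    then have "real (2 * \<kappa> * Suc n) > 0" by (simp only: of_nat_0_less_iff)
    then show ?thesis using r by (rule divide_pos_pos)
  qed
  have int_\<phi>: "integrable lborel (\<lambda>w. \<phi> \<kappa> a w ^ Suc n)" if "\<kappa> \<ge> 1" for \<kappa> a n
    unfolding power_\<phi>
    using exp_integral_heat[OF lap_poly[OF B lap_power[OF B QB]] pos[OF that]] has_bochner_integral_iff by blast
  have eq_\<phi>: "integral\<^sup>L lborel (\<lambda>w. \<phi> \<kappa> p w ^ Suc n) = integral\<^sup>L lborel (\<lambda>w. \<phi> \<kappa> q w ^ Suc n)" if "\<kappa> \<ge> 1" for \<kappa> n
    unfolding power_\<phi>
    by (rule same_values_exp_integral[OF B same_values_scale[OF B pq] lap_power[OF B QB] pos[OF that]])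
  \<comment> \<open>As \<open>u x = 1\<close>, the supremum for \<open>p\<close> is at least \<open>exp (p \<bullet> x)\<close>, and the supremum for \<open>q\<close> is no smaller.\<close>
  have ex: "\<exists>w. exp (p \<bullet> x - 1 / real (Suc n)) < \<phi> (Suc n) q w" for n
  proof (rule ccontr)
    assume "\<not> ?thesis"
    then have le: "\<phi> (Suc n) q w \<le> exp (p \<bullet> x - 1 / real (Suc n))" for w by (simp only: not_ex not_less)
    have n1: "Suc n \<ge> 1" by simp
    have "\<phi> (Suc n) p x \<le> exp (p \<bullet> x - 1 / real (Suc n))"
      by (rule sup_le_of_power_integrals[OF cont_\<phi> \<phi>0 int_\<phi>[OF n1] \<phi>0 int_\<phi>[OF n1] eq_\<phi>[OF n1] exp_gt_zero le])
    moreover have "\<phi> (Suc n) p x = exp (p \<bullet> x)" by (simp add: \<phi>_def ux)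
    ultimately have "p \<bullet> x \<le> p \<bullet> x - 1 / real (Suc n)" by (simp only: exp_le_cancel_iff)
    then show False by simp
  qed
  then obtain w where w: "\<And>n. exp (p \<bullet> x - 1 / real (Suc n)) < \<phi> (Suc n) q (w n)" by metis
  have lower: "exp (p \<bullet> x - 1) \<le> \<phi> (Suc n) q (w n)" for n
  proof -
    have "exp (p \<bullet> x - 1) \<le> exp (p \<bullet> x - 1 / real (Suc n))" by (simp add: field_simps)
    then show ?thesis using w[of n] by linarith
  qed
  obtain C2 where C2: "C2 > 0" "\<And>w. \<bar>Q w\<bar> \<le> C2 * exp (1 / (2 * r) * (w \<bullet> w))"
    using real_polynomial_exp_bound[OF lap_poly[OF B QB], of "1 / (2 * r)"] r by auto
  \<comment> \<open>The exponents \<open>2 \<kappa>\<close> are at least \<open>2\<close> and \<open>u\<close> has modulus at most \<open>1\<close>, so the Gaussian decay of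
    \<open>u\<^sup>2 exp (q \<bullet> w)\<close> confines all near-maximizers to one ball.\<close>
  define K where "K = r * (\<bar>ln (C2 ^ 2)\<bar> + \<bar>p \<bullet> x - 1\<bar>)"
  have bound: "norm (w n) \<le> r * norm q + K + 1" for n
  proof (rule bounded_of_square_le)
    let ?w = "w n"
    have "u ?w ^ (2 * Suc n) \<le> u ?w ^ 2"
    proof -
      have "(u ?w ^ 2) ^ Suc n \<le> (u ?w ^ 2) ^ 1"
        using abs_u[of ?w] by (intro power_decreasing) (auto simp: abs_square_le_1)
      then show ?thesis by (simp only: power_mult power_one_right)
    qed
    also have "u ?w ^ 2 \<le> (C2 * exp (t ?w / 2) * exp (- t ?w)) ^ 2"
    proof -
      have "\<bar>u ?w\<bar> \<le> C2 * exp (t ?w / 2) * exp (- t ?w)"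
      proof -
        have "1 / (2 * r) * (?w \<bullet> ?w) = t ?w / 2" by (simp add: t_def)
        then have "\<bar>Q ?w\<bar> \<le> C2 * exp (t ?w / 2)" using C2(2)[of ?w] by (simp only:)
        then show ?thesis unfolding u_def abs_mult by (simp add: mult_right_mono)
      qed
      from power_mono[OF this abs_ge_zero, of 2] show ?thesis by (simp only: power2_abs)
    qed
    also have "\<dots> = C2 ^ 2 * exp (- t ?w)"
      by (simp add: power_mult_distrib mult.assoc flip: exp_add exp_of_nat_mult)
    finally have "\<phi> (Suc n) q ?w \<le> C2 ^ 2 * exp (- t ?w) * exp (q \<bullet> ?w)"
      unfolding \<phi>_def by (intro mult_right_mono) auto
    also have "\<dots> = exp (ln (C2 ^ 2) - t ?w + q \<bullet> ?w)" using C2(1) by (simp add: exp_add exp_diff exp_minus field_simps)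
    finally have "p \<bullet> x - 1 \<le> ln (C2 ^ 2) - t ?w + q \<bullet> ?w" using lower[of n] by (meson exp_le_cancel_iff order_trans)
    then have "t ?w \<le> norm q * norm ?w + (\<bar>ln (C2 ^ 2)\<bar> + \<bar>p \<bullet> x - 1\<bar>)"
      using norm_cauchy_schwarz[of q ?w] by linarith
    then have "r * t ?w \<le> r * (norm q * norm ?w + (\<bar>ln (C2 ^ 2)\<bar> + \<bar>p \<bullet> x - 1\<bar>))" using r by simp
    then show "(norm ?w)\<^sup>2 \<le> r * norm q * norm ?w + K"
      using r by (simp add: t_def K_def power2_norm_eq_inner algebra_simps)
  qed (use r in \<open>auto simp: K_def\<close>)
  define R where "R = r * norm q + K + 1"
  have "\<forall>n. w n \<in> cball 0 R" using bound by (simp add: R_def)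
  then have "\<exists>y\<in>cball 0 R. \<exists>s. strict_mono s \<and> (w \<circ> s) \<longlonglongrightarrow> y"
    using compact_cball[of "0::'a" R] unfolding compact_def by blast
  then obtain y s where y: "strict_mono s" "(\<lambda>n. w (s n)) \<longlonglongrightarrow> y" unfolding o_def by blast
  have "p \<bullet> x \<le> q \<bullet> y"
  proof (rule LIMSEQ_le)
    show "(\<lambda>n. p \<bullet> x - 1 / real (Suc (s n))) \<longlonglongrightarrow> p \<bullet> x"
    proof -
      have "(\<lambda>n. 1 / real (Suc n)) \<longlonglongrightarrow> 0" using LIMSEQ_inverse_real_of_nat by (simp add: inverse_eq_divide)
      then have "(\<lambda>n. p \<bullet> x - 1 / real (Suc n)) \<longlonglongrightarrow> p \<bullet> x - 0" by (intro tendsto_intros)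
      from LIMSEQ_subseq_LIMSEQ[OF this y(1)] show ?thesis by (simp add: o_def)
    qed
    show "(\<lambda>n. q \<bullet> w (s n)) \<longlonglongrightarrow> q \<bullet> y" by (intro tendsto_intros y)
    have "p \<bullet> x - 1 / real (Suc n) \<le> q \<bullet> w n" for n
    proof -
      have "u (w n) ^ (2 * Suc n) \<le> 1"
        using abs_u[of "w n"] power_le_one[of "(u (w n))\<^sup>2" "Suc n"] unfolding power_mult by (simp add: abs_square_le_1)
      then have "\<phi> (Suc n) q (w n) \<le> 1 * exp (q \<bullet> w n)" unfolding \<phi>_def by (intro mult_right_mono) auto
      then have "exp (p \<bullet> x - 1 / real (Suc n)) \<le> exp (q \<bullet> w n)" using w[of n] by linarith
      then show ?thesis by simp
    qed
    then show "\<exists>N. \<forall>n\<ge>N. p \<bullet> x - 1 / real (Suc (s n)) \<le> q \<bullet> w (s n)" by blast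
  qed
  \<comment> \<open>The power \<open>2 \<kappa>\<close> of \<open>u\<close> stays bounded below along the near-maximizers, so \<open>u\<close> itself tends to \<open>1\<close> in
    modulus.\<close>
  moreover have "u y = 1"
  proof -
    define c where "c = \<bar>p \<bullet> x - 1\<bar> + norm q * R"
    have ulow: "exp (- c / real (2 * Suc n)) \<le> \<bar>u (w n)\<bar>" for n
    proof (rule ccontr)
      assume "\<not> ?thesis"
      then have "\<bar>u (w n)\<bar> ^ (2 * Suc n) < exp (- c / real (2 * Suc n)) ^ (2 * Suc n)"
        by (intro power_strict_mono) auto
      also have "\<dots> = exp (- c)" unfolding exp_of_nat_mult[symmetric] by (simp del: of_nat_Suc of_nat_mult)
      finally have "u (w n) ^ (2 * Suc n) < exp (- c)" by (simp add: power_even_abs)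
      then have "\<phi> (Suc n) q (w n) < exp (- c) * exp (q \<bullet> w n)"
        unfolding \<phi>_def by (intro mult_strict_right_mono) auto
      then have "exp (p \<bullet> x - 1) < exp (- c) * exp (q \<bullet> w n)" using lower[of n] by linarith
      then have "exp (p \<bullet> x - 1) < exp (- c + q \<bullet> w n)" by (simp only: exp_add)
      then have "p \<bullet> x - 1 < - c + q \<bullet> w n" by simp
      moreover have "q \<bullet> w n \<le> norm q * R"
        using norm_cauchy_schwarz[of q "w n"] mult_left_mono[OF bound[of n], of "norm q"] by (simp add: R_def)
      ultimately show False unfolding c_def by linarith
    qed
    have "(\<lambda>n. exp (- c / real (2 * Suc (s n)))) \<longlonglongrightarrow> exp 0"
    proof (intro tendsto_exp)
      have "(\<lambda>n. (- c / 2) * inverse (real (Suc n))) \<longlonglongrightarrow> (- c / 2) * 0"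
        by (intro tendsto_intros LIMSEQ_inverse_real_of_nat)
      from LIMSEQ_subseq_LIMSEQ[OF this y(1)] show "(\<lambda>n. - c / real (2 * Suc (s n))) \<longlonglongrightarrow> 0"
        by (simp add: o_def field_simps)
    qed
    moreover have "(\<lambda>n. \<bar>u (w (s n))\<bar>) \<longlonglongrightarrow> \<bar>u y\<bar>"
      using continuous_on_tendsto_compose[OF cont_u[of UNIV] y(2)] by (intro tendsto_rabs) auto
    ultimately have "exp 0 \<le> \<bar>u y\<bar>" using ulow by (intro LIMSEQ_le) auto
    then show ?thesis using u_le[of y] by (auto simp: abs_if split: if_splits)
  qed
  then have "t y = 1" "D y = 0" using u1 by auto
  then have "y \<bullet> y = x \<bullet> x" "\<forall>F\<in>\<F>. F y = F x" using r D0 by (auto simp: t_def r_def)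
  ultimately show ?thesis by blast
qed

text \<open>The class of \<open>x\<close> is cut out of the compact set of all \<open>w\<close> with \<open>norm w = norm x\<close> and \<open>p \<bullet> x \<le> q \<bullet> w\<close>
  by closed sets with the finite intersection property.\<close>

lemma same_values_equidistant:
  assumes B: "laplacian_subalgebra B" and pq: "same_values B p q"
  shows "\<exists>y. same_values B x y \<and> p \<bullet> x \<le> q \<bullet> y"
proof (cases "x = 0")
  case True
  then show ?thesis by (intro exI[of _ 0]) (simp add: same_values_def)
next
  case False
  let ?K = "{w. w \<bullet> w = x \<bullet> x \<and> p \<bullet> x \<le> q \<bullet> w}"
  let ?L = "\<lambda>F. {w. F w = F x}"
  have "closed ?K"
    by (intro closed_Collect_conj closed_Collect_eq closed_Collect_le continuous_intros)
  moreover have "?K \<subseteq> cball 0 (norm x)" by (auto simp: norm_eq_sqrt_inner)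
  then have "cball 0 (norm x) \<inter> ?K = ?K" by blast
  ultimately have cpt: "compact ?K" using compact_Int_closed[OF compact_cball, of ?K 0 "norm x"] by simp
  have cl: "closed (?L F)" if "F \<in> B" for F
    using lap_poly[OF B that] by (intro closed_Collect_eq continuous_on_const)
      (simp add: continuous_on_polymonial_function real_polynomial_function_eq)
  have fip: "?K \<inter> \<Inter>\<C> \<noteq> {}" if fin: "finite \<C>" "\<C> \<subseteq> ?L ` B" for \<C>
  proof -
    obtain \<F> where \<F>: "finite \<F>" "\<F> \<subseteq> B" "\<C> = ?L ` \<F>" using finite_subset_image[OF fin] by blast
    obtain w where w: "w \<bullet> w = x \<bullet> x \<and> p \<bullet> x \<le> q \<bullet> w \<and> (\<forall>F\<in>\<F>. F w = F x)"
      using equidistant_finite[OF B pq False \<F>(1,2)] by (rule exE)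
    then have "w \<in> ?K" "w \<in> \<Inter>\<C>" unfolding \<F>(3) by simp_all
    then have "w \<in> ?K \<inter> \<Inter>\<C>" by (rule IntI)
    then show ?thesis by (rule ex_in_conv[THEN iffD1, OF exI])
  qed
  have "?K \<inter> \<Inter>(?L ` B) \<noteq> {}"
    by (rule compact_imp_fip[OF cpt _ fip]) (use cl in blast)
  then obtain y where "y \<in> ?K \<inter> \<Inter>(?L ` B)" by blast
  then have "p \<bullet> x \<le> q \<bullet> y" "\<And>F. F \<in> B \<Longrightarrow> F y = F x" by simp_all
  then have "same_values B x y" unfolding same_values_def by metis
  with \<open>p \<bullet> x \<le> q \<bullet> y\<close> show ?thesis by blast
qed

section \<open>Shears of a power that preserve generalized polarizations\<close>

text \<open>Slot \<open>i\<close> is the one in which the polynomials of \<open>A\<close> are evaluated, and \<open>B\<close> stands for the algebra of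
  generalized polarizations of \<open>A\<close>.\<close>

locale polarized =
  fixes i :: "'k::finite" and A :: "('a::euclidean_space \<Rightarrow> real) set" and B :: "('a ^ 'k \<Rightarrow> real) set"
  assumes lap: "laplacian_subalgebra B"
    and A_poly: "f \<in> A \<Longrightarrow> real_polynomial_function f"
    and slot_mem: "f \<in> A \<Longrightarrow> (\<lambda>v. f (v $ i)) \<in> B"
    and inner_mem: "(\<lambda>v. v $ j \<bullet> v $ l) \<in> B"
begin

lemma nth_axis_other: "b \<noteq> c \<Longrightarrow> axis b u $ c = 0" for u :: 'a
  by (simp add: axis_def)

lemma grad_slot:
  fixes v :: "'a ^ 'k"
  assumes "real_polynomial_function f"
  shows "grad (\<lambda>v. f (v $ a)) v = axis a (grad f (v $ a))"
proof (rule grad_eqI)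
  have "((\<lambda>v. f (v $ a)) has_derivative (\<lambda>u. grad f (v $ a) \<bullet> u $ a)) (at v)"
    by (rule has_derivative_compose[OF _ has_derivative_grad[OF assms]])
       (rule bounded_linear_imp_has_derivative[OF bounded_linear_vec_nth])
  then show "((\<lambda>v. f (v $ a)) has_derivative (\<lambda>u. axis a (grad f (v $ a)) \<bullet> u)) (at v)"
    by (simp add: inner_axis')
qed

lemma grad_inner_slots: "grad (\<lambda>v. v $ a \<bullet> v $ b) v = axis a (v $ b) + axis b (v $ a)" for v :: "'a ^ 'k"
proof (rule grad_eqI)
  have "((\<lambda>v. v $ a \<bullet> v $ b) has_derivative (\<lambda>u. v $ a \<bullet> u $ b + u $ a \<bullet> v $ b)) (at v)"
    by (rule has_derivative_inner) (rule bounded_linear_imp_has_derivative[OF bounded_linear_vec_nth])+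
  then show "((\<lambda>v. v $ a \<bullet> v $ b) has_derivative (\<lambda>u. (axis a (v $ b) + axis b (v $ a)) \<bullet> u)) (at v)"
    by (simp add: inner_add_left inner_axis' inner_commute[of "v $ b"] add.commute)
qed

lemma slot_radial:
  assumes "F \<in> B"
  shows "(\<lambda>v. grad F v \<bullet> axis b (v $ b)) \<in> B"
proof -
  have "(\<lambda>v. (1/2) * (grad F v \<bullet> grad (\<lambda>v. v $ b \<bullet> v $ b) v)) \<in> B"
    by (intro lap_cmult[OF lap] lap_grad_inner[OF lap] assms inner_mem)
  then show ?thesis by (simp add: grad_inner_slots inner_add_right)
qed

text \<open>The gradient of \<open>\<xi> (v\<^sub>a) \<bullet> v\<^sub>b\<close> consists of \<open>\<xi> (v\<^sub>a)\<close> in slot \<open>b\<close>, of degree \<open>0\<close> in \<open>v\<^sub>b\<close>, and of a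
  field in slot \<open>a\<close> of degree \<open>1\<close> in \<open>v\<^sub>b\<close>. The radial field of slot \<open>b\<close> tells them apart.\<close>

lemma shear_field_mem:
  assumes ab: "a \<noteq> b" and \<xi>: "polynomial_function \<xi>" and H: "(\<lambda>v. \<xi> (v $ a) \<bullet> v $ b) \<in> B" and F: "F \<in> B"
  shows "(\<lambda>v. grad F v \<bullet> axis b (\<xi> (v $ a))) \<in> B"
proof (rule lap_split_gradient_field[where e = "\<lambda>v. axis b (v $ b)", OF lap H _ slot_radial _ F])
  let ?H = "\<lambda>v. \<xi> (v $ a) \<bullet> v $ b" and ?e = "\<lambda>v. axis b (v $ b) :: 'a ^ 'k"
  show "bounded_linear ?e"
    by (intro linear_conv_bounded_linear[THEN iffD1] linearI) (simp_all add: vec_eq_iff axis_def)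
  fix v
  define r where "r w x = grad (\<lambda>y. \<xi> y \<bullet> w) x" for w x
  have poly: "real_polynomial_function (\<lambda>y. \<xi> y \<bullet> w)" for w
    by (rule real_polynomial_inner[OF \<xi> polynomial_function_const])
  have "\<forall>x. \<exists>D. (\<xi> has_derivative D) (at x)"
    using differentiable_at_polynomial_function[OF \<xi>] unfolding differentiable_def by blast
  then obtain \<xi>' where \<xi>': "(\<xi> has_derivative \<xi>' x) (at x)" for x by metis
  have r: "r w x \<bullet> u = \<xi>' x u \<bullet> w" for w x u
    unfolding r_def by (rule grad_dot) (auto intro!: derivative_eq_intros \<xi>')
  have gradH: "grad ?H v = axis b (\<xi> (v $ a)) + axis a (r (v $ b) (v $ a))" for v
  proof (rule grad_eqI)
    have "((\<lambda>v. \<xi> (v $ a)) has_derivative (\<lambda>u. \<xi>' (v $ a) (u $ a))) (at v)"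
      by (rule has_derivative_compose[OF _ \<xi>'])
         (rule bounded_linear_imp_has_derivative[OF bounded_linear_vec_nth])
    from has_derivative_inner[OF this bounded_linear_imp_has_derivative[OF bounded_linear_vec_nth]]
    have "(?H has_derivative (\<lambda>u. \<xi> (v $ a) \<bullet> u $ b + \<xi>' (v $ a) (u $ a) \<bullet> v $ b)) (at v)" .
    then show "(?H has_derivative (\<lambda>u. (axis b (\<xi> (v $ a)) + axis a (r (v $ b) (v $ a))) \<bullet> u)) (at v)"
      by (simp add: inner_add_left inner_axis' r)
  qed
  have r_scale: "r (c *\<^sub>R w) x = c *\<^sub>R r w x" for c w x
    by (rule euclidean_eqI) (simp add: r)
  have "((\<lambda>s. grad ?H (v + s *\<^sub>R ?e v)) has_vector_derivative hess ?H v (?e v)) (at 0)"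
    using has_derivative_along_line[of "grad ?H" "hess ?H v" v 0 "?e v"] has_derivative_hess[OF lap_poly[OF lap H]]
    by simp
  moreover have "grad ?H (v + s *\<^sub>R ?e v) = axis b (\<xi> (v $ a)) + (1 + s) *\<^sub>R axis a (r (v $ b) (v $ a))" for s
  proof -
    have "(v + s *\<^sub>R ?e v) $ a = v $ a" "(v + s *\<^sub>R ?e v) $ b = (1 + s) *\<^sub>R v $ b"
      using ab by (simp_all add: axis_def scaleR_left_distrib)
    then show ?thesis unfolding gradH by (simp only: r_scale) (simp add: vec_eq_iff axis_def)
  qed
  moreover have "((\<lambda>s. axis b (\<xi> (v $ a)) + (1 + s) *\<^sub>R axis a (r (v $ b) (v $ a)))
      has_vector_derivative axis a (r (v $ b) (v $ a))) (at 0)"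
    unfolding has_vector_derivative_def by (auto intro!: derivative_eq_intros)
  ultimately have "hess ?H v (?e v) = axis a (r (v $ b) (v $ a))"
    by (metis (no_types, lifting) ext vector_derivative_unique_at)
  moreover have "?e (grad ?H v) = axis b (\<xi> (v $ a))" using ab by (simp add: gradH axis_def)
  ultimately show "hess ?H v (?e v) - ?e (grad ?H v) = grad ?H v - 2 *\<^sub>R axis b (\<xi> (v $ a))"
    by (simp add: gradH scaleR_2)
qed

definition preserves :: "('a ^ 'k \<Rightarrow> 'a ^ 'k) \<Rightarrow> bool" where
  "preserves T \<longleftrightarrow> (\<forall>x y. same_values B x y \<longrightarrow> same_values B (T x) (T y))"

lemma preserves_comp: "preserves S \<Longrightarrow> preserves T \<Longrightarrow> preserves (\<lambda>v. S (T v))"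
  by (simp add: preserves_def)

lemma preserves_shear_mem:
  assumes "a \<noteq> b" "polynomial_function \<xi>" "(\<lambda>v. \<xi> (v $ a) \<bullet> v $ b) \<in> B"
  shows "preserves (\<lambda>v. v + axis b (s *\<^sub>R \<xi> (v $ a)))"
  unfolding preserves_def
proof (intro allI impI)
  fix x y assume xy: "same_values B x y"
  have "same_values B (x + s *\<^sub>R axis b (\<xi> (x $ a))) (y + s *\<^sub>R axis b (\<xi> (y $ a)))"
  proof (rule same_values_flow[where c = 0, OF lap_poly[OF lap] shear_field_mem[OF assms] _ xy])
    show "axis b (\<xi> ((v + s *\<^sub>R axis b (\<xi> (v $ a))) $ a)) = (1 + 0 * s) *\<^sub>R axis b (\<xi> (v $ a))" for v s
      using assms(1) by (simp add: axis_def)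
  qed
  moreover have "s *\<^sub>R axis b u = axis b (s *\<^sub>R u)" for u :: 'a
    by (simp add: vec_eq_iff axis_def)
  ultimately show "same_values B (x + axis b (s *\<^sub>R \<xi> (x $ a))) (y + axis b (s *\<^sub>R \<xi> (y $ a)))" by simp
qed

lemma preserves_slot_scale: "preserves (\<lambda>v. v + axis b (s *\<^sub>R v $ b))"
  unfolding preserves_def
proof (intro allI impI)
  fix x y assume xy: "same_values B x y"
  have "same_values B (x + s *\<^sub>R axis b (x $ b)) (y + s *\<^sub>R axis b (y $ b))"
  proof (rule same_values_flow[where c = 1, OF lap_poly[OF lap] slot_radial _ xy])
    show "axis b ((v + s *\<^sub>R axis b (v $ b)) $ b) = (1 + 1 * s) *\<^sub>R axis b (v $ b)" for v :: "'a ^ 'k" and s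
      by (simp add: vec_eq_iff axis_def scaleR_left_distrib)
  qed
  moreover have "s *\<^sub>R axis b u = axis b (s *\<^sub>R u)" for u :: 'a
    by (simp add: vec_eq_iff axis_def)
  ultimately show "same_values B (x + axis b (s *\<^sub>R x $ b)) (y + axis b (s *\<^sub>R y $ b))" by simp
qed

definition swap :: "'k \<Rightarrow> 'k \<Rightarrow> 'a ^ 'k \<Rightarrow> 'a ^ 'k" where
  "swap a b v = (\<chi> c. v $ (if c = a then b else if c = b then a else c))"

text \<open>A quarter turn in the plane of two slots is a product of three shears. A reflection of one slot makes
  it a transposition.\<close>

lemma preserves_swap: "preserves (swap a b)"
proof (cases "a = b")
  case True
  then have "swap a b = (\<lambda>v. v)" by (auto simp: swap_def vec_eq_iff)
  then show ?thesis by (simp add: preserves_def)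
next
  case False
  have id: "preserves (\<lambda>v. v + axis d (s *\<^sub>R v $ c))" if "c \<noteq> d" for c d s
    using preserves_shear_mem[OF that polynomial_function_id inner_mem] .
  have "preserves (\<lambda>v. (\<lambda>v. v + axis b ((-2) *\<^sub>R v $ b)) ((\<lambda>v. v + axis a (1 *\<^sub>R v $ b))
     ((\<lambda>v. v + axis b ((-1) *\<^sub>R v $ a)) ((\<lambda>v. v + axis a (1 *\<^sub>R v $ b)) v))))"
    by (rule preserves_comp[OF preserves_slot_scale preserves_comp[OF id preserves_comp[OF id id]]])
       (use False in auto)
  moreover have "(\<lambda>v. v + axis b ((-2) *\<^sub>R v $ b)) ((\<lambda>v. v + axis a (1 *\<^sub>R v $ b))
     ((\<lambda>v. v + axis b ((-1) *\<^sub>R v $ a)) ((\<lambda>v. v + axis a (1 *\<^sub>R v $ b)) v))) = swap a b v" for v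
    using False by (auto simp: vec_eq_iff axis_def swap_def scaleR_2)
  ultimately show ?thesis by simp
qed

text \<open>The membership condition makes \<open>v\<^sub>b + s \<xi> (v\<^sub>i)\<close> a shear that preserves the classes; transpositions of slots
  then carry it over to sources other than \<open>i\<close>.\<close>

definition shear_field :: "('a \<Rightarrow> 'a) \<Rightarrow> bool" where
  "shear_field \<xi> \<longleftrightarrow> polynomial_function \<xi> \<and> (\<forall>b. b \<noteq> i \<longrightarrow> (\<lambda>v. \<xi> (v $ i) \<bullet> v $ b) \<in> B)"

lemma preserves_shear:
  assumes ab: "a \<noteq> b" and \<xi>: "shear_field \<xi>"
  shows "preserves (\<lambda>v. v + axis b (s *\<^sub>R \<xi> (v $ a)))"
proof -
  let ?b = "if b = i then a else if b = a then i else b"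
  have "?b \<noteq> i" using ab by auto
  then have sh: "preserves (\<lambda>v. v + axis ?b (s *\<^sub>R \<xi> (v $ i)))"
    using \<xi> by (intro preserves_shear_mem) (auto simp: shear_field_def)
  have "preserves (\<lambda>v. swap i a ((\<lambda>v. v + axis ?b (s *\<^sub>R \<xi> (v $ i))) (swap i a v)))"
    by (rule preserves_comp[OF preserves_swap preserves_comp[OF sh preserves_swap]])
  moreover have "swap i a ((\<lambda>v. v + axis ?b (s *\<^sub>R \<xi> (v $ i))) (swap i a v)) = v + axis b (s *\<^sub>R \<xi> (v $ a))" for v
    using ab by (auto simp: vec_eq_iff swap_def axis_def)
  ultimately show ?thesis by simp
qed

lemma shear_field_id: "shear_field (\<lambda>x. x)"
  by (simp add: shear_field_def inner_mem)

lemma shear_field_grad: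
  assumes "h \<in> A"
  shows "shear_field (grad h)"
  unfolding shear_field_def
proof (intro conjI allI impI)
  show "polynomial_function (grad h)" using polynomial_grad A_poly assms by blast
  fix b assume "b \<noteq> i"
  have "(\<lambda>v. grad (\<lambda>v. h (v $ i)) v \<bullet> grad (\<lambda>v. v $ i \<bullet> v $ b) v) \<in> B"
    by (intro lap_grad_inner[OF lap] slot_mem inner_mem assms)
  then show "(\<lambda>v. grad h (v $ i) \<bullet> v $ b) \<in> B"
    using nth_axis_other[OF \<open>b \<noteq> i\<close>] by (simp add: grad_slot A_poly assms grad_inner_slots inner_axis')
qed

text \<open>Differentiate \<open>grad f (v\<^sub>i) \<bullet> v\<^sub>b\<close> along the gradient of \<open>h (v\<^sub>i)\<close>, which acts on slot \<open>i\<close> only.\<close>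

lemma shear_field_hess:
  assumes f: "f \<in> A" and h: "h \<in> A"
  shows "shear_field (\<lambda>x. hess f x (grad h x))"
  unfolding shear_field_def
proof (intro conjI allI impI)
  show "polynomial_function (\<lambda>x. hess f x (grad h x))"
    using polynomial_hess polynomial_grad A_poly assms by blast
  fix b assume b: "b \<noteq> i"
  let ?G = "\<lambda>v. grad f (v $ i) \<bullet> v $ b"
  have G: "?G \<in> B" using shear_field_grad[OF f] b by (simp add: shear_field_def)
  have "grad ?G v \<bullet> axis i (grad h (v $ i)) = hess f (v $ i) (grad h (v $ i)) \<bullet> v $ b" for v
  proof -
    have "((\<lambda>v. grad f (v $ i)) has_derivative (\<lambda>u. hess f (v $ i) (u $ i))) (at v)"
      by (rule has_derivative_compose[OF _ has_derivative_hess[OF A_poly[OF f]]])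
         (rule bounded_linear_imp_has_derivative[OF bounded_linear_vec_nth])
    from grad_dot[OF has_derivative_inner[OF this bounded_linear_imp_has_derivative[OF bounded_linear_vec_nth]]]
    show ?thesis using b by (simp add: axis_def)
  qed
  moreover have "(\<lambda>v. grad ?G v \<bullet> grad (\<lambda>v. h (v $ i)) v) \<in> B"
    by (intro lap_grad_inner[OF lap] G slot_mem h)
  ultimately show "(\<lambda>v. hess f (v $ i) (grad h (v $ i)) \<bullet> v $ b) \<in> B"
    by (simp add: grad_slot A_poly h)
qed

subsection \<open>Invariants of the classes\<close>

lemma slot_value:
  assumes "f \<in> A" "same_values B x y"
  shows "f (x $ a) = f (y $ a)"
proof -
  have "same_values B (swap i a x) (swap i a y)" using preserves_swap assms(2) by (simp add: preserves_def)
  from bspec[OF this[unfolded same_values_def] slot_mem[OF assms(1)]]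
  show ?thesis by (simp add: swap_def)
qed

lemma same_values_shear:
  assumes "a \<noteq> b" "shear_field \<xi>" "same_values B x y"
  shows "same_values B (x + axis b (s *\<^sub>R \<xi> (x $ a))) (y + axis b (s *\<^sub>R \<xi> (y $ a)))"
  using preserves_shear[OF assms(1,2)] assms(3) by (simp add: preserves_def)

lemma same_values_shear_sum:
  assumes "finite I" "\<And>l. l \<in> I \<Longrightarrow> a l \<noteq> b \<and> shear_field (\<xi> l)" "same_values B x y"
  shows "same_values B (x + axis b (\<Sum>l\<in>I. t l *\<^sub>R \<xi> l (x $ a l))) (y + axis b (\<Sum>l\<in>I. t l *\<^sub>R \<xi> l (y $ a l)))"
  using assms(1,2)
proof (induction I rule: finite_induct)
  case empty
  have "axis b (0::'a) = 0" by (simp add: vec_eq_iff axis_def)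
  then show ?case using assms(3) by (simp only: sum.empty add_0_right)
next
  case (insert j I)
  let ?S = "\<lambda>x. x + axis b (\<Sum>l\<in>I. t l *\<^sub>R \<xi> l (x $ a l))"
  have "same_values B (?S x + axis b (t j *\<^sub>R \<xi> j (?S x $ a j))) (?S y + axis b (t j *\<^sub>R \<xi> j (?S y $ a j)))"
    by (rule same_values_shear) (use insert in auto)
  moreover have "?S x + axis b (t j *\<^sub>R \<xi> j (?S x $ a j)) = x + axis b (\<Sum>l\<in>insert j I. t l *\<^sub>R \<xi> l (x $ a l))" for x
    using insert by (auto simp: vec_eq_iff axis_def add_ac)
  ultimately show ?case by (simp only:)
qed

text \<open>Both sides are derivatives of the value of \<open>f\<close> in slot \<open>b\<close> along a shear.\<close>

lemma grad_inner_shear_field: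
  assumes f: "f \<in> A" and xy: "same_values B x y" and "a \<noteq> b" "shear_field \<xi>"
  shows "grad f (x $ b) \<bullet> \<xi> (x $ a) = grad f (y $ b) \<bullet> \<xi> (y $ a)"
proof -
  have "(\<lambda>s. f (x $ b + s *\<^sub>R \<xi> (x $ a))) = (\<lambda>s. f (y $ b + s *\<^sub>R \<xi> (y $ a)))"
    using slot_value[OF f same_values_shear[OF assms(3,4) xy], of _ b] by (simp add: axis_def)
  then show ?thesis
    using deriv_along_line[OF A_poly[OF f], of "x $ b" "\<xi> (x $ a)" 0]
      deriv_along_line[OF A_poly[OF f], of "y $ b" "\<xi> (y $ a)" 0] DERIV_unique by simp
qed

text \<open>Emptying another slot makes room to collect gradients at the point of slot \<open>a\<close>.\<close>

lemma slot_value_add_gradients: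
  assumes card: "CARD('k) \<ge> 2" and f: "f \<in> A" and xy: "same_values B x y" and I: "finite I" "h ` I \<subseteq> A"
  shows "f (x $ a + (\<Sum>l\<in>I. t l *\<^sub>R grad (h l) (x $ a))) = f (y $ a + (\<Sum>l\<in>I. t l *\<^sub>R grad (h l) (y $ a)))"
proof -
  obtain b where b: "b \<noteq> a"
  proof -
    have "\<not> (UNIV :: 'k set) \<subseteq> {a}" using card card_mono[of "{a}" "UNIV :: 'k set"] by auto
    then show ?thesis using that by blast
  qed
  let ?Z = "\<lambda>x. x + axis b ((-1) *\<^sub>R x $ b)"
  let ?S = "\<lambda>x. ?Z x + axis b (\<Sum>l\<in>I. t l *\<^sub>R grad (h l) (?Z x $ a))"
  have "same_values B (?Z x) (?Z y)" using preserves_slot_scale xy unfolding preserves_def by blast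
  then have "same_values B (?S x) (?S y)"
    by (intro same_values_shear_sum[OF I(1), where a = "\<lambda>_. a" and \<xi> = "\<lambda>l. grad (h l)"])
       (use I b shear_field_grad in auto)
  then have "same_values B (?S x + axis a (1 *\<^sub>R (?S x $ b))) (?S y + axis a (1 *\<^sub>R (?S y $ b)))"
    by (rule same_values_shear[OF b shear_field_id])
  from slot_value[OF f this, of a] show ?thesis using b by (simp add: axis_def)
qed

lemma grad_inner_grad:
  assumes card: "CARD('k) \<ge> 2" and f: "f \<in> A" "h \<in> A" and xy: "same_values B x y"
  shows "grad f (x $ a) \<bullet> grad h (x $ b) = grad f (y $ a) \<bullet> grad h (y $ b)"
proof (cases "a = b")
  case True
  have "(\<lambda>s. f (x $ a + s *\<^sub>R grad h (x $ a))) = (\<lambda>s. f (y $ a + s *\<^sub>R grad h (y $ a)))"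
    using slot_value_add_gradients[OF card f(1) xy, of "{()}" "\<lambda>_. h" a "\<lambda>_. s" for s] f(2) by auto
  then show ?thesis
    using deriv_along_line[OF A_poly[OF f(1)], of "x $ a" "grad h (x $ a)" 0]
      deriv_along_line[OF A_poly[OF f(1)], of "y $ a" "grad h (y $ a)" 0] DERIV_unique True by simp
next
  case False
  then show ?thesis using grad_inner_shear_field[OF f(1) xy _ shear_field_grad[OF f(2)], of b a] by simp
qed

end

section \<open>Linear algebra of frames\<close>

text \<open>Linear relations are relations between inner products: a linear combination vanishes if and only if its norm
  does. So \<open>u a \<mapsto> w a\<close> extends linearly.\<close>

lemma gram_isometry:
  fixes u w :: "'i \<Rightarrow> 'a::euclidean_space"
  assumes gram: "\<And>a b. a \<in> I \<Longrightarrow> b \<in> I \<Longrightarrow> u a \<bullet> u b = w a \<bullet> w b" and span: "span (u ` I) = UNIV"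
  shows "\<exists>g. orthogonal_transformation g \<and> (\<forall>a\<in>I. g (u a) = w a)"
proof -
  obtain S where S: "S \<subseteq> u ` I" "independent S" "u ` I \<subseteq> span S"
    using maximal_independent_subset by blast
  have spanS: "span S = UNIV" using span_mono[OF S(3)] span by (simp add: span_span top.extremum_unique)
  have "\<forall>s\<in>S. \<exists>a. a \<in> I \<and> u a = s" using S(1) by blast
  then obtain idx where idx: "\<And>s. s \<in> S \<Longrightarrow> idx s \<in> I \<and> u (idx s) = s" by metis
  obtain g where g: "linear g" "\<And>s. s \<in> S \<Longrightarrow> g s = w (idx s)"
    using linear_independent_extend[OF S(2), of "\<lambda>s. w (idx s)"] by blast
  interpret linear g by fact
  have dot: "g x \<bullet> w a = x \<bullet> u a" if "a \<in> I" for x a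
  proof -
    have "x \<in> span S" using spanS by simp
    then show ?thesis
    proof (induction rule: span_induct_alt)
      case base then show ?case by (simp add: zero)
    next
      case (step c s y)
      have "w (idx s) \<bullet> w a = s \<bullet> u a" using gram[of "idx s" a] idx[OF step(1)] that by simp
      then show ?case using step g(2) by (simp add: add scale inner_add_left)
    qed
  qed
  have gx: "g x \<bullet> g y = x \<bullet> y" for x y
  proof -
    have "y \<in> span S" using spanS by simp
    then show ?thesis
    proof (induction rule: span_induct_alt)
      case base then show ?case by (simp add: zero)
    next
      case (step c s y)
      then show ?case using dot[of "idx s" x] idx[OF step(1)] g(2) by (simp add: add scale inner_add_right)
    qed
  qed
  have gu: "g (u a) = w a" if "a \<in> I" for a
  proof -
    have "(g (u a) - w a) \<bullet> (g (u a) - w a) = 0"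
      using dot[OF that, of "u a"] gx[of "u a" "u a"] gram[OF that that]
      by (simp add: inner_diff_left inner_diff_right inner_commute[of "w a" "g (u a)"])
    then show ?thesis by simp
  qed
  show ?thesis using g(1) gu gx by (auto simp: orthogonal_transformation_def)
qed

lemma bounded_linear_representation:
  fixes S :: "'a::euclidean_space set"
  assumes "independent S" "span S = UNIV"
  shows "bounded_linear (\<lambda>v. representation S v s)"
  using assms by (intro linear_conv_bounded_linear[THEN iffD1] linearI)
    (simp_all add: representation_add representation_scale)

lemma linear_combine_representation:
  fixes S :: "'a::euclidean_space set"
  assumes "independent S" "span S = UNIV"
  shows "linear (\<lambda>v. \<Sum>s\<in>S. representation S v s *\<^sub>R \<beta> s)"
  using assms by (intro linearI) (simp_all add: representation_add representation_scale scaleR_add_left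
      sum.distrib scaleR_sum_right)

lemma sum_representation_basis:
  fixes S :: "'a::euclidean_space set"
  assumes "independent S" "span S = UNIV"
  shows "(\<Sum>s\<in>S. representation S v s *\<^sub>R s) = v"
  using sum_representation_eq[OF assms(1), of v S] assms independent_bound by auto

text \<open>Replacing a basis vector \<open>s\<close> by a nearby \<open>\<beta> s\<close> is a linear map within distance \<open>1/2\<close> of the identity,
  and hence invertible with a bound on its inverse.\<close>

lemma frame_perturbation:
  fixes S :: "'a::euclidean_space set"
  assumes S: "independent S" "span S = UNIV"
  shows "\<exists>K>0. \<forall>\<beta> w. (\<forall>s\<in>S. norm (\<beta> s - s) \<le> 1 / K) \<longrightarrow>
     (\<exists>u. w = (\<Sum>s\<in>S. u s *\<^sub>R \<beta> s) \<and> (\<Sum>s\<in>S. \<bar>u s\<bar>) \<le> K * norm w)"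
proof -
  have fin: "finite S" using S(1) independent_bound by blast
  let ?r = "\<lambda>s v. representation S v s"
  have lin: "bounded_linear (?r s)" for s by (rule bounded_linear_representation[OF S])
  have "\<forall>s. \<exists>K>0. \<forall>v. \<bar>?r s v\<bar> \<le> norm v * K"
    using bounded_linear.pos_bounded[OF lin] by auto
  then obtain k where k: "\<And>s. k s > 0" "\<And>s v. \<bar>?r s v\<bar> \<le> norm v * k s" by metis
  define K where "K = 2 * (1 + (\<Sum>s\<in>S. k s))"
  have K: "K > 0" using k by (simp add: K_def add_pos_nonneg sum_nonneg less_imp_le)
  have sum_r: "(\<Sum>s\<in>S. \<bar>?r s v\<bar>) \<le> K / 2 * norm v" for v
  proof -
    have "(\<Sum>s\<in>S. \<bar>?r s v\<bar>) \<le> (\<Sum>s\<in>S. norm v * k s)" by (intro sum_mono k)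
    also have "\<dots> \<le> K / 2 * norm v" by (simp add: K_def sum_distrib_left[symmetric] algebra_simps)
    finally show ?thesis .
  qed
  have "\<exists>u. w = (\<Sum>s\<in>S. u s *\<^sub>R \<beta> s) \<and> (\<Sum>s\<in>S. \<bar>u s\<bar>) \<le> K * norm w"
    if \<beta>: "\<And>s. s \<in> S \<Longrightarrow> norm (\<beta> s - s) \<le> 1 / K" for \<beta> w
  proof -
    define M where "M v = (\<Sum>s\<in>S. ?r s v *\<^sub>R \<beta> s)" for v
    have linM: "linear M" unfolding M_def by (rule linear_combine_representation[OF S])
    have near: "norm (M v - v) \<le> norm v / 2" for v
    proof -
      have "v = (\<Sum>s\<in>S. ?r s v *\<^sub>R s)" using sum_representation_basis[OF S] by simp
      then have "M v - v = (\<Sum>s\<in>S. ?r s v *\<^sub>R (\<beta> s - s))"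
        unfolding M_def by (metis (no_types, lifting) scaleR_diff_right sum.cong sum_subtractf)
      also have "norm \<dots> \<le> (\<Sum>s\<in>S. \<bar>?r s v\<bar> * (1 / K))"
      proof (rule sum_norm_le)
        fix s assume "s \<in> S"
        show "norm (?r s v *\<^sub>R (\<beta> s - s)) \<le> \<bar>?r s v\<bar> * (1 / K)"
          unfolding norm_scaleR using \<beta>[OF \<open>s \<in> S\<close>] by (intro mult_left_mono) auto
      qed
      also have "\<dots> = (\<Sum>s\<in>S. \<bar>?r s v\<bar>) * (1 / K)" by (simp only: sum_distrib_right)
      also have "\<dots> \<le> (K / 2 * norm v) * (1 / K)" using K by (intro mult_right_mono sum_r) auto
      finally show ?thesis using K by simp
    qed
    have half: "norm v \<le> 2 * norm (M v)" for v
      using near[of v] norm_triangle_ineq2[of v "M v"] by (simp add: norm_minus_commute)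
    have "inj M"
    proof (rule linear_injective_0[THEN iffD2, OF linM, rule_format])
      fix v assume "M v = 0"
      then show "v = 0" using half[of v] by simp
    qed
    then have "surj M" by (rule linear_injective_imp_surjective[OF linM]) (rule refl)
    then obtain v where v: "w = M v" by (metis surjD)
    have "(\<Sum>s\<in>S. \<bar>?r s v\<bar>) \<le> K / 2 * norm v" by (rule sum_r)
    also have "\<dots> \<le> K / 2 * (2 * norm w)" using half[of v] K unfolding v by (intro mult_left_mono) auto
    finally show ?thesis unfolding v M_def by (intro exI[of _ "\<lambda>s. ?r s v"]) simp
  qed
  then show ?thesis using K by (intro exI[of _ K] conjI allI impI) blast+
qed

lemma hess_bound:
  fixes f :: "'a::euclidean_space \<Rightarrow> real"
  assumes f: "real_polynomial_function f"
  shows "\<exists>C>0. \<forall>z\<in>cball z0 r. \<forall>d. norm (hess f z d) \<le> C * norm d"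
proof -
  have "\<exists>C>0. \<forall>z\<in>cball z0 r. norm (hess f z b) \<le> C" for b
  proof -
    have "compact ((\<lambda>z. hess f z b) ` cball z0 r)"
      by (intro compact_continuous_image continuous_on_polymonial_function polynomial_hess f) auto
    then have "bounded ((\<lambda>z. hess f z b) ` cball z0 r)" by (rule compact_imp_bounded)
    then show ?thesis unfolding bounded_pos by auto
  qed
  then obtain C where C: "\<And>b. C b > 0" "\<And>b z. z \<in> cball z0 r \<Longrightarrow> norm (hess f z b) \<le> C b" by metis
  have "norm (hess f z d) \<le> (1 + (\<Sum>b\<in>Basis. C b)) * norm d" if z: "z \<in> cball z0 r" for z d
  proof -
    interpret linear "hess f z" using linear_hess[OF f] .
    have "hess f z d = hess f z (\<Sum>b\<in>Basis. (d \<bullet> b) *\<^sub>R b)" by (simp add: euclidean_representation)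
    also have "\<dots> = (\<Sum>b\<in>Basis. (d \<bullet> b) *\<^sub>R hess f z b)" by (simp add: sum scale)
    also have "norm \<dots> \<le> (\<Sum>b\<in>Basis. norm d * C b)"
    proof (rule sum_norm_le)
      fix b :: 'a assume "b \<in> Basis"
      then show "norm ((d \<bullet> b) *\<^sub>R hess f z b) \<le> norm d * C b"
        unfolding norm_scaleR using C(2)[OF z] Basis_le_norm[of b d] by (intro mult_mono) auto
    qed
    also have "\<dots> \<le> (1 + (\<Sum>b\<in>Basis. C b)) * norm d"
      by (simp only: sum_distrib_left[symmetric]) (simp add: algebra_simps)
    finally show ?thesis .
  qed
  moreover have "1 + (\<Sum>b\<in>Basis. C b) > 0" using C(1) by (simp add: add_pos_nonneg sum_nonneg less_imp_le)
  ultimately show ?thesis by blast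
qed

text \<open>At a point where the sum of the norms is maximal, the mean value inequality bounds this maximum by a
  proper fraction of itself.\<close>

lemma gronwall_family:
  fixes e :: "'b \<Rightarrow> real \<Rightarrow> 'a::real_normed_vector"
  assumes S: "finite S"
    and der: "\<And>s t. s \<in> S \<Longrightarrow> t \<in> {0..1} \<Longrightarrow> (e s has_vector_derivative e' s t) (at t)"
    and init: "\<And>s. s \<in> S \<Longrightarrow> e s 0 = 0"
    and le: "\<And>s t. s \<in> S \<Longrightarrow> t \<in> {0..1} \<Longrightarrow> norm (e' s t) \<le> \<theta> * (\<Sum>s\<in>S. norm (e s t))"
    and \<theta>: "\<theta> \<ge> 0" "real (card S) * \<theta> < 1"
    and s: "s \<in> S" and t: "t \<in> {0..1}"
  shows "e s t = 0"
proof -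
  let ?E = "\<lambda>t. \<Sum>s\<in>S. norm (e s t)"
  have "continuous_on {0..1} (e s)" if "s \<in> S" for s
    using der[OF that] has_vector_derivative_continuous continuous_at_imp_continuous_on by blast
  then have "continuous_on {0..1} ?E" by (intro continuous_intros)
  then obtain m where m: "m \<in> {0..1}" "\<And>t. t \<in> {0..1} \<Longrightarrow> ?E t \<le> ?E m"
    using continuous_attains_sup[of "{0..1::real}" ?E] by auto
  have E0: "?E m \<ge> 0" by (simp add: sum_nonneg)
  have "norm (e s m) \<le> \<theta> * ?E m" if s: "s \<in> S" for s
  proof -
    have "norm (e s m - e s 0) \<le> (\<theta> * ?E m) * norm (m - 0)"
    proof (rule differentiable_bound[where S = "{0..1}" and f' = "\<lambda>t h. h *\<^sub>R e' s t"])
      fix t :: real assume t: "t \<in> {0..1}"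
      show "(e s has_derivative (\<lambda>h. h *\<^sub>R e' s t)) (at t within {0..1})"
        using der[OF s t] has_derivative_at_withinI unfolding has_vector_derivative_def by blast
      have "norm (e' s t) \<le> \<theta> * ?E m"
        using le[OF s t] mult_left_mono[OF m(2)[OF t] \<theta>(1)] by linarith
      then show "onorm (\<lambda>h. h *\<^sub>R e' s t) \<le> \<theta> * ?E m"
        by (intro onorm_le) (simp add: mult.commute mult_left_mono)
    qed (use m in auto)
    also have "\<dots> \<le> (\<theta> * ?E m) * 1" using m(1) E0 \<theta>(1) by (intro mult_left_mono) auto
    finally show ?thesis using init[OF s] by simp
  qed
  then have "?E m \<le> (\<Sum>s\<in>S. \<theta> * ?E m)" by (intro sum_mono)
  also have "\<dots> = (real (card S) * \<theta>) * ?E m" by simp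
  finally have "(1 - real (card S) * \<theta>) * ?E m \<le> 0" by (simp add: left_diff_distrib)
  then have "?E m \<le> 0" using \<theta>(2) by (simp add: mult_le_0_iff)
  then have "?E t \<le> 0" using m(2)[OF t] by linarith
  then have "?E t = 0" by (simp add: order_antisym sum_nonneg)
  then show ?thesis using S s by (simp add: sum_nonneg_eq_0_iff)
qed

section \<open>Rigidity at points where the gradients span\<close>

context polarized
begin

definition transport :: "('a \<Rightarrow> 'a) \<Rightarrow> 'a ^ 'k \<Rightarrow> 'a ^ 'k \<Rightarrow> bool" where
  "transport g x y \<longleftrightarrow> orthogonal_transformation g \<and> (\<forall>f\<in>A. \<forall>j. g (grad f (x $ j)) = grad f (y $ j))"

definition gradients :: "'a ^ 'k \<Rightarrow> 'k set \<Rightarrow> 'a set" where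
  "gradients x J = {grad f (x $ j) |f j. f \<in> A \<and> j \<in> J}"

lemma transport_exists:
  assumes card: "CARD('k) \<ge> 2" and good: "span (gradients x UNIV) = UNIV" and xy: "same_values B x y"
  shows "\<exists>g. transport g x y"
proof -
  have "gradients x UNIV = (\<lambda>(f, j). grad f (x $ j)) ` (A \<times> UNIV)"
    by (auto simp: gradients_def)
  then have "span ((\<lambda>(f, j). grad f (x $ j)) ` (A \<times> UNIV)) = UNIV" using good by simp
  then have "\<exists>g. orthogonal_transformation g \<and> (\<forall>a\<in>A \<times> UNIV. g ((\<lambda>(f, j). grad f (x $ j)) a) = (\<lambda>(f, j). grad f (y $ j)) a)"
    by (intro gram_isometry) (auto simp: grad_inner_grad[OF card _ _ xy])
  then show ?thesis unfolding transport_def by auto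
qed

text \<open>Shears into slot \<open>i\<close> leave the other slots alone, so gradients at the other slots can be added one after
  the other.\<close>

lemma same_values_add_span:
  assumes xy: "same_values B x y" and g: "transport g x y" and c: "c \<in> span (gradients x (- {i}))"
  shows "same_values B (x + axis i c) (y + axis i (g c))"
  using c
proof (induction rule: span_induct_alt)
  case base
  have "g 0 = 0" "axis i (0::'a) = 0"
    using g by (simp_all add: transport_def orthogonal_transformation_linear linear_0 vec_eq_iff axis_def)
  then show ?case using xy by (simp only: add_0_right)
next
  case (step t u c)
  then obtain h j where h: "u = grad h (x $ j)" "h \<in> A" "j \<noteq> i" by (auto simp: gradients_def)
  interpret linear g using g by (simp add: transport_def orthogonal_transformation_linear)
  have "same_values B (x + axis i c + axis i (t *\<^sub>R grad h ((x + axis i c) $ j)))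
     (y + axis i (g c) + axis i (t *\<^sub>R grad h ((y + axis i (g c)) $ j)))"
    by (rule same_values_shear[OF h(3) shear_field_grad[OF h(2)] step.IH])
  moreover have "x + axis i c + axis i (t *\<^sub>R grad h ((x + axis i c) $ j)) = x + axis i (t *\<^sub>R u + c)"
    using h by (simp add: vec_eq_iff axis_def)
  moreover have "g (t *\<^sub>R u + c) = t *\<^sub>R grad h (y $ j) + g c"
    using g h by (simp add: add scale transport_def)
  then have "y + axis i (g c) + axis i (t *\<^sub>R grad h ((y + axis i (g c)) $ j)) = y + axis i (g (t *\<^sub>R u + c))"
    using h by (simp add: vec_eq_iff axis_def)
  ultimately show ?case by (simp only:)
qed

text \<open>It suffices to compare inner products with the gradients at all slots. Those with gradients at slots other
  than \<open>i\<close> arise by differentiating invariant inner products along the motion \<open>c\<close> of slot \<open>i\<close>. For a gradient of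
  \<open>h\<close> at slot \<open>i\<close> and a motion \<open>c\<close> given by the gradient of \<open>h'\<close> at another slot, the symmetry of the
  Hessian leaves the inner product of the gradient of \<open>h'\<close> with the shear field \<open>hess f (grad h)\<close> at slot \<open>i\<close>.\<close>

lemma hess_transport:
  assumes card: "CARD('k) \<ge> 2" and xy: "same_values B x y" and g: "transport g x y"
    and good: "span (gradients x UNIV) = UNIV" and f: "f \<in> A" and c: "c \<in> span (gradients x (- {i}))"
  shows "g (hess f (x $ i) c) = hess f (y $ i) (g c)"
proof -
  have orth: "orthogonal_transformation g" and gg: "\<And>h j. h \<in> A \<Longrightarrow> g (grad h (x $ j)) = grad h (y $ j)"
    using g by (auto simp: transport_def)
  interpret linear g using orth by (rule orthogonal_transformation_linear)
  note fp = A_poly[OF f]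
  define d where "d = g (hess f (x $ i) c) - hess f (y $ i) (g c)"
  have gen: "hess f (x $ i) c \<bullet> grad h (x $ l) = hess f (y $ i) (g c) \<bullet> grad h (y $ l)" if h: "h \<in> A" for h l
  proof (cases "l = i")
    case False
    have "(\<lambda>s. grad f (x $ i + s *\<^sub>R c) \<bullet> grad h (x $ l)) = (\<lambda>s. grad f (y $ i + s *\<^sub>R g c) \<bullet> grad h (y $ l))"
    proof
      fix s
      have "same_values B (x + axis i (s *\<^sub>R c)) (y + axis i (g (s *\<^sub>R c)))"
        by (rule same_values_add_span[OF xy g span_scale[OF c]])
      from grad_inner_grad[OF card f h this, of i l] False
      show "grad f (x $ i + s *\<^sub>R c) \<bullet> grad h (x $ l) = grad f (y $ i + s *\<^sub>R g c) \<bullet> grad h (y $ l)"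
        by (simp add: axis_def scale)
    qed
    moreover have "((\<lambda>s. grad f (z + s *\<^sub>R c) \<bullet> u) has_real_derivative hess f z c \<bullet> u) (at 0)" for z c u
    proof -
      have "((\<lambda>s. grad f (z + s *\<^sub>R c)) has_vector_derivative hess f z c) (at 0)"
        using has_derivative_along_line[of "grad f" "hess f z" z 0 c] has_derivative_hess[OF fp] by simp
      then show ?thesis unfolding has_real_derivative_iff_has_vector_derivative has_vector_derivative_def
        by (auto intro!: derivative_eq_intros)
    qed
    ultimately show ?thesis using DERIV_unique by metis
  next
    case True
    interpret hx: linear "hess f (x $ i)" using linear_hess[OF fp] .
    interpret hy: linear "hess f (y $ i)" using linear_hess[OF fp] .
    show ?thesis using c
    proof (induction rule: span_induct_alt)
      case base
      then show ?case by (simp add: zero hx.zero hy.zero)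
    next
      case (step t u c)
      then obtain h' j where h': "u = grad h' (x $ j)" "h' \<in> A" "j \<noteq> i" by (auto simp: gradients_def)
      have "hess f (x $ i) u \<bullet> grad h (x $ i) = grad h' (x $ j) \<bullet> hess f (x $ i) (grad h (x $ i))"
        unfolding h'(1) by (subst hess_sym[OF fp]) (rule inner_commute)
      also have "\<dots> = grad h' (y $ j) \<bullet> hess f (y $ i) (grad h (y $ i))"
        by (rule grad_inner_shear_field[OF h'(2) xy _ shear_field_hess[OF f h]]) (use h'(3) in simp)
      also have "\<dots> = hess f (y $ i) (g u) \<bullet> grad h (y $ i)"
        unfolding h'(1) gg[OF h'(2)] by (subst hess_sym[OF fp]) (rule inner_commute)
      finally show ?case using step True
        by (simp add: add scale hx.add hx.scale hy.add hy.scale inner_add_left)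
    qed
  qed
  have "d \<bullet> g v = 0" for v
  proof -
    have "v \<in> span (gradients x UNIV)" using good by simp
    then show ?thesis
    proof (induction rule: span_induct_alt)
      case base then show ?case by (simp add: zero)
    next
      case (step t u v)
      then obtain h l where h: "u = grad h (x $ l)" "h \<in> A" by (auto simp: gradients_def)
      have "d \<bullet> g u = hess f (x $ i) c \<bullet> u - hess f (y $ i) (g c) \<bullet> g u"
        using orth by (simp add: d_def inner_diff_left orthogonal_transformation_def)
      also have "\<dots> = 0" using gen[OF h(2), of l] gg[OF h(2)] h(1) by simp
      finally show ?case using step by (simp add: add scale inner_add_right)
    qed
  qed
  moreover have "surj g" using orth by (rule orthogonal_transformation_surj)
  ultimately have "d \<bullet> d = 0" by (metis surjD)
  then show ?thesis by (simp add: d_def)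
qed

end

context polarized
begin

lemma span_gradients_basis:
  assumes good: "span (gradients x UNIV) = UNIV"
  obtains S \<phi> \<iota> where "finite S" "independent S" "span S = UNIV"
    "\<And>s. s \<in> S \<Longrightarrow> \<phi> s \<in> A" "\<And>s. s \<in> S \<Longrightarrow> grad (\<phi> s) (x $ \<iota> s) = s"
proof -
  obtain S where S: "S \<subseteq> gradients x UNIV" "independent S" "gradients x UNIV \<subseteq> span S"
    using maximal_independent_subset by blast
  have "span S = UNIV" using span_mono[OF S(3)] good by (simp add: span_span top.extremum_unique)
  moreover have "\<forall>s\<in>S. \<exists>f j. f \<in> A \<and> grad f (x $ j) = s" using S(1) by (force simp: gradients_def)
  then obtain \<phi> \<iota> where "\<And>s. s \<in> S \<Longrightarrow> \<phi> s \<in> A \<and> grad (\<phi> s) (x $ \<iota> s) = s" by metis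
  moreover have "finite S" using S(2) independent_bound by blast
  ultimately show ?thesis using that S(2) by blast
qed

text \<open>The isometry that transports the gradients does not change when slot \<open>i\<close> moves by a short vector
  in the span of the gradients of the other slots. The discrepancy \<open>e\<close> of the gradients of a basis satisfies
  a linear differential inequality, because the isometries at \<open>x\<close> and at the moved point agree on
  the gradients of the other slots and both intertwine the Hessians in the direction of the motion.\<close>

lemma transport_locally_constant:
  assumes card: "CARD('k) \<ge> 2" and xy: "same_values B x y" and g: "transport g x y"
    and good: "span (gradients x UNIV) = UNIV"
  obtains \<epsilon> where "\<epsilon> > 0" "\<And>c f. c \<in> span (gradients x (- {i})) \<Longrightarrow> norm c \<le> \<epsilon> \<Longrightarrow> f \<in> A \<Longrightarrow>
      g (grad f (x $ i + c)) = grad f (y $ i + g c)"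
proof -
  have orth: "orthogonal_transformation g" using g by (simp add: transport_def)
  interpret g: linear g using orth by (rule orthogonal_transformation_linear)
  obtain S \<phi> \<iota> where S: "finite S" "independent S" "span S = UNIV"
    and \<phi>: "\<And>s. s \<in> S \<Longrightarrow> \<phi> s \<in> A" and \<phi>s: "\<And>s. s \<in> S \<Longrightarrow> grad (\<phi> s) (x $ \<iota> s) = s"
    by (rule span_gradients_basis[OF good]) (rule that)
  have \<phi>p: "real_polynomial_function (\<phi> s)" if "s \<in> S" for s using A_poly \<phi> that by blast
  obtain K where K: "K > 0" "\<forall>\<beta> w. (\<forall>s\<in>S. norm (\<beta> s - s) \<le> 1 / K) \<longrightarrow>
     (\<exists>u. w = (\<Sum>s\<in>S. u s *\<^sub>R \<beta> s) \<and> (\<Sum>s\<in>S. \<bar>u s\<bar>) \<le> K * norm w)"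
    using frame_perturbation[OF S(2,3)] by blast
  define \<beta> where "\<beta> c s = grad (\<phi> s) ((x + axis i c) $ \<iota> s)" for c s
  have "\<exists>r>0. \<forall>c. norm c \<le> r \<longrightarrow> norm (\<beta> c s - s) \<le> 1 / K" if s: "s \<in> S" for s
  proof -
    have "continuous_on UNIV (\<lambda>c. \<beta> c s)"
    proof (cases "\<iota> s = i")
      case True
      have "continuous_on UNIV (\<lambda>c. grad (\<phi> s) (x $ i + c))"
        by (rule continuous_on_compose2[OF continuous_grad[OF \<phi>p[OF s], of UNIV]]) (auto intro!: continuous_intros)
      then show ?thesis by (simp add: \<beta>_def True axis_def)
    next
      case False
      then have "(\<lambda>c. \<beta> c s) = (\<lambda>_. grad (\<phi> s) (x $ \<iota> s))" by (simp add: \<beta>_def axis_def)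
      then show ?thesis by (simp only: continuous_on_const)
    qed
    then have "continuous (at 0) (\<lambda>c. \<beta> c s)" by (simp add: continuous_on_eq_continuous_at)
    moreover have "\<beta> 0 s = s" using \<phi>s[OF s] by (simp add: \<beta>_def axis_def)
    ultimately obtain r where r: "r > 0" "\<And>c. dist c 0 < r \<Longrightarrow> dist (\<beta> c s) s < 1 / K"
      unfolding continuous_at_eps_delta using K(1) by (metis divide_pos_pos zero_less_one)
    have "norm (\<beta> c s - s) \<le> 1 / K" if "norm c \<le> r / 2" for c
      using r(2)[of c] r(1) that by (simp add: dist_norm)
    then show ?thesis using r(1) by (intro exI[of _ "r / 2"]) auto
  qed
  then obtain r where r: "\<And>s. s \<in> S \<Longrightarrow> r s > 0"
    "\<And>s c. s \<in> S \<Longrightarrow> norm c \<le> r s \<Longrightarrow> norm (\<beta> c s - s) \<le> 1 / K" by metis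
  have "\<exists>C>0. \<forall>z\<in>cball (x $ i) 1. \<forall>d. norm (hess (\<phi> s) z d) \<le> C * norm d" if "s \<in> S" for s
    by (rule hess_bound[OF \<phi>p[OF that]])
  then obtain C where C: "\<And>s. s \<in> S \<Longrightarrow> C s > 0"
    "\<And>s z d. s \<in> S \<Longrightarrow> z \<in> cball (x $ i) 1 \<Longrightarrow> norm (hess (\<phi> s) z d) \<le> C s * norm d" by metis
  define C1 where "C1 = 1 + (\<Sum>s\<in>S. C s)"
  have C1: "C1 > 0" using C(1) by (simp add: C1_def add_pos_nonneg sum_nonneg less_imp_le)
  have CC1: "C s \<le> C1" if "s \<in> S" for s
    using member_le_sum[of s S C] C(1) S(1) that by (force simp: C1_def less_imp_le)
  define X where "X = (1 + real (card S)) * (K * C1)"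
  have X: "X > 0" using K(1) C1 by (simp add: X_def add_pos_nonneg)
  define \<epsilon> where "\<epsilon> = Min ({1, 1 / (2 * X)} \<union> r ` S)"
  have finM: "finite ({1, 1 / (2 * X)} \<union> r ` S)" using S(1) by simp
  have \<epsilon>_le: "\<epsilon> \<le> z" if "z \<in> {1, 1 / (2 * X)} \<union> r ` S" for z
    unfolding \<epsilon>_def by (rule Min_le[OF finM that])
  have \<epsilon>: "\<epsilon> > 0" "\<epsilon> \<le> 1" "\<And>s. s \<in> S \<Longrightarrow> \<epsilon> \<le> r s" "\<epsilon> \<le> 1 / (2 * X)"
  proof -
    show "\<epsilon> > 0" unfolding \<epsilon>_def by (subst Min_gr_iff[OF finM]) (use r(1) X in auto)
  qed (simp_all add: \<epsilon>_le)
  have small: "real (card S) * (K * (C1 * \<epsilon>)) < 1"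
  proof -
    have "real (card S) * (K * (C1 * \<epsilon>)) \<le> (1 + real (card S)) * (K * (C1 * \<epsilon>))"
      using K(1) C1 \<epsilon>(1) by (intro mult_right_mono) auto
    also have "\<dots> = X * \<epsilon>" by (simp add: X_def)
    also have "\<dots> \<le> X * (1 / (2 * X))" using X \<epsilon>(4) by (intro mult_left_mono) auto
    also have "\<dots> = 1 / 2" using X by simp
    finally show ?thesis by simp
  qed
  \<comment> \<open>Within distance \<open>\<epsilon>\<close> the moved basis \<open>\<beta> c\<close> is a frame with constant \<open>K\<close>, and \<open>small\<close> is the hypothesis
    on the constant in \<open>gronwall_family\<close>.\<close>
  have frame: "\<exists>u. w = (\<Sum>s\<in>S. u s *\<^sub>R \<beta> c s) \<and> (\<Sum>s\<in>S. \<bar>u s\<bar>) \<le> K * norm w" if "norm c \<le> \<epsilon>" for c w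
    using that \<epsilon>(3) r(2) by (intro K(2)[rule_format]) force
  have \<beta>_grad: "\<beta> c s \<in> gradients (x + axis i c) UNIV" if "s \<in> S" for c s
    using \<phi>[OF that] by (auto simp: gradients_def \<beta>_def)
  have good': "span (gradients (x + axis i c) UNIV) = UNIV" if c: "norm c \<le> \<epsilon>" for c
  proof -
    have "w \<in> span (gradients (x + axis i c) UNIV)" for w
    proof -
      obtain u where "w = (\<Sum>s\<in>S. u s *\<^sub>R \<beta> c s)" using frame[OF c] by blast
      then show ?thesis using \<beta>_grad by (simp add: span_sum span_scale span_base)
    qed
    then show ?thesis by blast
  qed
  have other: "gradients (x + axis i c) (- {i}) = gradients x (- {i})" for c
    by (auto simp: gradients_def axis_def)
  have "g (grad f (x $ i + c)) = grad f (y $ i + g c)"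
    if c: "c \<in> span (gradients x (- {i}))" and c\<epsilon>: "norm c \<le> \<epsilon>" and f: "f \<in> A" for c f
  proof -
    have agree: "h b = g b" if h: "transport h (x + axis i c') (y + axis i (g c'))" and b: "b \<in> span (gradients x (- {i}))" for h c' b
    proof -
      interpret h: linear h using h by (simp add: transport_def orthogonal_transformation_linear)
      show ?thesis using b
      proof (induction rule: span_induct_alt)
        case base then show ?case by (simp add: g.zero h.zero)
      next
        case (step t u b)
        then obtain f j where f: "u = grad f (x $ j)" "f \<in> A" "j \<noteq> i" by (auto simp: gradients_def)
        have "h (grad f ((x + axis i c') $ j)) = grad f ((y + axis i (g c')) $ j)" using h f(2) unfolding transport_def by blast
        then have "h u = grad f (y $ j)" using f by (simp add: axis_def)
        moreover have "g u = grad f (y $ j)" using g f by (simp add: transport_def)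
        ultimately show ?case using step by (simp add: g.add g.scale h.add h.scale)
      qed
    qed
    define e where "e s t = g (grad (\<phi> s) (x $ i + t *\<^sub>R c)) - grad (\<phi> s) (y $ i + t *\<^sub>R g c)" for s t
    have e0: "e s t = 0" if s: "s \<in> S" and t: "t \<in> {0..1}" for s t
    proof (rule gronwall_family[where e = e and S = S and \<theta> = "K * (C1 * \<epsilon>)", OF S(1) _ _ _ _ small s t])
      show "K * (C1 * \<epsilon>) \<ge> 0" using K(1) C1 \<epsilon>(1) by simp
      show "e s 0 = 0" if "s \<in> S" for s using g \<phi>[OF that] by (simp add: e_def transport_def)
      let ?e' = "\<lambda>s t. g (hess (\<phi> s) (x $ i + t *\<^sub>R c) c) - hess (\<phi> s) (y $ i + t *\<^sub>R g c) (g c)"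
      show "(e s has_vector_derivative ?e' s t) (at t)" if s: "s \<in> S" for s t
        unfolding e_def[abs_def]
        by (intro has_vector_derivative_diff bounded_linear.has_vector_derivative[OF g.linear_axioms[unfolded linear_conv_bounded_linear]]
            has_derivative_along_line[OF has_derivative_hess[OF \<phi>p[OF s]]])
      show "norm (?e' s t) \<le> K * (C1 * \<epsilon>) * (\<Sum>s\<in>S. norm (e s t))" if s: "s \<in> S" and t: "t \<in> {0..1}" for s t
      proof -
        let ?c = "t *\<^sub>R c"
        have tc: "?c \<in> span (gradients x (- {i}))" using c by (rule span_scale)
        have "norm ?c \<le> 1 * norm c" unfolding norm_scaleR using t by (intro mult_right_mono) auto
        then have tc\<epsilon>: "norm ?c \<le> \<epsilon>" using c\<epsilon> by simp
        have xy': "same_values B (x + axis i ?c) (y + axis i (g ?c))" by (rule same_values_add_span[OF xy g tc])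
        obtain h where h: "transport h (x + axis i ?c) (y + axis i (g ?c))"
          using transport_exists[OF card good'[OF tc\<epsilon>] xy'] by blast
        interpret h: linear h using h by (simp add: transport_def orthogonal_transformation_linear)
        define w where "w = hess (\<phi> s) (x $ i + ?c) c"
        have "h (hess (\<phi> s) ((x + axis i ?c) $ i) c) = hess (\<phi> s) ((y + axis i (g ?c)) $ i) (h c)"
          by (rule hess_transport[OF card xy' h good'[OF tc\<epsilon>] \<phi>[OF s]]) (use c other in simp)
        then have hw: "h w = hess (\<phi> s) (y $ i + t *\<^sub>R g c) (g c)"
          using agree[OF h c] by (simp add: w_def axis_def g.scale)
        obtain u where u: "w = (\<Sum>s\<in>S. u s *\<^sub>R \<beta> ?c s)" "(\<Sum>s\<in>S. \<bar>u s\<bar>) \<le> K * norm w"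
          using frame[OF tc\<epsilon>] by blast
        have \<beta>e: "norm (g (\<beta> ?c s) - h (\<beta> ?c s)) \<le> norm (e s t)" if s: "s \<in> S" for s
        proof -
          have hs: "h (\<beta> ?c s) = grad (\<phi> s) ((y + axis i (g ?c)) $ \<iota> s)"
            using h \<phi>[OF s] unfolding transport_def \<beta>_def by blast
          have gs: "g (grad (\<phi> s) (x $ \<iota> s)) = grad (\<phi> s) (y $ \<iota> s)"
            using g \<phi>[OF s] unfolding transport_def by blast
          show ?thesis
          proof (cases "\<iota> s = i")
            case True
            then show ?thesis unfolding hs by (simp add: \<beta>_def e_def axis_def g.scale)
          next
            case False
            then show ?thesis unfolding hs using gs by (simp add: \<beta>_def axis_def)
          qed
        qed
        \<comment> \<open>The derivative of \<open>e s\<close> is \<open>(g - h) w\<close>, and \<open>g - h\<close> is controlled by its values on the moved basis,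
          which are zero or values of \<open>e\<close>.\<close>
        have gw: "g w = (\<Sum>s\<in>S. u s *\<^sub>R g (\<beta> ?c s))" by (subst u(1)) (simp add: g.sum g.scale)
        have hw': "h w = (\<Sum>s\<in>S. u s *\<^sub>R h (\<beta> ?c s))" by (subst u(1)) (simp add: h.sum h.scale)
        have "?e' s t = (\<Sum>s\<in>S. u s *\<^sub>R (g (\<beta> ?c s) - h (\<beta> ?c s)))"
          unfolding hw[symmetric] w_def[symmetric] gw hw' by (simp only: scaleR_diff_right sum_subtractf)
        also have "norm \<dots> \<le> (\<Sum>s'\<in>S. \<bar>u s'\<bar> * (\<Sum>s\<in>S. norm (e s t)))"
        proof (rule sum_norm_le)
          fix s' assume s': "s' \<in> S"
          have "norm (e s' t) \<le> (\<Sum>s\<in>S. norm (e s t))" using s' S(1) by (intro member_le_sum) auto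
          then show "norm (u s' *\<^sub>R (g (\<beta> ?c s') - h (\<beta> ?c s'))) \<le> \<bar>u s'\<bar> * (\<Sum>s\<in>S. norm (e s t))"
            unfolding norm_scaleR using \<beta>e[OF s'] by (intro mult_left_mono) auto
        qed
        also have "\<dots> = (\<Sum>s\<in>S. \<bar>u s\<bar>) * (\<Sum>s\<in>S. norm (e s t))" by (simp only: sum_distrib_right)
        also have "\<dots> \<le> (K * norm w) * (\<Sum>s\<in>S. norm (e s t))"
          using u(2) by (intro mult_right_mono) (auto simp: sum_nonneg)
        also have "\<dots> \<le> (K * (C1 * \<epsilon>)) * (\<Sum>s\<in>S. norm (e s t))"
        proof -
          have "x $ i + ?c \<in> cball (x $ i) 1" using tc\<epsilon> \<epsilon>(2) by (simp add: dist_norm)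
          then have "norm w \<le> C s * norm c" unfolding w_def by (rule C(2)[OF s])
          also have "\<dots> \<le> C1 * \<epsilon>" using CC1[OF s] c\<epsilon> C(1)[OF s] C1 by (intro mult_mono) auto
          finally show ?thesis using K(1) by (intro mult_right_mono mult_left_mono) (auto simp: sum_nonneg)
        qed
        finally show ?thesis .
      qed
    qed
    have xy1: "same_values B (x + axis i c) (y + axis i (g c))" by (rule same_values_add_span[OF xy g c])
    obtain h where h: "transport h (x + axis i c) (y + axis i (g c))"
      using transport_exists[OF card good'[OF c\<epsilon>] xy1] by blast
    interpret h: linear h using h by (simp add: transport_def orthogonal_transformation_linear)
    have gh\<beta>: "g (\<beta> c s) = h (\<beta> c s)" if s: "s \<in> S" for s
    proof -
      have hs: "h (\<beta> c s) = grad (\<phi> s) ((y + axis i (g c)) $ \<iota> s)"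
        using h \<phi>[OF s] unfolding transport_def \<beta>_def by blast
      have gs: "g (grad (\<phi> s) (x $ \<iota> s)) = grad (\<phi> s) (y $ \<iota> s)"
        using g \<phi>[OF s] unfolding transport_def by blast
      show ?thesis
      proof (cases "\<iota> s = i")
        case True
        then show ?thesis unfolding hs using e0[OF s, of 1] by (simp add: \<beta>_def e_def axis_def)
      next
        case False
        then show ?thesis unfolding hs using gs by (simp add: \<beta>_def axis_def)
      qed
    qed
    have gh: "g w = h w" for w
    proof -
      obtain u where "w = (\<Sum>s\<in>S. u s *\<^sub>R \<beta> c s)" using frame[OF c\<epsilon>] by blast
      then show ?thesis using gh\<beta> by (simp add: g.sum g.scale h.sum h.scale)
    qed
    have "h (grad f ((x + axis i c) $ i)) = grad f ((y + axis i (g c)) $ i)"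
      using h f unfolding transport_def by blast
    then show ?thesis using gh by (simp add: axis_def)
  qed
  then show ?thesis using that \<epsilon>(1) by blast
qed

text \<open>Near \<open>x\<^sub>i\<close>, every point is reached by first moving in the span of the gradients of the other slots
  and then adding gradients at the point reached. Elements of \<open>A\<close> take the same values when this is done at \<open>x\<close>
  and at \<open>y\<close>, so they are invariant under the isometry near \<open>x\<^sub>i\<close>, and hence everywhere.\<close>

lemma rigidity:
  assumes card: "CARD('k) \<ge> 2" and xy: "same_values B x y" and g: "transport g x y"
    and good: "span (gradients x UNIV) = UNIV" and f: "f \<in> A"
  shows "f (x $ i + v) = f (y $ i + g v)"
proof -
  have orth: "orthogonal_transformation g" using g by (simp add: transport_def)
  interpret g: linear g using orth by (rule orthogonal_transformation_linear)
  obtain \<epsilon> where \<epsilon>: "\<epsilon> > 0" "\<And>c f. c \<in> span (gradients x (- {i})) \<Longrightarrow> norm c \<le> \<epsilon> \<Longrightarrow> f \<in> A \<Longrightarrow>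
      g (grad f (x $ i + c)) = grad f (y $ i + g c)"
    by (rule transport_locally_constant[OF card xy g good]) (rule that)
  obtain S \<phi> \<iota> where S: "finite S" "independent S" "span S = UNIV"
    and \<phi>: "\<And>s. s \<in> S \<Longrightarrow> \<phi> s \<in> A" and \<phi>s: "\<And>s. s \<in> S \<Longrightarrow> grad (\<phi> s) (x $ \<iota> s) = s"
    by (rule span_gradients_basis[OF good]) (rule that)
  let ?r = "\<lambda>s v. representation S v s"
  have lin_r: "bounded_linear (?r s)" for s by (rule bounded_linear_representation[OF S(2,3)])
  define I where "I = {s \<in> S. \<iota> s = i}"
  define a where "a z = (\<Sum>s\<in>S - I. ?r s z *\<^sub>R s)" for z
  define \<Theta> where "\<Theta> z = a z + (\<Sum>s\<in>I. ?r s z *\<^sub>R grad (\<phi> s) (x $ i + a z))" for z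
  have I: "finite I" "I \<subseteq> S" "\<phi> ` I \<subseteq> A" using S(1) \<phi> by (auto simp: I_def)
  have a_span: "a z \<in> span (gradients x (- {i}))" for z
    unfolding a_def
  proof (intro span_sum span_scale span_base)
    fix s assume s: "s \<in> S - I"
    then have "\<phi> s \<in> A" "\<iota> s \<in> - {i}" using \<phi> by (auto simp: I_def)
    then have "grad (\<phi> s) (x $ \<iota> s) \<in> gradients x (- {i})"
      unfolding gradients_def mem_Collect_eq by (intro exI[of _ "\<phi> s"] exI[of _ "\<iota> s"] conjI refl)
    moreover have "grad (\<phi> s) (x $ \<iota> s) = s" by (rule \<phi>s) (use s in blast)
    ultimately show "s \<in> gradients x (- {i})" by (simp only:)
  qed
  have lin_a: "bounded_linear a"
    unfolding a_def[abs_def] by (intro bounded_linear_sum bounded_linear_scaleR_left[THEN bounded_linear_compose] lin_r)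
  define P where "P v = f (x $ i + v) - f (y $ i + g v)" for v
  have P\<Theta>: "P (\<Theta> z) = 0" if z: "norm (a z) \<le> \<epsilon>" for z
  proof -
    have "same_values B (x + axis i (a z)) (y + axis i (g (a z)))"
      by (rule same_values_add_span[OF xy g a_span])
    from slot_value_add_gradients[OF card f this I(1,3), of i "\<lambda>s. ?r s z"]
    have eq: "f (x $ i + a z + (\<Sum>s\<in>I. ?r s z *\<^sub>R grad (\<phi> s) (x $ i + a z)))
        = f (y $ i + g (a z) + (\<Sum>s\<in>I. ?r s z *\<^sub>R grad (\<phi> s) (y $ i + g (a z))))"
      unfolding vector_add_component axis_nth .
    have "grad (\<phi> s) (y $ i + g (a z)) = g (grad (\<phi> s) (x $ i + a z))" if "s \<in> I" for s
      by (rule \<epsilon>(2)[OF a_span z, symmetric]) (use that I(3) in blast)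
    then have "(\<Sum>s\<in>I. ?r s z *\<^sub>R grad (\<phi> s) (y $ i + g (a z))) = g (\<Sum>s\<in>I. ?r s z *\<^sub>R grad (\<phi> s) (x $ i + a z))"
      unfolding g.sum g.scale by (intro sum.cong) auto
    then show ?thesis using eq unfolding P_def \<Theta>_def g.add by (simp only: add.assoc diff_self)
  qed
  have \<Theta>0: "\<Theta> 0 = 0" by (simp add: \<Theta>_def a_def representation_zero)
  have contA: "continuous_on UNIV a" using lin_a by (rule linear_continuous_on)
  have \<phi>p: "real_polynomial_function (\<phi> s)" if "s \<in> I" for s using I(3) A_poly that by blast
  have cont_grad: "continuous_on UNIV (\<lambda>z. grad (\<phi> s) (x $ i + a z))" if "s \<in> I" for s
    by (rule continuous_on_compose2[OF continuous_grad[OF \<phi>p[OF that], of UNIV]])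
       (auto intro!: continuous_intros contA)
  have cont: "continuous_on UNIV \<Theta>"
    unfolding \<Theta>_def[abs_def]
    by (intro continuous_on_add contA continuous_on_sum continuous_on_scaleR linear_continuous_on lin_r cont_grad)
  have der: "(\<Theta> has_derivative (\<lambda>h. h)) (at 0)"
  proof -
    have a0: "a 0 = 0" using lin_a by (simp add: linear_simps)
    have d1: "((\<lambda>z. x $ i + a z) has_derivative a) (at 0)"
      using has_derivative_add[OF has_derivative_const[of "x $ i"] bounded_linear_imp_has_derivative[OF lin_a]] by simp
    have d2: "((\<lambda>z. grad (\<phi> s) (x $ i + a z)) has_derivative (\<lambda>h. hess (\<phi> s) (x $ i + a 0) (a h))) (at 0)" if s: "s \<in> I" for s
      by (rule has_derivative_compose[OF d1 has_derivative_hess[OF \<phi>p[OF s]]])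
    define D where "D h = (\<Sum>s\<in>I. ?r s 0 *\<^sub>R hess (\<phi> s) (x $ i + a 0) (a h) + ?r s h *\<^sub>R grad (\<phi> s) (x $ i + a 0))" for h
    from d2 have "(\<Theta> has_derivative (\<lambda>h. a h + D h)) (at 0)"
      unfolding \<Theta>_def[abs_def] D_def
      by (intro has_derivative_add has_derivative_sum has_derivative_scaleR bounded_linear_imp_has_derivative lin_a lin_r)
    moreover have "a h + D h = h" for h
    proof -
      have "D h = (\<Sum>s\<in>I. ?r s h *\<^sub>R s)"
        unfolding D_def using \<phi>s by (intro sum.cong) (auto simp: representation_zero a0 I_def)
      then have "a h + D h = (\<Sum>s\<in>S. ?r s h *\<^sub>R s)"
        using sum.subset_diff[OF I(2) S(1), of "\<lambda>s. ?r s h *\<^sub>R s"] by (simp add: a_def)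
      also have "\<dots> = h" by (rule sum_representation_basis[OF S(2,3)])
      finally show ?thesis .
    qed
    ultimately show ?thesis by simp
  qed
  have "continuous (at 0) a" using contA by (simp add: continuous_on_eq_continuous_at)
  then obtain \<delta> where \<delta>: "\<delta> > 0" "\<And>z. dist z 0 < \<delta> \<Longrightarrow> dist (a z) (a 0) < \<epsilon>"
    unfolding continuous_at_eps_delta using \<epsilon>(1) by metis
  have a0: "a 0 = 0" using lin_a by (simp add: linear_simps)
  \<comment> \<open>The derivative of \<open>\<Theta>\<close> at \<open>0\<close> is the identity, so \<open>\<Theta>\<close> covers a neighbourhood of \<open>0\<close>.\<close>
  have "\<Theta> 0 \<in> interior (\<Theta> ` ball 0 \<delta>)"
    by (rule sussmann_open_mapping[OF open_UNIV cont UNIV_I der bounded_linear_ident]) (use \<delta>(1) in \<open>auto simp: o_def id_def\<close>)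
  then obtain \<rho> where \<rho>: "\<rho> > 0" "ball 0 \<rho> \<subseteq> \<Theta> ` ball 0 \<delta>" unfolding \<Theta>0 mem_interior by blast
  have "P v = 0"
  proof (rule polynomial_zero_near_imp_zero[where f = P, OF _ \<rho>(1)])
    have "polynomial_function g"
      using g.linear_axioms by (intro polynomial_function_bounded_linear) (simp add: linear_conv_bounded_linear)
    from polynomial_function_add[OF polynomial_function_const this]
    have p: "polynomial_function (\<lambda>v. x $ i + v)" "polynomial_function (\<lambda>v. y $ i + g v)"
      using polynomial_function_add[OF polynomial_function_const polynomial_function_id] by auto
    have "real_polynomial_function (f \<circ> (\<lambda>v. x $ i + v))" "real_polynomial_function (f \<circ> (\<lambda>v. y $ i + g v))"
      by (rule real_polynomial_function_compose[OF p(1) A_poly[OF f]]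
          real_polynomial_function_compose[OF p(2) A_poly[OF f]])+
    then show "real_polynomial_function P" unfolding P_def[abs_def] o_def by (rule real_polynomial_function_diff)
    fix v :: 'a assume "norm v < \<rho>"
    then obtain z where "v = \<Theta> z" "z \<in> ball 0 \<delta>" using \<rho>(2) by force
    then show "P v = 0" using P\<Theta>[of z] \<delta>(2)[of z] by (simp add: a0)
  qed
  then show ?thesis by (simp add: P_def)
qed

end

section \<open>Normal spaces at generic points\<close>

lemma C_times_on_cong:
  assumes "open I" "\<And>s. s \<in> I \<Longrightarrow> f s = g s" "C_times_on n I f"
  shows "C_times_on n I g"
  using assms(2,3)
proof (induction n arbitrary: f g)
  case 0
  then show ?case using continuous_on_cong[of I I f g] by simp
next
  case (Suc n)
  have iff: "(f has_derivative D) (at s) \<longleftrightarrow> (g has_derivative D) (at s)" if "s \<in> I" for s D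
  proof -
    show "(f has_derivative D) (at s) \<longleftrightarrow> (g has_derivative D) (at s)"
      using has_derivative_transform_within_open[OF _ assms(1) that, of f D UNIV g]
        has_derivative_transform_within_open[OF _ assms(1) that, of g D UNIV f] Suc.prems(1) by auto
  qed
  have der: "frechet_derivative f (at s) = frechet_derivative g (at s)" if "s \<in> I" for s
    by (simp add: frechet_derivative_def iff[OF that])
  have "f differentiable_on I" using Suc.prems(2) by simp
  then have "g differentiable_on I"
    using assms(1) iff by (simp add: differentiable_on_eq_differentiable_at differentiable_def)
  moreover have "C_times_on n I (\<lambda>x. frechet_derivative g (at x) v)" for v
    by (rule Suc.IH[of "\<lambda>x. frechet_derivative f (at x) v"]) (use der Suc.prems(2) in auto)
  ultimately show ?case by simp
qed

lemma C_times_on_along_line: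
  fixes \<psi> :: "'a::euclidean_space \<Rightarrow> 'b::euclidean_space" and I :: "real set"
  assumes "open W" "open I" and I: "\<And>s. s \<in> I \<Longrightarrow> p + s *\<^sub>R w \<in> W" and "C_times_on n W \<psi>"
  shows "C_times_on n I (\<lambda>s. \<psi> (p + s *\<^sub>R w))"
  using assms(4)
proof (induction n arbitrary: \<psi>)
  case 0
  then have "continuous_on W \<psi>" by simp
  then have "continuous_on I (\<lambda>s. \<psi> (p + s *\<^sub>R w))"
    by (rule continuous_on_compose2) (use I in \<open>auto intro!: continuous_intros\<close>)
  then show ?case by simp
next
  case (Suc n)
  have \<psi>: "(\<psi> has_derivative frechet_derivative \<psi> (at z)) (at z)" if "z \<in> W" for z
    using Suc.prems that assms(1) by (simp add: differentiable_on_eq_differentiable_at frechet_derivative_works)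
  have der: "((\<lambda>s. \<psi> (p + s *\<^sub>R w)) has_derivative (\<lambda>v. frechet_derivative \<psi> (at (p + s *\<^sub>R w)) (v *\<^sub>R w))) (at s)"
    if "s \<in> I" for s
  proof -
    have "((\<lambda>s. \<psi> (p + s *\<^sub>R w)) has_vector_derivative frechet_derivative \<psi> (at (p + s *\<^sub>R w)) w) (at s)"
      by (rule has_derivative_along_line) (rule \<psi>[OF I[OF that]])
    then show ?thesis
      using linear_scale[OF has_derivative_linear[OF \<psi>[OF I[OF that]]]] by (simp add: has_vector_derivative_def)
  qed
  then have "(\<lambda>s. \<psi> (p + s *\<^sub>R w)) differentiable_on I"
    using assms(2) by (auto simp: differentiable_on_eq_differentiable_at differentiable_def)
  moreover have "C_times_on n I (\<lambda>s. frechet_derivative (\<lambda>s. \<psi> (p + s *\<^sub>R w)) (at s) v)" for v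
  proof (rule C_times_on_cong[OF assms(2)])
    show "C_times_on n I (\<lambda>s. frechet_derivative \<psi> (at (p + s *\<^sub>R w)) (v *\<^sub>R w))"
      using Suc.prems by (intro Suc.IH) simp
    fix s assume "s \<in> I"
    then show "frechet_derivative \<psi> (at (p + s *\<^sub>R w)) (v *\<^sub>R w) = frechet_derivative (\<lambda>s. \<psi> (p + s *\<^sub>R w)) (at s) v"
      using frechet_derivative_at[OF der] by metis
  qed
  ultimately show ?case by simp
qed

lemma vector_derivative_in_subspace:
  fixes \<eta> :: "real \<Rightarrow> 'a::euclidean_space"
  assumes T: "subspace T" and \<eta>: "(\<eta> has_vector_derivative w) (at 0)"
    and \<epsilon>: "\<epsilon> > 0" "\<And>s. \<bar>s\<bar> < \<epsilon> \<Longrightarrow> \<eta> s \<in> T"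
  shows "w \<in> T"
proof -
  obtain a b where ab: "a \<in> span T" "\<And>t. t \<in> span T \<Longrightarrow> orthogonal b t" "w = a + b"
    using orthogonal_subspace_decomp_exists[of T w] by blast
  have bT: "b \<bullet> t = 0" if "t \<in> T" for t using ab(2)[of t] that by (simp add: span_base orthogonal_def)
  have "((\<lambda>s. b \<bullet> \<eta> s) has_real_derivative b \<bullet> w) (at 0)"
    using \<eta> unfolding has_real_derivative_iff_has_vector_derivative has_vector_derivative_def
    by (auto intro!: derivative_eq_intros)
  moreover have "((\<lambda>s. b \<bullet> \<eta> s) has_real_derivative 0) (at 0)"
    by (rule has_field_derivative_transform_within_open[OF DERIV_const[of 0] open_ball[of 0 \<epsilon>]])
       (use \<epsilon> bT in \<open>auto simp: dist_real_def\<close>)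
  ultimately have "b \<bullet> w = 0" by (rule DERIV_unique)
  moreover have "b \<bullet> a = 0" using ab(1,2) by (simp add: orthogonal_def)
  ultimately have "b = 0" unfolding ab(3) by (simp add: inner_add_right)
  then show ?thesis using ab(1,3) T by (simp add: span_eq_iff[THEN iffD2])
qed

text \<open>By means of a slice chart, velocities of differentiable curves in a submanifold are velocities of
  smooth curves.\<close>

lemma tangent_space_of_curve:
  assumes L: "embedded_submanifold d L" and \<epsilon>: "\<epsilon> > 0" "\<And>s. \<bar>s\<bar> < \<epsilon> \<Longrightarrow> \<gamma> s \<in> L"
    and \<gamma>: "(\<gamma> has_vector_derivative v) (at 0)"
  shows "v \<in> tangent_space L (\<gamma> 0)"
proof -
  let ?x = "\<gamma> 0"
  have "?x \<in> L" using \<epsilon> by simp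
  from bspec[OF L[unfolded embedded_submanifold_def] this]
  obtain U W and \<phi> \<psi> :: "'a \<Rightarrow> 'a" and T where UW: "open U" "open W" "?x \<in> U" and hom: "homeomorphism U W \<phi> \<psi>"
    and sm: "smooth_on U \<phi>" "smooth_on W \<psi>" and T: "subspace T" and LT: "\<phi> ` (L \<inter> U) = T \<inter> W"
    by (elim exE conjE) (rule that)
  have \<phi>\<psi>: "\<And>y. y \<in> U \<Longrightarrow> \<psi> (\<phi> y) = y" "\<And>y. y \<in> U \<Longrightarrow> \<phi> y \<in> W"
    using hom by (auto simp: homeomorphism_def)
  have "C_times_on (Suc 0) U \<phi>" "C_times_on (Suc 0) W \<psi>" using sm unfolding smooth_on_def by blast+
  then have "\<phi> differentiable_on U" "\<psi> differentiable_on W" by simp_all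
  then have d: "\<phi> differentiable (at ?x)" "\<psi> differentiable (at (\<phi> ?x))"
    using UW \<phi>\<psi>(2) by (simp_all add: differentiable_on_eq_differentiable_at)
  then obtain D E where D: "(\<phi> has_derivative D) (at ?x)" and E: "(\<psi> has_derivative E) (at (\<phi> ?x))"
    unfolding differentiable_def by blast
  have "((\<lambda>y. \<psi> (\<phi> y)) has_derivative (\<lambda>h. E (D h))) (at ?x)" by (rule has_derivative_compose[OF D E])
  moreover have "((\<lambda>y. \<psi> (\<phi> y)) has_derivative (\<lambda>h. h)) (at ?x)"
    by (rule has_derivative_transform_within_open[OF has_derivative_ident UW(1,3)]) (use \<phi>\<psi> in simp)
  ultimately have "(\<lambda>h. E (D h)) = (\<lambda>h. h)" by (rule has_derivative_unique)
  then have ED: "E (D v) = v" by (rule fun_cong)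
  have "continuous (at 0) \<gamma>" using \<gamma> by (rule has_vector_derivative_continuous)
  then have "\<forall>\<^sub>F s in at 0. \<gamma> s \<in> U"
    using UW(1,3) unfolding continuous_at by (rule topological_tendstoD)
  then obtain \<delta> where \<delta>: "\<delta> > 0" "\<And>s. s \<noteq> 0 \<Longrightarrow> dist s 0 < \<delta> \<Longrightarrow> \<gamma> s \<in> U"
    unfolding eventually_at by auto
  have \<gamma>U: "\<gamma> s \<in> U" if "\<bar>s\<bar> < \<delta>" for s
    using \<delta>(2)[of s] UW(3) that by (cases "s = 0") (auto simp: dist_real_def)
  have "D v \<in> T"
  proof (rule vector_derivative_in_subspace[OF T])
    have "((\<lambda>s. \<phi> (\<gamma> s)) has_derivative (\<lambda>h. D (h *\<^sub>R v))) (at 0)"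
      by (rule has_derivative_compose[of \<gamma> "\<lambda>h. h *\<^sub>R v" 0 UNIV \<phi> D])
         (use \<gamma> D in \<open>simp_all add: has_vector_derivative_def\<close>)
    then show "((\<lambda>s. \<phi> (\<gamma> s)) has_vector_derivative D v) (at 0)"
      using linear_scale[OF has_derivative_linear[OF D]] by (simp add: has_vector_derivative_def)
    show "min \<epsilon> \<delta> > 0" using \<epsilon>(1) \<delta>(1) by simp
    show "\<phi> (\<gamma> s) \<in> T" if "\<bar>s\<bar> < min \<epsilon> \<delta>" for s
      using \<epsilon>(2)[of s] \<gamma>U[of s] LT that by auto
  qed
  have "\<phi> ?x \<in> T \<inter> W" using LT \<open>?x \<in> L\<close> UW(3) by blast
  have "open ((\<lambda>s. \<phi> ?x + s *\<^sub>R D v) -` W)"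
    using UW(2) by (intro open_vimage) (auto intro!: continuous_intros)
  moreover have "0 \<in> (\<lambda>s. \<phi> ?x + s *\<^sub>R D v) -` W" using \<open>\<phi> ?x \<in> T \<inter> W\<close> by simp
  ultimately obtain \<rho> where \<rho>: "\<rho> > 0" "ball 0 \<rho> \<subseteq> (\<lambda>s. \<phi> ?x + s *\<^sub>R D v) -` W"
    using open_contains_ball by blast
  have inW: "\<phi> ?x + s *\<^sub>R D v \<in> W" if "s \<in> {-\<rho><..<\<rho>}" for s
    using \<rho>(2) that by (auto simp: dist_real_def subset_iff abs_less_iff)
  let ?c = "\<lambda>s. \<psi> (\<phi> ?x + s *\<^sub>R D v)"
  have "smooth_on {-\<rho><..<\<rho>} ?c"
    unfolding smooth_on_def
  proof
    fix n
    show "C_times_on n {-\<rho><..<\<rho>} ?c"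
      by (rule C_times_on_along_line[OF UW(2) open_greaterThanLessThan inW])
         (use sm(2) in \<open>auto simp: smooth_on_def\<close>)
  qed
  moreover have "?c ` {-\<rho><..<\<rho>} \<subseteq> L"
  proof
    fix z assume "z \<in> ?c ` {-\<rho><..<\<rho>}"
    then obtain s where s: "s \<in> {-\<rho><..<\<rho>}" "z = ?c s" by blast
    have "\<phi> ?x + s *\<^sub>R D v \<in> T \<inter> W"
      using inW[OF s(1)] \<open>\<phi> ?x \<in> T \<inter> W\<close> \<open>D v \<in> T\<close> T by (simp add: subspace_add subspace_scale)
    then obtain y where "y \<in> L \<inter> U" "\<phi> ?x + s *\<^sub>R D v = \<phi> y" using LT by blast
    then show "z \<in> L" using s(2) \<phi>\<psi>(1) by simp
  qed
  moreover have "?c 0 = ?x" using \<phi>\<psi>(1)[OF UW(3)] by simp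
  moreover have "(?c has_vector_derivative v) (at 0)"
    using has_derivative_along_line[of \<psi> E "\<phi> ?x" 0 "D v"] E ED by simp
  ultimately show ?thesis unfolding tangent_space_def using \<rho>(1) by blast
qed

text \<open>Let \<open>N\<close> be an orthonormal basis of the gradients at \<open>x\<close>. As the rank is maximal at \<open>x\<close>, the level sets of the
  corresponding functions are near \<open>x\<close> level sets of all of \<open>A\<close>. The map \<open>\<Phi>\<close> below has derivative
  \<open>id\<close> at \<open>x\<close> and turns these level sets into affine subspaces.\<close>

lemma normal_space_le_gradients:
  fixes A :: "('a::euclidean_space \<Rightarrow> real) set"
  assumes poly: "\<And>f. f \<in> A \<Longrightarrow> real_polynomial_function f"
    and sub: "\<And>z. subspace ((\<lambda>f. grad f z) ` A)"
    and L: "embedded_submanifold d L" and x: "x \<in> L" and level: "\<And>y. (\<And>f. f \<in> A \<Longrightarrow> f y = f x) \<Longrightarrow> y \<in> L"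
    and nbhd: "open X" "x \<in> X" "\<And>y. y \<in> X \<Longrightarrow> dim ((\<lambda>f. grad f y) ` A) \<le> dim ((\<lambda>f. grad f x) ` A)"
  shows "normal_space L x \<subseteq> (\<lambda>f. grad f x) ` A"
proof -
  let ?G = "\<lambda>z. (\<lambda>f. grad f z) ` A"
  obtain N where N: "N \<subseteq> ?G x" "pairwise orthogonal N" "\<And>n. n \<in> N \<Longrightarrow> norm n = 1"
    "independent N" "card N = dim (?G x)" "span N = ?G x"
    by (rule orthonormal_basis_subspace[OF sub[of x]]) (rule that)
  have finN: "finite N" using N(4) independent_bound by blast
  have orth: "n \<bullet> m = (if n = m then 1 else 0)" if "n \<in> N" "m \<in> N" for n m
    using N(2) N(3)[OF that(1)] that unfolding pairwise_def orthogonal_def by (auto simp: norm_eq_1)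
  have "\<forall>n\<in>N. \<exists>f\<in>A. grad f x = n" using N(1) by blast
  then obtain \<phi> where \<phi>: "\<And>n. n \<in> N \<Longrightarrow> \<phi> n \<in> A" "\<And>n. n \<in> N \<Longrightarrow> grad (\<phi> n) x = n" by metis
  have \<phi>p: "real_polynomial_function (\<phi> n)" if "n \<in> N" for n using poly \<phi>(1) that by blast
  obtain S where S0: "N \<subseteq> S" "S \<subseteq> UNIV" "independent S" "UNIV \<subseteq> span S"
    by (rule maximal_independent_subset_extend[OF subset_UNIV N(4)]) (rule that)
  then have S: "N \<subseteq> S" "independent S" "span S = UNIV" by auto
  have finS: "finite S" using S(2) independent_bound by blast
  obtain K where K: "K > 0" "\<forall>\<beta> w. (\<forall>s\<in>S. norm (\<beta> s - s) \<le> 1 / K) \<longrightarrow>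
     (\<exists>u. w = (\<Sum>s\<in>S. u s *\<^sub>R \<beta> s) \<and> (\<Sum>s\<in>S. \<bar>u s\<bar>) \<le> K * norm w)"
    using frame_perturbation[OF S(2,3)] by blast
  define O1 where "O1 = {y \<in> X. \<forall>n\<in>N. norm (grad (\<phi> n) y - n) < 1 / K}"
  have "open O1"
  proof -
    have "open {y. norm (grad (\<phi> n) y - n) < 1 / K}" if "n \<in> N" for n
      by (rule open_Collect_less)
         (rule continuous_on_norm continuous_on_diff continuous_grad[OF \<phi>p[OF that]] continuous_on_const)+
    then have "open (X \<inter> (\<Inter>n\<in>N. {y. norm (grad (\<phi> n) y - n) < 1 / K}))"
      using nbhd(1) finN by (intro open_Int open_INT) auto
    moreover have "O1 = X \<inter> (\<Inter>n\<in>N. {y. norm (grad (\<phi> n) y - n) < 1 / K})" by (auto simp: O1_def)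
    ultimately show ?thesis by simp
  qed
  have xO1: "x \<in> O1" using nbhd(2) \<phi>(2) K(1) by (simp add: O1_def)
  have span_near: "?G y \<subseteq> span ((\<lambda>n. grad (\<phi> n) y) ` N)" if y: "y \<in> O1" for y
  proof -
    define \<beta> where "\<beta> s = (if s \<in> N then grad (\<phi> s) y else s)" for s
    have "\<forall>s\<in>S. norm (\<beta> s - s) \<le> 1 / K" using y K(1) by (auto simp: O1_def \<beta>_def less_imp_le)
    then have ex: "\<exists>u. w = (\<Sum>s\<in>S. u s *\<^sub>R \<beta> s)" for w using K(2) by blast
    have "w \<in> span (\<beta> ` S)" for w
    proof -
      obtain u where "w = (\<Sum>s\<in>S. u s *\<^sub>R \<beta> s)" using ex by blast
      then show ?thesis by (simp add: span_sum span_scale span_base)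
    qed
    then have full: "UNIV \<subseteq> span (\<beta> ` S)" by blast
    have cS: "card S = DIM('a)" using dim_eq_card_independent[OF S(2)] dim_span[of S] S(3) by simp
    have "DIM('a) \<le> card (\<beta> ` S)" using dim_le_card[OF full] finS by simp
    then have card: "card (\<beta> ` S) = card S" using card_image_le[OF finS, of \<beta>] cS by simp
    then have inj: "inj_on \<beta> S" using finS by (simp add: eq_card_imp_inj_on)
    have "independent (\<beta> ` S)"
      by (rule card_le_dim_spanning[OF subset_UNIV full]) (use finS card cS in auto)
    then have ind: "independent (\<beta> ` N)" by (rule independent_mono) (use S(1) in auto)
    have "card (\<beta> ` N) = card N" using inj S(1) by (intro card_image) (auto intro: inj_on_subset)
    moreover have "\<beta> ` N \<subseteq> ?G y" using \<phi>(1) by (auto simp: \<beta>_def)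
    ultimately have "?G y \<subseteq> span (\<beta> ` N)"
      using nbhd(3)[of y] y N(5) ind by (intro card_ge_dim_independent) (auto simp: O1_def)
    moreover have "\<beta> ` N = (\<lambda>n. grad (\<phi> n) y) ` N" by (auto simp: \<beta>_def)
    ultimately show ?thesis by simp
  qed
  define \<Phi> where "\<Phi> y = y + (\<Sum>n\<in>N. (\<phi> n y - n \<bullet> y) *\<^sub>R n)" for y
  define \<Phi>' where "\<Phi>' y = id_blinfun + (\<Sum>n\<in>N. blinfun_scaleR_left n o\<^sub>L blinfun_inner_right (grad (\<phi> n) y - n))" for y
  have \<Phi>'_apply: "blinfun_apply (\<Phi>' y) h = h + (\<Sum>n\<in>N. ((grad (\<phi> n) y - n) \<bullet> h) *\<^sub>R n)" for y h
    by (simp add: \<Phi>'_def blinfun.add_left blinfun.sum_left)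
  have der\<Phi>: "(\<Phi> has_derivative blinfun_apply (\<Phi>' y)) (at y)" for y
  proof -
    have "(\<Phi> has_derivative (\<lambda>h. h + (\<Sum>n\<in>N. (grad (\<phi> n) y \<bullet> h - n \<bullet> h) *\<^sub>R n))) (at y)"
      unfolding \<Phi>_def[abs_def]
      by (intro has_derivative_add has_derivative_ident has_derivative_sum has_derivative_scaleR_left
          has_derivative_diff has_derivative_grad \<phi>p has_derivative_inner_right)
    then show ?thesis by (simp add: \<Phi>'_apply[abs_def] inner_diff_left)
  qed
  have cont\<Phi>': "continuous_on UNIV \<Phi>'"
  proof -
    have "continuous_on UNIV (\<lambda>y. blinfun_scaleR_left n o\<^sub>L blinfun_inner_right (grad (\<phi> n) y - n))" if n: "n \<in> N" for n
      by (intro bounded_bilinear.continuous_on[OF bounded_bilinear_blinfun_compose continuous_on_const]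
          bounded_linear.continuous_on[OF bounded_linear_blinfun_inner_right] continuous_on_diff continuous_on_const
          continuous_grad[OF \<phi>p[OF n]])
    then show ?thesis unfolding \<Phi>'_def[abs_def] by (intro continuous_on_add continuous_on_const continuous_on_sum)
  qed
  have id: "\<Phi>' x = id_blinfun"
    by (rule blinfun_eqI) (simp add: \<Phi>'_apply \<phi>(2))
  have inv1: "id_blinfun o\<^sub>L \<Phi>' x = id_blinfun"
    by (rule blinfun_eqI) (simp add: id)
  obtain U V g g' where UV: "open U" "x \<in> U" "open V" "\<Phi> x \<in> V" "homeomorphism U V \<Phi> g"
      "\<And>y. y \<in> V \<Longrightarrow> (g has_derivative (g' y)) (at y)" "\<And>y. y \<in> V \<Longrightarrow> g' y = inv_into UNIV (blinfun_apply (\<Phi>' (g y)))"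
    by (rule inverse_function_theorem[OF open_UNIV der\<Phi> cont\<Phi>' UNIV_I inv1]) (rule that)
  have gx: "g (\<Phi> x) = x" using UV(2,5) by (simp add: homeomorphism_def)
  have g'x: "g' (\<Phi> x) v = v" for v
  proof -
    have "blinfun_apply (\<Phi>' (g (\<Phi> x))) = id" by (auto simp: gx id)
    then show ?thesis using UV(7)[OF UV(4)] by simp
  qed
  have \<phi>_\<Phi>: "\<phi> n y = n \<bullet> \<Phi> y" if n: "n \<in> N" for n y
  proof -
    have "n \<bullet> \<Phi> y = n \<bullet> y + (\<Sum>m\<in>N. if n = m then \<phi> m y - m \<bullet> y else 0)"
      unfolding \<Phi>_def inner_add_right inner_sum_right inner_scaleR_right
      using orth[OF n] by (intro arg_cong2[where f = "(+)"] sum.cong) auto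
    then show ?thesis using n finN by simp
  qed
  have tangent: "v \<in> tangent_space L x" if v: "\<And>n. n \<in> N \<Longrightarrow> n \<bullet> v = 0" for v
  proof -
    define \<gamma> where "\<gamma> s = g (\<Phi> x + s *\<^sub>R v)" for s
    have "continuous_on V g" using UV(5) by (simp add: homeomorphism_def)
    then have "open (V \<inter> g -` O1)" using continuous_open_preimage[OF _ UV(3) \<open>open O1\<close>] by blast
    then have "open ((\<lambda>s. \<Phi> x + s *\<^sub>R v) -` (V \<inter> g -` O1))"
      by (intro open_vimage) (auto intro!: continuous_intros)
    moreover have "0 \<in> (\<lambda>s. \<Phi> x + s *\<^sub>R v) -` (V \<inter> g -` O1)" using UV(4) xO1 gx by simp
    ultimately obtain \<epsilon> where \<epsilon>: "\<epsilon> > 0" "ball 0 \<epsilon> \<subseteq> (\<lambda>s. \<Phi> x + s *\<^sub>R v) -` (V \<inter> g -` O1)"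
      using open_contains_ball by blast
    have inV: "\<Phi> x + s *\<^sub>R v \<in> V" "\<gamma> s \<in> O1" if "s \<in> ball 0 \<epsilon>" for s using \<epsilon>(2) that by (auto simp: \<gamma>_def)
    define \<gamma>' where "\<gamma>' s = g' (\<Phi> x + s *\<^sub>R v) v" for s
    have der\<gamma>: "(\<gamma> has_vector_derivative \<gamma>' s) (at s)" if "s \<in> ball 0 \<epsilon>" for s
      unfolding \<gamma>_def[abs_def] \<gamma>'_def by (rule has_derivative_along_line[OF UV(6)[OF inV(1)[OF that]]])
    have der_f: "((\<lambda>s. f (\<gamma> s)) has_real_derivative grad f (\<gamma> s) \<bullet> \<gamma>' s) (at s)"
      if "s \<in> ball 0 \<epsilon>" "real_polynomial_function f" for f s
    proof -
      have "((\<lambda>s. f (\<gamma> s)) has_derivative (\<lambda>h. grad f (\<gamma> s) \<bullet> (h *\<^sub>R \<gamma>' s))) (at s)"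
        by (rule has_derivative_compose[OF der\<gamma>[OF that(1), unfolded has_vector_derivative_def] has_derivative_grad[OF that(2)]])
      then show ?thesis by (simp add: has_field_derivative_def mult.commute[of _ "grad f (\<gamma> s) \<bullet> \<gamma>' s"])
    qed
    have const_\<phi>: "\<phi> n (\<gamma> s) = n \<bullet> \<Phi> x" if n: "n \<in> N" and s: "s \<in> ball 0 \<epsilon>" for n s
    proof -
      have "\<Phi> (\<gamma> s) = \<Phi> x + s *\<^sub>R v" using inV(1)[OF s] UV(5) by (simp add: \<gamma>_def homeomorphism_def)
      then show ?thesis using \<phi>_\<Phi>[OF n, of "\<gamma> s"] v[OF n] by (simp add: inner_add_right)
    qed
    \<comment> \<open>By maximality of the rank, velocities orthogonal to the gradients of the \<open>\<phi> n\<close> are orthogonal to all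
      gradients, so all of \<open>A\<close> is constant along \<open>\<gamma>\<close>.\<close>
    have perp: "grad f (\<gamma> s) \<bullet> \<gamma>' s = 0" if f: "f \<in> A" and s: "s \<in> ball 0 \<epsilon>" for f s
    proof -
      have "grad (\<phi> n) (\<gamma> s) \<bullet> \<gamma>' s = 0" if n: "n \<in> N" for n
      proof -
        have "((\<lambda>s. \<phi> n (\<gamma> s)) has_real_derivative 0) (at s)"
          by (rule has_field_derivative_transform_within_open[OF DERIV_const[of "n \<bullet> \<Phi> x"] open_ball s])
             (use const_\<phi>[OF n] in simp)
        then show ?thesis using der_f[OF s \<phi>p[OF n]] DERIV_unique by blast
      qed
      moreover have "grad f (\<gamma> s) \<in> span ((\<lambda>n. grad (\<phi> n) (\<gamma> s)) ` N)" using span_near[OF inV(2)[OF s]] f by blast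
      ultimately show ?thesis
      proof -
        assume z: "\<And>n. n \<in> N \<Longrightarrow> grad (\<phi> n) (\<gamma> s) \<bullet> \<gamma>' s = 0"
        assume "grad f (\<gamma> s) \<in> span ((\<lambda>n. grad (\<phi> n) (\<gamma> s)) ` N)"
        then show ?thesis
          by (induction rule: span_induct_alt) (use z in \<open>auto simp: inner_add_left\<close>)
      qed
    qed
    have "\<gamma> s \<in> L" if s: "s \<in> ball 0 \<epsilon>" for s
    proof (rule level)
      fix f assume f: "f \<in> A"
      have "\<exists>c. \<forall>s\<in>ball 0 \<epsilon>. f (\<gamma> s) = c"
      proof (rule has_field_derivative_zero_constant)
        fix s :: real assume s: "s \<in> ball 0 \<epsilon>"
        show "((\<lambda>s. f (\<gamma> s)) has_real_derivative 0) (at s within ball 0 \<epsilon>)"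
          using der_f[OF s poly[OF f]] perp[OF f s] by (simp add: has_field_derivative_at_within)
      qed simp
      then obtain c where "\<forall>s\<in>ball 0 \<epsilon>. f (\<gamma> s) = c" by blast
      moreover have "0 \<in> ball (0::real) \<epsilon>" using \<epsilon>(1) by simp
      ultimately have "f (\<gamma> s) = f (\<gamma> 0)" using s by simp
      then show "f (\<gamma> s) = f x" by (simp add: \<gamma>_def gx)
    qed
    then have "v \<in> tangent_space L (\<gamma> 0)"
      using der\<gamma>[of 0] \<epsilon>(1) by (intro tangent_space_of_curve[OF L \<epsilon>(1)]) (auto simp: \<gamma>'_def g'x)
    then show ?thesis by (simp add: \<gamma>_def gx)
  qed
  show ?thesis
  proof
    fix w assume w: "w \<in> normal_space L x"
    define v where "v = w - (\<Sum>n\<in>N. (n \<bullet> w) *\<^sub>R n)"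
    have nv: "m \<bullet> v = 0" if m: "m \<in> N" for m
    proof -
      have "m \<bullet> (\<Sum>n\<in>N. (n \<bullet> w) *\<^sub>R n) = (\<Sum>n\<in>N. if m = n then n \<bullet> w else 0)"
        unfolding inner_sum_right inner_scaleR_right using orth[OF m] by (intro sum.cong) auto
      then show ?thesis using m finN by (simp add: v_def inner_diff_right)
    qed
    have "v \<bullet> w = 0"
      using w tangent[OF nv] unfolding normal_space_def orthogonal_comp_def orthogonal_def by blast
    moreover have "(\<Sum>n\<in>N. (n \<bullet> w) *\<^sub>R n) \<bullet> v = 0" using nv by (simp add: inner_sum_left)
    ultimately have "v \<bullet> v = 0" unfolding v_def by (simp add: inner_diff_left inner_diff_right inner_commute)
    then have "w = (\<Sum>n\<in>N. (n \<bullet> w) *\<^sub>R n)" by (simp add: v_def)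
    moreover have "(\<Sum>n\<in>N. (n \<bullet> w) *\<^sub>R n) \<in> span N" by (intro span_sum span_scale span_base)
    ultimately have "w \<in> span N" by (simp only:)
    then show "w \<in> ?G x" using N(6) by simp
  qed
qed

text \<open>The open set of the normal spaces condition contains a product of open sets. In each factor choose a
  point where the rank of the gradients is maximal.\<close>

lemma normal_spaces_imp_gradients_span:
  fixes A :: "('a::euclidean_space \<Rightarrow> real) set" and \<sigma> :: "'a \<Rightarrow> 'x"
  assumes poly: "\<And>f. f \<in> A \<Longrightarrow> real_polynomial_function f"
    and sub: "\<And>z. subspace ((\<lambda>f. grad f z) ` A)"
    and emb: "\<And>L. L \<in> fibers \<sigma> \<Longrightarrow> \<exists>d. embedded_submanifold d L"
    and sep: "\<And>x y. (\<And>f. f \<in> A \<Longrightarrow> f x = f y) \<Longrightarrow> \<sigma> x = \<sigma> y"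
    and ns: "normal_spaces_condition TYPE('k::finite) \<sigma>"
  shows "\<exists>x :: 'a ^ 'k. span {grad f (x $ j) |f j. f \<in> A} = UNIV"
proof -
  let ?G = "\<lambda>z. (\<lambda>f. grad f z) ` A"
  obtain U :: "('a ^ 'k) set" where U: "open U" "U \<noteq> {}"
    "\<forall>x\<in>U. {\<Sum>i\<in>UNIV. w i |w. \<forall>i. w i \<in> normal_space (fiber \<sigma> (x $ i)) (x $ i)} = UNIV"
    using ns unfolding normal_spaces_condition_def by blast
  obtain x0 where "x0 \<in> U" using U(2) by blast
  then obtain X where X: "\<And>i. open (X i) \<and> x0 $ i \<in> X i" "\<And>y. (\<forall>i. y $ i \<in> X i) \<Longrightarrow> y \<in> U"
    using U(1) unfolding open_vec_def by metis
  have "\<exists>z. z \<in> X i \<and> (\<forall>y. y \<in> X i \<longrightarrow> dim (?G y) \<le> dim (?G z))" for i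
    by (rule ex_has_greatest_nat[of _ "x0 $ i" _ "DIM('a) + 1"]) (use X(1) dim_subset_UNIV in \<open>auto simp: less_Suc_eq_le\<close>)
  then obtain z where z: "\<And>i. z i \<in> X i" "\<And>i y. y \<in> X i \<Longrightarrow> dim (?G y) \<le> dim (?G (z i))" by metis
  define x where "x = (\<chi> i. z i)"
  have "x \<in> U" by (rule X(2)) (simp add: x_def z(1))
  have normal: "normal_space (fiber \<sigma> (x $ i)) (x $ i) \<subseteq> ?G (x $ i)" for i
  proof -
    have "fiber \<sigma> (x $ i) \<in> fibers \<sigma>" by (simp add: fibers_def)
    then obtain d where d: "embedded_submanifold d (fiber \<sigma> (x $ i))" using emb by blast
    show ?thesis
    proof (rule normal_space_le_gradients[where X = "X i", OF poly sub d])
      show "x $ i \<in> fiber \<sigma> (x $ i)" by (simp add: fiber_def)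
      show "y \<in> fiber \<sigma> (x $ i)" if "\<And>f. f \<in> A \<Longrightarrow> f y = f (x $ i)" for y
        using sep[of y "x $ i"] that by (simp add: fiber_def)
      show "open (X i)" using X(1) by blast
      show "x $ i \<in> X i" by (simp add: x_def z(1))
      show "dim (?G y) \<le> dim (?G (x $ i))" if "y \<in> X i" for y using z(2)[OF that] by (simp add: x_def)
    qed
  qed
  have "w \<in> span {grad f (x $ j) |f j. f \<in> A}" for w
  proof -
    have "w \<in> {\<Sum>i\<in>UNIV. w i |w. \<forall>i. w i \<in> normal_space (fiber \<sigma> (x $ i)) (x $ i)}"
      using U(3) \<open>x \<in> U\<close> by blast
    then obtain u where u: "w = (\<Sum>i\<in>UNIV. u i)" "\<And>i. u i \<in> normal_space (fiber \<sigma> (x $ i)) (x $ i)" by blast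
    have "u i \<in> {grad f (x $ j) |f j. f \<in> A}" for i using u(2)[of i] normal[of i] by blast
    then show ?thesis unfolding u(1) by (intro span_sum span_base)
  qed
  then have "span {grad f (x $ j) |f j. f \<in> A} = UNIV" by blast
  then show ?thesis by (rule exI)
qed

section \<open>Spanning along a line\<close>

text \<open>Gaussian elimination without division reduces the number of vectors by one. Independence is lost
  only at zeros of the pivots, which are nonzero polynomials because the family is independent at \<open>t1\<close>.\<close>

lemma independent_family_generic:
  fixes c :: "'i \<Rightarrow> real \<Rightarrow> 'a::euclidean_space"
  assumes "finite I" and "\<And>l b. l \<in> I \<Longrightarrow> \<exists>R. \<forall>t. c l t \<bullet> b = poly R t"
    and "\<And>u. (\<Sum>l\<in>I. u l *\<^sub>R c l t1) = 0 \<Longrightarrow> \<forall>l\<in>I. u l = 0"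
  shows "\<exists>F. finite F \<and> (\<forall>t. t \<notin> F \<longrightarrow> (\<forall>u. (\<Sum>l\<in>I. u l *\<^sub>R c l t) = 0 \<longrightarrow> (\<forall>l\<in>I. u l = 0)))"
  using assms
proof (induction I arbitrary: c rule: finite_induct)
  case empty
  then show ?case by auto
next
  case (insert a I)
  have "c a t1 \<noteq> 0"
  proof
    assume "c a t1 = 0"
    then have "(\<Sum>l\<in>insert a I. (if l = a then 1 else 0) *\<^sub>R c l t1) = 0"
      using insert.hyps by (intro sum.neutral) auto
    from insert.prems(2)[OF this] show False by simp
  qed
  then obtain b where b: "c a t1 \<bullet> b \<noteq> 0" by (metis inner_eq_zero_iff)
  \<comment> \<open>One step of fraction-free elimination with pivot \<open>c a \<bullet> b\<close>.\<close>
  define c' where "c' l t = (c a t \<bullet> b) *\<^sub>R c l t - (c l t \<bullet> b) *\<^sub>R c a t" for l t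
  have sum': "(\<Sum>l\<in>I. u l *\<^sub>R c' l t) = (c a t \<bullet> b) *\<^sub>R (\<Sum>l\<in>I. u l *\<^sub>R c l t) - (\<Sum>l\<in>I. u l * (c l t \<bullet> b)) *\<^sub>R c a t" for u t
    by (simp add: c'_def scaleR_diff_right sum_subtractf scaleR_sum_right scaleR_sum_left mult.commute)
  have "\<exists>F. finite F \<and> (\<forall>t. t \<notin> F \<longrightarrow> (\<forall>u. (\<Sum>l\<in>I. u l *\<^sub>R c' l t) = 0 \<longrightarrow> (\<forall>l\<in>I. u l = 0)))"
  proof (rule insert.IH)
    fix l e assume l: "l \<in> I"
    obtain R1 R2 R3 R4 where "\<forall>t. c a t \<bullet> b = poly R1 t" "\<forall>t. c l t \<bullet> e = poly R2 t"
      "\<forall>t. c l t \<bullet> b = poly R3 t" "\<forall>t. c a t \<bullet> e = poly R4 t"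
      using insert.prems(1) l by (meson insertI1 insertI2)
    then show "\<exists>R. \<forall>t. c' l t \<bullet> e = poly R t"
      by (intro exI[of _ "R1 * R2 - R3 * R4"]) (simp add: c'_def inner_diff_left)
  next
    fix u assume u: "(\<Sum>l\<in>I. u l *\<^sub>R c' l t1) = 0"
    define u' where "u' l = (if l = a then - (\<Sum>l\<in>I. u l * (c l t1 \<bullet> b)) else (c a t1 \<bullet> b) * u l)" for l
    have "(\<Sum>l\<in>I. u' l *\<^sub>R c l t1) = (c a t1 \<bullet> b) *\<^sub>R (\<Sum>l\<in>I. u l *\<^sub>R c l t1)"
      unfolding scaleR_sum_right using insert.hyps by (intro sum.cong) (auto simp: u'_def)
    then have "(\<Sum>l\<in>insert a I. u' l *\<^sub>R c l t1) = 0"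
      using u insert.hyps unfolding sum' by (simp add: u'_def)
    then have u0: "\<forall>l\<in>insert a I. u' l = 0" by (rule insert.prems(2))
    show "\<forall>l\<in>I. u l = 0"
    proof
      fix l assume "l \<in> I"
      then have "u' l = 0" "l \<noteq> a" using u0 insert.hyps by auto
      then show "u l = 0" using b by (simp add: u'_def)
    qed
  qed
  then obtain F where F: "finite F" "\<And>t u. t \<notin> F \<Longrightarrow> (\<Sum>l\<in>I. u l *\<^sub>R c' l t) = 0 \<Longrightarrow> \<forall>l\<in>I. u l = 0" by blast
  obtain R where R: "\<And>t. c a t \<bullet> b = poly R t" using insert.prems(1)[of a b] by blast
  have "R \<noteq> 0" using R[of t1] b by auto
  then have "finite (F \<union> {t. poly R t = 0})" using F(1) poly_roots_finite by blast
  moreover have "\<forall>l\<in>insert a I. u l = 0"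
    if t: "t \<notin> F \<union> {t. poly R t = 0}" and u: "(\<Sum>l\<in>insert a I. u l *\<^sub>R c l t) = 0" for t u
  proof -
    have piv: "c a t \<bullet> b \<noteq> 0" using t R by auto
    have u0: "u a *\<^sub>R c a t + (\<Sum>l\<in>I. u l *\<^sub>R c l t) = 0" using u insert.hyps by simp
    then have "(u a *\<^sub>R c a t + (\<Sum>l\<in>I. u l *\<^sub>R c l t)) \<bullet> b = 0" by simp
    then have "(\<Sum>l\<in>I. u l * (c l t \<bullet> b)) = - (u a * (c a t \<bullet> b))"
      by (simp add: inner_add_left inner_sum_left)
    moreover have "(\<Sum>l\<in>I. u l *\<^sub>R c l t) = - (u a *\<^sub>R c a t)" using u0 by (simp add: eq_neg_iff_add_eq_0 add.commute)
    ultimately have "(\<Sum>l\<in>I. u l *\<^sub>R c' l t) = 0" unfolding sum' by (simp add: mult.commute)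
    then have uI: "\<forall>l\<in>I. u l = 0" using F(2) t by blast
    then have "u a *\<^sub>R c a t = 0" using u0 by simp
    then have "u a = 0" using piv by auto
    then show ?thesis using uI by simp
  qed
  ultimately show ?case by blast
qed

context polarized
begin

lemma gradients_span_along_line:
  assumes good: "span (gradients x UNIV) = UNIV"
  shows "\<exists>F. finite F \<and> (\<forall>t. t \<notin> F \<longrightarrow> span (gradients (P + t *\<^sub>R (x - P)) UNIV) = UNIV)"
proof -
  obtain S \<phi> \<iota> where S: "finite S" "independent S" "span S = UNIV"
    and \<phi>: "\<And>s. s \<in> S \<Longrightarrow> \<phi> s \<in> A" and \<phi>s: "\<And>s. s \<in> S \<Longrightarrow> grad (\<phi> s) (x $ \<iota> s) = s"
    by (rule span_gradients_basis[OF good]) (rule that)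
  define c where "c s t = grad (\<phi> s) ((P + t *\<^sub>R (x - P)) $ \<iota> s)" for s t
  have "\<exists>F. finite F \<and> (\<forall>t. t \<notin> F \<longrightarrow> (\<forall>u. (\<Sum>s\<in>S. u s *\<^sub>R c s t) = 0 \<longrightarrow> (\<forall>s\<in>S. u s = 0)))"
  proof (rule independent_family_generic[OF S(1)])
    fix s b assume "s \<in> S"
    then have "real_polynomial_function (\<lambda>z. grad (\<phi> s) z \<bullet> b)"
      by (intro real_polynomial_inner polynomial_grad A_poly \<phi> polynomial_function_const)
    from polynomial_along_line[OF this, of "P $ \<iota> s" "(x - P) $ \<iota> s"]
    show "\<exists>R. \<forall>t. c s t \<bullet> b = poly R t" by (simp add: c_def)
  next
    fix u assume "(\<Sum>s\<in>S. u s *\<^sub>R c s 1) = 0"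
    moreover have "(\<Sum>s\<in>S. u s *\<^sub>R c s 1) = (\<Sum>s\<in>S. u s *\<^sub>R s)" using \<phi>s by (intro sum.cong) (auto simp: c_def)
    ultimately show "\<forall>s\<in>S. u s = 0" using independentD[OF S(2,1) order_refl] by simp
  qed
  then obtain F where F: "finite F" "\<And>t u. t \<notin> F \<Longrightarrow> (\<Sum>s\<in>S. u s *\<^sub>R c s t) = 0 \<Longrightarrow> \<forall>s\<in>S. u s = 0" by blast
  have "span (gradients (P + t *\<^sub>R (x - P)) UNIV) = UNIV" if t: "t \<notin> F" for t
  proof -
    define M where "M v = (\<Sum>s\<in>S. representation S v s *\<^sub>R c s t)" for v
    have linM: "linear M" unfolding M_def by (rule linear_combine_representation[OF S(2,3)])
    have "inj M"
    proof (rule linear_injective_0[THEN iffD2, OF linM, rule_format])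
      fix v assume "M v = 0"
      then have "\<forall>s\<in>S. representation S v s = 0" unfolding M_def by (rule F(2)[OF t])
      then have "(\<Sum>s\<in>S. representation S v s *\<^sub>R s) = 0" by simp
      then show "v = 0" using sum_representation_basis[OF S(2,3)] by metis
    qed
    then have "surj M" by (rule linear_injective_imp_surjective[OF linM]) (rule refl)
    have "w \<in> span (gradients (P + t *\<^sub>R (x - P)) UNIV)" for w
    proof -
      obtain v where "w = M v" using \<open>surj M\<close> by (rule surjE)
      moreover have "c s t \<in> gradients (P + t *\<^sub>R (x - P)) UNIV" if "s \<in> S" for s
        unfolding c_def gradients_def mem_Collect_eq using \<phi>[OF that]
        by (intro exI[of _ "\<phi> s"] exI[of _ "\<iota> s"]) simp
      then have "M v \<in> span (gradients (P + t *\<^sub>R (x - P)) UNIV)"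
        unfolding M_def by (intro span_sum span_scale span_base)
      ultimately show ?thesis by simp
    qed
    then show ?thesis by blast
  qed
  then show ?thesis using F(1) by blast
qed

end

section \<open>The symmetry group of an algebra of polynomials\<close>

definition symmetries :: "('a::euclidean_space \<Rightarrow> real) set \<Rightarrow> ('a \<Rightarrow>\<^sub>L 'a) set" where
  "symmetries A = {g. orthogonal_transformation (blinfun_apply g) \<and> (\<forall>f\<in>A. \<forall>v. f (blinfun_apply g v) = f v)}"

lemma blinfun_apply_compose: "blinfun_apply (g o\<^sub>L h) = blinfun_apply g \<circ> blinfun_apply h"
  by auto

lemma group_orthogonal_group: "group (orthogonal_group :: ('a::euclidean_space \<Rightarrow>\<^sub>L 'a) monoid)"
proof (rule groupI)
  fix g :: "'a \<Rightarrow>\<^sub>L 'a" assume "g \<in> carrier orthogonal_group"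
  then have g: "orthogonal_transformation (blinfun_apply g)" by (simp add: orthogonal_group_def)
  then obtain h where h: "orthogonal_transformation h" "\<And>v. h (blinfun_apply g v) = v"
    using orthogonal_transformation_inv[OF g] orthogonal_transformation_inj[OF g] by (metis inv_f_f)
  have "blinfun_apply (Blinfun h) = h"
    using orthogonal_transformation_linear[OF h(1)] by (simp add: bounded_linear_Blinfun_apply linear_conv_bounded_linear)
  then show "\<exists>h\<in>carrier orthogonal_group. h \<otimes>\<^bsub>orthogonal_group\<^esub> g = \<one>\<^bsub>orthogonal_group\<^esub>"
    using h by (intro bexI[of _ "Blinfun h"]) (auto simp: orthogonal_group_def intro!: blinfun_eqI)
next
  fix g h :: "'a \<Rightarrow>\<^sub>L 'a"
  assume "g \<in> carrier orthogonal_group" "h \<in> carrier orthogonal_group"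
  then show "g \<otimes>\<^bsub>orthogonal_group\<^esub> h \<in> carrier orthogonal_group"
    using orthogonal_transformation_compose[of "blinfun_apply g" "blinfun_apply h"]
    by (simp add: orthogonal_group_def blinfun_apply_compose)
next
  fix g h k :: "'a \<Rightarrow>\<^sub>L 'a"
  show "g \<otimes>\<^bsub>orthogonal_group\<^esub> h \<otimes>\<^bsub>orthogonal_group\<^esub> k
      = g \<otimes>\<^bsub>orthogonal_group\<^esub> (h \<otimes>\<^bsub>orthogonal_group\<^esub> k)"
    by (rule blinfun_eqI) (simp add: orthogonal_group_def)
next
  fix g :: "'a \<Rightarrow>\<^sub>L 'a"
  show "\<one>\<^bsub>orthogonal_group\<^esub> \<otimes>\<^bsub>orthogonal_group\<^esub> g = g"
    by (rule blinfun_eqI) (simp add: orthogonal_group_def)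
next
  show "\<one>\<^bsub>orthogonal_group\<^esub> \<in> carrier (orthogonal_group :: ('a \<Rightarrow>\<^sub>L 'a) monoid)"
    using orthogonal_transformation_id by (simp add: orthogonal_group_def)
qed

lemma subgroup_symmetries:
  fixes A :: "('a::euclidean_space \<Rightarrow> real) set"
  shows "subgroup (symmetries A) orthogonal_group"
proof (rule group.subgroupI[OF group_orthogonal_group])
  show "symmetries A \<subseteq> carrier orthogonal_group" by (auto simp: symmetries_def orthogonal_group_def)
  have "orthogonal_transformation (blinfun_apply (id_blinfun :: 'a \<Rightarrow>\<^sub>L 'a))"
    using orthogonal_transformation_id by simp
  then have "id_blinfun \<in> symmetries A" by (simp add: symmetries_def)
  then show "symmetries A \<noteq> {}" by blast
  fix g h assume g: "g \<in> symmetries A" and h: "h \<in> symmetries A"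
  have "f (blinfun_apply g (blinfun_apply h v)) = f v" if "f \<in> A" for f v
  proof -
    have "f (blinfun_apply g (blinfun_apply h v)) = f (blinfun_apply h v)" using g that by (simp add: symmetries_def)
    also have "\<dots> = f v" using h that by (simp add: symmetries_def)
    finally show ?thesis .
  qed
  then show "g \<otimes>\<^bsub>orthogonal_group\<^esub> h \<in> symmetries A"
    using g h orthogonal_transformation_compose[of "blinfun_apply g" "blinfun_apply h"]
    by (simp add: symmetries_def orthogonal_group_def blinfun_apply_compose)
next
  fix g assume g: "g \<in> symmetries A"
  let ?i = "m_inv orthogonal_group g"
  have gc: "g \<in> carrier orthogonal_group" using g by (simp add: symmetries_def orthogonal_group_def)
  have "?i \<in> carrier orthogonal_group" using group.inv_closed[OF group_orthogonal_group gc] .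
  moreover have "g o\<^sub>L ?i = id_blinfun"
    using group.r_inv[OF group_orthogonal_group gc] by (simp add: orthogonal_group_def)
  then have "blinfun_apply g (blinfun_apply ?i v) = v" for v
    by (metis blinfun_apply_blinfun_compose blinfun_apply_id_blinfun)
  then have "f (blinfun_apply ?i v) = f v" if "f \<in> A" for f v
    using g that unfolding symmetries_def by (metis (mono_tags, lifting) mem_Collect_eq)
  ultimately show "?i \<in> symmetries A" by (simp add: symmetries_def orthogonal_group_def)
qed

lemma compact_symmetries:
  fixes A :: "('a::euclidean_space \<Rightarrow> real) set"
  assumes "\<And>f. f \<in> A \<Longrightarrow> real_polynomial_function f"
  shows "compact (symmetries A)"
proof -
  have "symmetries A = (\<Inter>v. \<Inter>w. {g. blinfun_apply g v \<bullet> blinfun_apply g w = v \<bullet> w}) \<inter>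
      (\<Inter>f\<in>A. \<Inter>v. {g. f (blinfun_apply g v) = f v})"
    by (auto simp: symmetries_def orthogonal_transformation_def blinfun.bounded_linear_right bounded_linear.linear)
  moreover have "closed {g :: 'a \<Rightarrow>\<^sub>L 'a. f (blinfun_apply g v) = f v}" if "f \<in> A" for f v
  proof -
    have "continuous_on UNIV f"
      using assms[OF that] by (simp add: continuous_on_polymonial_function real_polynomial_function_eq)
    then have "continuous_on UNIV (\<lambda>g :: 'a \<Rightarrow>\<^sub>L 'a. f (blinfun_apply g v))"
      by (rule continuous_on_compose2) (auto intro!: continuous_intros)
    then show ?thesis by (intro closed_Collect_eq continuous_on_const)
  qed
  moreover have "closed {g :: 'a \<Rightarrow>\<^sub>L 'a. blinfun_apply g v \<bullet> blinfun_apply g w = v \<bullet> w}" for v w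
    by (intro closed_Collect_eq continuous_intros)
  ultimately have "closed (symmetries A)" by (auto intro!: closed_Int closed_INT)
  moreover have "norm g \<le> 1" if "g \<in> symmetries A" for g
    using that by (intro norm_blinfun_bound) (auto simp: symmetries_def orthogonal_transformation_norm)
  then have "bounded (symmetries A)" unfolding bounded_iff by blast
  ultimately show ?thesis by (simp add: compact_eq_bounded_closed)
qed

section \<open>Homogeneity\<close>

lemma polynomials_laplacian_subalgebra:
  "laplacian_subalgebra {f :: 'a::euclidean_space \<Rightarrow> real. real_polynomial_function f}"
proof -
  have "real_polynomial_function (\<lambda>x::'a. \<Sum>b\<in>Basis. (x \<bullet> b)\<^sup>2)"
    by (rule real_polynomial_function_sum[OF finite_Basis])
       (rule real_polynomial_function_power[OF real_polynomial_function.intros(1)[OF bounded_linear_inner_left]])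
  then show ?thesis
    unfolding laplacian_subalgebra_def polynomial_subalgebra_def
    by (simp add: real_polynomial_laplacian real_polynomial_function.intros(2,3,4))
qed

lemma polarized_generalized_polarizations:
  fixes i :: "'k::finite" and A :: "('a::euclidean_space \<Rightarrow> real) set"
  assumes A: "\<And>f. f \<in> A \<Longrightarrow> real_polynomial_function f"
  shows "polarized i A (generalized_polarizations i A)"
proof
  let ?\<B> = "{B :: ('a ^ 'k \<Rightarrow> real) set. laplacian_subalgebra B \<and> (\<forall>f\<in>A. (\<lambda>v. f (v $ i)) \<in> B) \<and>
          (\<forall>j l. (\<lambda>v. v $ j \<bullet> v $ l) \<in> B)}"
  have eq: "generalized_polarizations i A = \<Inter>?\<B>" by (simp add: generalized_polarizations_def)
  have nth: "polynomial_function (\<lambda>v :: 'a ^ 'k. v $ j)" for j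
    by (rule polynomial_function_bounded_linear[OF bounded_linear_vec_nth])
  have slot: "real_polynomial_function (\<lambda>v :: 'a ^ 'k. f (v $ i))" if "f \<in> A" for f
    using real_polynomial_function_compose[OF nth[of i] A[OF that]] by (simp add: o_def)
  have inner: "real_polynomial_function (\<lambda>v :: 'a ^ 'k. v $ j \<bullet> v $ l)" for j l
    by (rule real_polynomial_inner[OF nth nth])
  have "{f. real_polynomial_function f} \<in> ?\<B>"
    using polynomials_laplacian_subalgebra slot inner by simp
  then have poly: "generalized_polarizations i A \<subseteq> {f. real_polynomial_function f}" unfolding eq by blast
  show "laplacian_subalgebra (generalized_polarizations i A)"
    using poly unfolding laplacian_subalgebra_def polynomial_subalgebra_def eq by auto
  show "\<And>f. f \<in> A \<Longrightarrow> (\<lambda>v. f (v $ i)) \<in> generalized_polarizations i A" unfolding eq by blast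
  show "\<And>j l. (\<lambda>v. v $ j \<bullet> v $ l) \<in> generalized_polarizations i A" unfolding eq by blast
qed (rule A)

lemma basic_polynomials_iff:
  "f \<in> basic_polynomials \<sigma> \<longleftrightarrow> real_polynomial_function f \<and> (\<forall>x y. \<sigma> x = \<sigma> y \<longrightarrow> f x = f y)"
proof -
  have "f x = f y" if "\<forall>L\<in>fibers \<sigma>. \<forall>x\<in>L. \<forall>y\<in>L. f x = f y" "\<sigma> x = \<sigma> y" for x y
  proof -
    have mem: "fiber \<sigma> x \<in> fibers \<sigma>" "x \<in> fiber \<sigma> x" "y \<in> fiber \<sigma> x"
      using that(2) by (simp_all add: fibers_def fiber_def)
    show ?thesis by (rule bspec[OF bspec[OF bspec[OF that(1) mem(1)] mem(2)] mem(3)])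
  qed
  moreover have "\<forall>L\<in>fibers \<sigma>. \<forall>x\<in>L. \<forall>y\<in>L. f x = f y" if "\<forall>x y. \<sigma> x = \<sigma> y \<longrightarrow> f x = f y"
  proof (intro ballI)
    fix L x y assume "L \<in> fibers \<sigma>" "x \<in> L" "y \<in> L"
    then have "\<sigma> x = \<sigma> y" by (auto simp: fibers_def fiber_def)
    then show "f x = f y" using that by blast
  qed
  ultimately show ?thesis unfolding basic_polynomials_def by blast
qed

lemma basic_grad_subspace:
  "subspace ((\<lambda>f. grad f z) ` basic_polynomials \<sigma>)"
proof (rule subspaceI)
  have "(\<lambda>x. 0) \<in> basic_polynomials \<sigma>" by (simp add: basic_polynomials_iff real_polynomial_function.intros(2))
  then show "0 \<in> (\<lambda>f. grad f z) ` basic_polynomials \<sigma>" by (rule rev_image_eqI) simp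
next
  fix u w assume "u \<in> (\<lambda>f. grad f z) ` basic_polynomials \<sigma>" "w \<in> (\<lambda>f. grad f z) ` basic_polynomials \<sigma>"
  then obtain f g where fg: "f \<in> basic_polynomials \<sigma>" "g \<in> basic_polynomials \<sigma>" "u = grad f z" "w = grad g z" by blast
  then have p: "real_polynomial_function f" "real_polynomial_function g" by (simp_all add: basic_polynomials_iff)
  have "(\<lambda>x. f x + g x) \<in> basic_polynomials \<sigma>"
    using fg(1,2) real_polynomial_function.intros(3)[OF p] unfolding basic_polynomials_iff by metis
  then show "u + w \<in> (\<lambda>f. grad f z) ` basic_polynomials \<sigma>"
    by (rule rev_image_eqI) (simp add: fg(3,4) grad_add p)
next
  fix u and c :: real assume "u \<in> (\<lambda>f. grad f z) ` basic_polynomials \<sigma>"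
  then obtain f where f: "f \<in> basic_polynomials \<sigma>" "u = grad f z" by blast
  then have p: "real_polynomial_function f" by (simp add: basic_polynomials_iff)
  have "real_polynomial_function (\<lambda>x. c * f x)"
    by (rule real_polynomial_function.intros(4)[OF real_polynomial_function.intros(2) p])
  then have "(\<lambda>x. c * f x) \<in> basic_polynomials \<sigma>"
    using f(1) unfolding basic_polynomials_iff by metis
  then show "c *\<^sub>R u \<in> (\<lambda>f. grad f z) ` basic_polynomials \<sigma>"
    by (rule rev_image_eqI) (simp add: f(2) grad_mult[OF real_polynomial_function.intros(2) p])
qed

context polarized
begin

text \<open>Points near \<open>(p, 0, \<dots>, 0)\<close> at which the gradients span are equivalent to points near
  \<open>(q, 0, \<dots>, 0)\<close>, and rigidity provides symmetries that match them. A limit of these symmetries maps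
  \<open>p\<close> to \<open>q\<close>.\<close>

lemma symmetry_exists:
  assumes card: "CARD('k) \<ge> 2" and good: "span (gradients x0 UNIV) = UNIV" and norm2: "(\<lambda>x. x \<bullet> x) \<in> A"
    and pq: "same_values B (axis i p) (axis i q)"
  shows "\<exists>g\<in>symmetries A. blinfun_apply g p = q"
proof -
  obtain F where F: "finite F" "\<And>t. t \<notin> F \<Longrightarrow> span (gradients (axis i p + t *\<^sub>R (x0 - axis i p)) UNIV) = UNIV"
    using gradients_span_along_line[OF good, of "axis i p"] by blast
  have "\<exists>t. t \<in> {0<..<1 / real (Suc n)} - F" for n
  proof -
    have "infinite ({0<..<1 / real (Suc n)} - F)"
      using F(1) by (intro Diff_infinite_finite) (auto simp: infinite_Ioo)
    then show ?thesis by (metis ex_in_conv finite.emptyI)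
  qed
  then obtain t where t: "\<And>n. t n \<in> {0<..<1 / real (Suc n)} - F" by metis
  define x where "x n = axis i p + t n *\<^sub>R (x0 - axis i p)" for n
  have good_x: "span (gradients (x n) UNIV) = UNIV" for n using F(2) t[of n] by (simp add: x_def)
  have "t \<longlonglongrightarrow> 0"
  proof (rule tendsto_sandwich[OF _ _ tendsto_const])
    show "(\<lambda>n. 1 / real (Suc n)) \<longlonglongrightarrow> 0" using LIMSEQ_inverse_real_of_nat by (simp add: inverse_eq_divide)
  qed (use t in \<open>auto intro!: always_eventually less_imp_le\<close>)
  then have "(\<lambda>n. p + t n *\<^sub>R ((x0 - axis i p) $ i)) \<longlonglongrightarrow> p + 0 *\<^sub>R ((x0 - axis i p) $ i)"
    by (intro tendsto_intros)
  then have lim_x: "(\<lambda>n. x n $ i) \<longlonglongrightarrow> p" by (simp add: x_def)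
  have "\<exists>g\<in>symmetries A. p \<bullet> x n $ i \<le> q \<bullet> blinfun_apply g (x n $ i)" for n
  proof -
    obtain y where y: "same_values B (x n) y" "axis i p \<bullet> x n \<le> axis i q \<bullet> y"
      using same_values_equidistant[OF lap pq] by blast
    obtain g where g: "transport g (x n) y" using transport_exists[OF card good_x y(1)] by blast
    then have orth: "orthogonal_transformation g" by (simp add: transport_def)
    interpret linear g using orth by (rule orthogonal_transformation_linear)
    have "g (grad (\<lambda>x. x \<bullet> x) (x n $ i)) = grad (\<lambda>x. x \<bullet> x) (y $ i)"
      using g norm2 unfolding transport_def by blast
    then have gx: "g (x n $ i) = y $ i" by (simp add: grad_norm2 scale)
    have inv: "f (g v) = f v" if "f \<in> A" for f v
    proof -
      have "f (x n $ i + (v - x n $ i)) = f (y $ i + g (v - x n $ i))"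
        by (rule rigidity[OF card y(1) g good_x that])
      then show ?thesis by (simp add: diff gx)
    qed
    have ap: "blinfun_apply (Blinfun g) = g"
      using linear_axioms by (simp add: bounded_linear_Blinfun_apply linear_conv_bounded_linear)
    have "Blinfun g \<in> symmetries A" using orth inv by (simp add: symmetries_def ap)
    moreover have "p \<bullet> x n $ i \<le> q \<bullet> blinfun_apply (Blinfun g) (x n $ i)"
      using y(2) by (simp add: ap gx inner_axis')
    ultimately show ?thesis by blast
  qed
  then obtain g where g: "\<And>n. g n \<in> symmetries A" "\<And>n. p \<bullet> x n $ i \<le> q \<bullet> blinfun_apply (g n) (x n $ i)" by metis
  have "compact (symmetries A)" by (rule compact_symmetries) (rule A_poly)
  then have "\<exists>h\<in>symmetries A. \<exists>s. strict_mono s \<and> (g \<circ> s) \<longlonglongrightarrow> h" using g(1) unfolding compact_def by blast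
  then obtain h s where h: "h \<in> symmetries A" "strict_mono s" "(g \<circ> s) \<longlonglongrightarrow> h" by blast
  have lim_xs: "(\<lambda>n. x (s n) $ i) \<longlonglongrightarrow> p" using LIMSEQ_subseq_LIMSEQ[OF lim_x h(2)] by (simp add: o_def)
  have "p \<bullet> p \<le> q \<bullet> blinfun_apply h p"
  proof (rule LIMSEQ_le)
    show "(\<lambda>n. p \<bullet> x (s n) $ i) \<longlonglongrightarrow> p \<bullet> p" by (intro tendsto_intros lim_xs)
    show "(\<lambda>n. q \<bullet> blinfun_apply (g (s n)) (x (s n) $ i)) \<longlonglongrightarrow> q \<bullet> blinfun_apply h p"
      using h(3) by (intro tendsto_intros lim_xs) (simp add: o_def)
  qed (use g(2) in blast)
  moreover have "q \<bullet> q = p \<bullet> p" using slot_value[OF norm2 pq, of i] by simp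
  moreover have "blinfun_apply h p \<bullet> blinfun_apply h p = p \<bullet> p"
    using h(1) by (simp add: symmetries_def orthogonal_transformation_def)
  ultimately have "(blinfun_apply h p - q) \<bullet> (blinfun_apply h p - q) \<le> 0"
    by (simp add: inner_diff_left inner_diff_right inner_commute[of "blinfun_apply h p" q])
  then have "blinfun_apply h p = q" by (metis inner_gt_zero_iff eq_iff_diff_eq_0 not_less)
  then show ?thesis using h(1) by blast
qed

end

text \<open>The assumption on the restricted partition says that the fibers are the common level sets of the
  restrictions of generalized polarizations. In particular these restrictions are basic, and basic
  polynomials separate the fibers.\<close>

lemma restricted_polarizations:
  fixes \<sigma> :: "'a::euclidean_space \<Rightarrow> 'x::metric_space" and i :: "'k::finite"
  defines "A \<equiv> basic_polynomials \<sigma>"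
  defines "B \<equiv> generalized_polarizations i A"
  assumes part: "restrict_partition (level_partition B) (range (axis i)) = (\<lambda>L. axis i ` L) ` fibers \<sigma>"
  shows "F \<in> B \<Longrightarrow> (\<lambda>v. F (axis i v)) \<in> A" "same_values B (axis i x) (axis i y) \<Longrightarrow> \<sigma> x = \<sigma> y"
proof -
  have A_poly: "real_polynomial_function f" if "f \<in> A" for f using that unfolding A_def basic_polynomials_iff by blast
  interpret polarized i A B unfolding B_def by (rule polarized_generalized_polarizations) (rule A_poly)
  have inj: "axis i u = axis i w \<longleftrightarrow> u = w" for u w :: 'a by (auto simp: axis_eq_axis)
  show "(\<lambda>v. F (axis i v)) \<in> A" if F: "F \<in> B"
  proof -
    have "linear (axis i :: 'a \<Rightarrow> 'a ^ 'k)" by (intro linearI) (simp_all add: vec_eq_iff axis_def)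
    then have "polynomial_function (axis i :: 'a \<Rightarrow> 'a ^ 'k)"
      by (simp add: polynomial_function_bounded_linear linear_conv_bounded_linear)
    from real_polynomial_function_compose[OF this lap_poly[OF lap F]]
    have "real_polynomial_function (\<lambda>v. F (axis i v))" by (simp add: o_def)
    moreover have "F (axis i u) = F (axis i w)" if uw: "\<sigma> u = \<sigma> w" for u w
    proof -
      let ?L = "fiber \<sigma> u"
      have L: "?L \<in> fibers \<sigma>" "u \<in> ?L" "w \<in> ?L" using uw by (simp_all add: fibers_def fiber_def)
      have "axis i ` ?L \<in> restrict_partition (level_partition B) (range (axis i))" unfolding part by (rule imageI) (rule L(1))
      then have "\<exists>M. axis i ` ?L = M \<inter> range (axis i) \<and> M \<in> level_partition B \<and> M \<inter> range (axis i) \<noteq> {}"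
        unfolding restrict_partition_def mem_Collect_eq .
      then obtain M where M: "M \<in> level_partition B" "axis i ` ?L = M \<inter> range (axis i)" by (elim exE conjE) (rule that)
      from M(1)[unfolded level_partition_def] obtain z where "M = {(x, y). \<forall>f\<in>B. f x = f y} `` {z}"
        by (rule quotientE) (rule that)
      moreover have "axis i ` ?L \<subseteq> M" unfolding M(2) by (rule Int_lower1)
      then have "axis i u \<in> M" "axis i w \<in> M" using L(2,3) by auto
      ultimately have "F z = F (axis i u)" "F z = F (axis i w)" using F by auto
      then show ?thesis by simp
    qed
    ultimately show ?thesis unfolding A_def basic_polynomials_iff by blast
  qed
  show "\<sigma> x = \<sigma> y" if xy: "same_values B (axis i x) (axis i y)"
  proof -
    let ?M = "{(x, y). \<forall>f\<in>B. f x = f y} `` {axis i x}"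
    have "?M \<in> level_partition B" unfolding level_partition_def by (rule quotientI) simp
    have mem: "axis i x \<in> ?M" "axis i y \<in> ?M" using xy by (auto simp: same_values_def)
    note \<open>?M \<in> level_partition B\<close>
    moreover have "?M \<inter> range (axis i) \<noteq> {}" using mem(1) by blast
    ultimately have "?M \<inter> range (axis i) \<in> restrict_partition (level_partition B) (range (axis i))"
      unfolding restrict_partition_def by (intro CollectI exI[of _ ?M] conjI refl)
    then obtain L where L: "?M \<inter> range (axis i) = axis i ` L" "L \<in> fibers \<sigma>"
      unfolding part by (rule imageE) (rule that)
    have "axis i x \<in> axis i ` L" "axis i y \<in> axis i ` L" unfolding L(1)[symmetric] using mem by simp_all
    then have "x \<in> L" "y \<in> L" using inj by auto
    then show ?thesis using L(2) by (auto simp: fibers_def fiber_def)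
  qed
qed

theorem theorem33:
  fixes \<sigma> :: "'a::euclidean_space \<Rightarrow> 'x::metric_space"
    and i :: "'k::finite"
  assumes "infinitesimal_manifold_submetry \<sigma>"
    and "CARD('k) \<ge> 2"
    and "normal_spaces_condition TYPE('k) \<sigma>"
    and "restrict_partition
           (level_partition (generalized_polarizations i (basic_polynomials \<sigma>)))
           (range (axis i)) = (\<lambda>L. axis i ` L) ` fibers \<sigma>"
  shows "homogeneous (fibers \<sigma>)"
proof -
  define A where "A = basic_polynomials \<sigma>"
  define B where "B = generalized_polarizations i A"
  have A_poly: "real_polynomial_function f" if "f \<in> A" for f using that unfolding A_def basic_polynomials_iff by blast
  have A_const: "f x = f y" if "f \<in> A" "\<sigma> x = \<sigma> y" for f x y
    using that unfolding A_def basic_polynomials_iff by blast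
  interpret polarized i A B unfolding B_def by (rule polarized_generalized_polarizations) (rule A_poly)
  have restr: "(\<lambda>v. F (axis i v)) \<in> A" if "F \<in> B" for F
    using restricted_polarizations(1)[OF assms(4)] that by (simp add: A_def B_def)
  have same_fiber: "same_values B (axis i x) (axis i y) \<longleftrightarrow> \<sigma> x = \<sigma> y" for x y
  proof
    show "\<sigma> x = \<sigma> y" if "same_values B (axis i x) (axis i y)"
      using restricted_polarizations(2)[OF assms(4)] that by (simp add: A_def B_def)
    show "same_values B (axis i x) (axis i y)" if "\<sigma> x = \<sigma> y"
      using A_const[OF restr that] by (simp add: same_values_def)
  qed
  have sep: "\<sigma> x = \<sigma> y" if "\<And>f. f \<in> A \<Longrightarrow> f x = f y" for x y
  proof -
    have "same_values B (axis i x) (axis i y)"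
      unfolding same_values_def using that[OF restr] by blast
    then show ?thesis using same_fiber by blast
  qed
  have norm2: "(\<lambda>x. x \<bullet> x) \<in> A" using restr[OF inner_mem[of i i]] by simp
  have emb: "\<exists>d. embedded_submanifold d L" if "L \<in> fibers \<sigma>" for L
    using assms(1) that unfolding infinitesimal_manifold_submetry_def manifold_submetry_def by blast
  have "\<exists>x0 :: 'a ^ 'k. span {grad f (x0 $ j) |f j. f \<in> A} = UNIV"
  proof (rule normal_spaces_imp_gradients_span[where \<sigma> = \<sigma>])
    show "subspace ((\<lambda>f. grad f z) ` A)" for z unfolding A_def by (rule basic_grad_subspace)
    show "\<sigma> x = \<sigma> y" if "\<And>f. f \<in> A \<Longrightarrow> f x = f y" for x y using that by (rule sep)
  qed (use A_poly emb assms(3) in blast)+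
  then obtain x0 :: "'a ^ 'k" where "span {grad f (x0 $ j) |f j. f \<in> A} = UNIV" by (rule exE)
  then have good: "span (gradients x0 UNIV) = UNIV" by (simp add: gradients_def)
  have "fiber \<sigma> p = (\<lambda>g. blinfun_apply g p) ` symmetries A" for p
  proof (intro subset_antisym subsetI)
    fix q assume "q \<in> fiber \<sigma> p"
    then have "same_values B (axis i p) (axis i q)" using same_fiber by (simp add: fiber_def)
    then obtain g where "g \<in> symmetries A" "blinfun_apply g p = q"
      using symmetry_exists[OF assms(2) good norm2] by blast
    then show "q \<in> (\<lambda>g. blinfun_apply g p) ` symmetries A" by blast
  next
    fix q assume "q \<in> (\<lambda>g. blinfun_apply g p) ` symmetries A"
    then obtain g where g: "g \<in> symmetries A" "q = blinfun_apply g p" by blast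
    have "\<sigma> q = \<sigma> p" by (rule sep) (use g in \<open>simp add: symmetries_def\<close>)
    then show "q \<in> fiber \<sigma> p" by (simp add: fiber_def)
  qed
  then have "fibers \<sigma> = range (\<lambda>x. (\<lambda>g. blinfun_apply g x) ` symmetries A)"
    unfolding fibers_def by simp
  then show ?thesis
    unfolding homogeneous_def using subgroup_symmetries[of A] compact_symmetries[of A] A_poly by blast
qed

end
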